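(* Let $f:[0,\infty)\to[0,\infty)$ be a directly Riemann integrable function on $[0,\infty)$, and let $j=j(t)$ be a positive integer-valued function. Put $m:=\mathbb{E}\xi$. Assume that either (a) or (b) below holds: (a) the distribution of $\xi$ is nonlattice; for some $r$ either [$r\in(1,2]$ and $\mathbb{E}\xi^r<\infty$] or [$r\in(1,2)$ and $\mathbb{P}\{\xi>t\}\sim bt^{-r}$ as $t\to\infty$ for some $b>0$]; with the same $r$, $\mathbb{E}(\eta\wedge t)=O(t^{2-r})$ as $t\to\infty$; and $j(t)=o(t^{(r-1)/2})$ as $t\to\infty$; (b) the distribution of $\xi$ is spread-out, $\mathbb{E}\xi^3<\infty$, $\mathbb{E}\eta^2<\infty$, and $j(t)=o(t^{2/3})$ as $t\to\infty$. Then $m<\infty$ and $$(f\ast V_j)(t)=\int_{[0,t]}f(t-y)\,dV_j(y)\ \sim\ \Big(\frac1m\int_0^\infty f(y)\,dy\Big)V_{j-1}(t),\qquad t\to\infty,\quad j=j(t).$$ Moreover, $V_{j-1}(t)$ on the right-hand side can be replaced with $\dfrac{t^{j-1}}{m^{j-1}(j-1)!}$ in case (a), and with $\dfrac{t^{j-1}}{m^{j-1}(j-1)!}\exp\left(\dfrac{\gamma_0 m j^2}{t}\right)$ in case (b), where $\gamma_0:=\dfrac{\mathbb{E}\xi^2}{2m^2}-\dfrac{\mathbb{E}\eta}{m}$.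
   Context: Let $(\xi_i,\eta_i)_{i\in\mathbb{N}}$ be independent copies of a random vector $(\xi,\eta)$ whose components are almost surely positive and arbitrarily dependent. Put $S_0:=0$, $S_i:=\xi_1+\cdots+\xi_i$ and $T_i:=S_{i-1}+\eta_i$ for $i\in\mathbb{N}$ (a perturbed random walk). Let $N(t):=\sum_{i\ge1}\mathbf{1}_{\{T_i\le t\}}$ and $V(t):=\mathbb{E}N(t)$ for $t\ge0$, and $V(t):=0$ for $t<0$. Define $V_0:=\mathbf{1}_{[0,\infty)}$, $V_1:=V$ and, for $j\ge2$ and $t\ge0$, $V_j(t):=\int_{[0,t]}V_{j-1}(t-y)\,dV(y)$ (Lebesgue–Stieltjes integral), i.e. $V_j$ is the $j$-fold Lebesgue–Stieltjes convolution power of $V$. (Equivalently, for $j\ge 1$, $V_j(t)$ is the expected number of $j$th generation individuals born in $[0,t]$ in the general branching process started by one ancestor at time $0$ in which each individual independently produces offspring at times, relative to its own birth, distributed as $(T_i)_{i\in\mathbb{N}}$.) The distribution of $\xi$ is nonlattice if it is not concentrated on any set $\{dn:n=0,1,2,\ldots\}$ with $d>0$. It is spread-out if some convolution power of the distribution function $t\mapsto\mathbb{P}\{\xi\le t\}$ has a (nontrivial) absolutely continuous component with respect to Lebesgue measure. A (Borel) function $f:[0,\infty)\to[0,\infty)$ is directly Riemann integrable on $[0,\infty)$ if $\overline\sigma(h):=h\sum_{n\ge1}\sup_{(n-1)h\le y<nh}f(y)<\infty$ for each $h>0$ and $\lim_{h\to0+}(\overline\sigma(h)-\underline\sigma(h))=0$,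 where $\underline\sigma(h):=h\sum_{n\ge1}\inf_{(n-1)h\le y<nh}f(y)$. Here $x\wedge y=\min(x,y)$. The notation $u(t)\sim v(t)$ means $u(t)/v(t)\to1$ as $t\to\infty$; a relation $u(t)\sim c\,v(t)$ with a constant $c\ge0$ is understood as $u(t)/v(t)\to c$. *)

theory Defs
  imports "HOL-Probability.Probability" "HOL-Library.Landau_Symbols"
begin

section \<open>The perturbed random walk and the convolution powers of its mean function\<close>

definition rw :: "(nat \<Rightarrow> 'a \<Rightarrow> real) \<Rightarrow> nat \<Rightarrow> 'a \<Rightarrow> real" where
  "rw xi n \<omega> = (\<Sum>i=1..n. xi i \<omega>)"

text \<open>The sequences are indexed by the positive integers; the value at index 0 is never used.\<close>

definition prw :: "(nat \<Rightarrow> 'a \<Rightarrow> real) \<Rightarrow> (nat \<Rightarrow> 'a \<Rightarrow> real) \<Rightarrow> nat \<Rightarrow> 'a \<Rightarrow> real" where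
  "prw xi eta i \<omega> = rw xi (i - 1) \<omega> + eta i \<omega>"

definition prw_count ::
    "(nat \<Rightarrow> 'a \<Rightarrow> real) \<Rightarrow> (nat \<Rightarrow> 'a \<Rightarrow> real) \<Rightarrow> real \<Rightarrow> 'a \<Rightarrow> ennreal" where
  "prw_count xi eta t \<omega> = (\<Sum>n. if prw xi eta (Suc n) \<omega> \<le> t then 1 else 0)"

text \<open>The expectation below is finite when the steps are independent, identically distributed
  and almost surely positive, so that \<^const>\<open>enn2real\<close> loses nothing there.\<close>

definition prw_mean ::
    "'a measure \<Rightarrow> (nat \<Rightarrow> 'a \<Rightarrow> real) \<Rightarrow> (nat \<Rightarrow> 'a \<Rightarrow> real) \<Rightarrow> real \<Rightarrow> real" where
  "prw_mean M xi eta t =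
     (if t < 0 then 0 else enn2real (\<integral>\<^sup>+ \<omega>. prw_count xi eta t \<omega> \<partial>M))"

text \<open>\<^term>\<open>interval_measure F\<close> is the Lebesgue-Stieltjes measure of a nondecreasing
  right-continuous \<^term>\<open>F\<close>. If \<^term>\<open>F\<close> vanishes on the negative half-line, a jump of
  \<^term>\<open>F\<close> at 0 is an atom at 0, which an integral over \<^term>\<open>{0..t}\<close> includes.\<close>

definition stieltjes_conv :: "(real \<Rightarrow> real) \<Rightarrow> (real \<Rightarrow> real) \<Rightarrow> real \<Rightarrow> real" where
  "stieltjes_conv f F t = (LINT y:{0..t}|interval_measure F. f (t - y))"

text \<open>If \<^term>\<open>F\<close> vanishes on the negative half-line, so do all of the functions below: the
  range of integration is then empty.\<close>

fun stieltjes_conv_power :: "(real \<Rightarrow> real) \<Rightarrow> nat \<Rightarrow> real \<Rightarrow> real" where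
  "stieltjes_conv_power F 0 = indicator {0..}"
| "stieltjes_conv_power F (Suc 0) = F"
| "stieltjes_conv_power F (Suc (Suc j)) = stieltjes_conv (stieltjes_conv_power F (Suc j)) F"


section \<open>Direct Riemann integrability\<close>

definition upper_sum :: "(real \<Rightarrow> real) \<Rightarrow> real \<Rightarrow> ennreal" where
  "upper_sum f h = ennreal h * (\<Sum>n. SUP y\<in>{real n * h..<real (Suc n) * h}. ennreal (f y))"

definition lower_sum :: "(real \<Rightarrow> real) \<Rightarrow> real \<Rightarrow> ennreal" where
  "lower_sum f h = ennreal h * (\<Sum>n. INF y\<in>{real n * h..<real (Suc n) * h}. ennreal (f y))"

text \<open>Meant for functions that are nonnegative on \<^term>\<open>{0..}\<close>.\<close>

definition directly_riemann_integrable :: "(real \<Rightarrow> real) \<Rightarrow> bool" where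
  "directly_riemann_integrable f \<longleftrightarrow>
     (\<forall>h>0. upper_sum f h < \<infinity>) \<and>
     ((\<lambda>h. upper_sum f h - lower_sum f h) \<longlongrightarrow> 0) (at_right 0)"


section \<open>Properties of distributions on the line\<close>

definition nonlattice :: "real measure \<Rightarrow> bool" where
  "nonlattice \<mu> \<longleftrightarrow> (\<forall>d>0. \<not> (AE x in \<mu>. x \<in> {d * real n | n. True}))"

primrec convolution_power :: "real measure \<Rightarrow> nat \<Rightarrow> real measure" where
  "convolution_power \<mu> 0 = return borel 0"
| "convolution_power \<mu> (Suc n) = (\<mu> \<star> convolution_power \<mu> n)"

text \<open>\<^term>\<open>\<alpha>\<close> and \<^term>\<open>\<sigma>\<close> form the Lebesgue decomposition of \<^term>\<open>\<mu>\<close> with respect to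
  Lebesgue measure.\<close>

definition has_ac_component :: "real measure \<Rightarrow> bool" where
  "has_ac_component \<mu> \<longleftrightarrow>
     (\<exists>\<alpha> \<sigma>. sets \<alpha> = sets borel \<and> sets \<sigma> = sets borel \<and>
        (\<forall>A\<in>sets borel. emeasure \<mu> A = emeasure \<alpha> A + emeasure \<sigma> A) \<and>
        absolutely_continuous lborel \<alpha> \<and>
        (\<exists>S\<in>null_sets lborel. emeasure \<sigma> (UNIV - S) = 0) \<and>
        emeasure \<alpha> UNIV > 0)"

definition spread_out :: "real measure \<Rightarrow> bool" where
  "spread_out \<mu> \<longleftrightarrow> (\<exists>n\<ge>1. has_ac_component (convolution_power \<mu> n))"


section \<open>Asymptotic relations and the two sets of assumptions\<close>

text \<open>The relation u(t) ~ c v(t), read as u(t)/v(t) tending to \<^term>\<open>c\<close>, which may be 0. The first conjunct rules out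
  the convention \<^term>\<open>x / 0 = (0::real)\<close>.\<close>

definition sim_const :: "(real \<Rightarrow> real) \<Rightarrow> real \<Rightarrow> (real \<Rightarrow> real) \<Rightarrow> bool" where
  "sim_const u c v \<longleftrightarrow>
     eventually (\<lambda>t. v t \<noteq> 0) at_top \<and> ((\<lambda>t. u t / v t) \<longlongrightarrow> c) at_top"

definition nonlattice_assms ::
    "'a measure \<Rightarrow> ('a \<Rightarrow> real) \<Rightarrow> ('a \<Rightarrow> real) \<Rightarrow> (real \<Rightarrow> nat) \<Rightarrow> bool" where
  "nonlattice_assms M \<xi> \<eta> j \<longleftrightarrow>
     nonlattice (distr M borel \<xi>) \<and>
     (\<exists>r::real.
        ((1 < r \<and> r \<le> 2 \<and> integrable M (\<lambda>\<omega>. \<xi> \<omega> powr r)) \<or>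
         (1 < r \<and> r < 2 \<and>
            (\<exists>b>0. sim_const (\<lambda>t. measure M {\<omega>\<in>space M. \<xi> \<omega> > t}) b (\<lambda>t. t powr (- r))))) \<and>
        (\<lambda>t. LINT \<omega>|M. min (\<eta> \<omega>) t) \<in> O[at_top](\<lambda>t. t powr (2 - r)) \<and>
        (\<lambda>t. real (j t)) \<in> o[at_top](\<lambda>t. t powr ((r - 1) / 2)))"

definition spread_out_assms ::
    "'a measure \<Rightarrow> ('a \<Rightarrow> real) \<Rightarrow> ('a \<Rightarrow> real) \<Rightarrow> (real \<Rightarrow> nat) \<Rightarrow> bool" where
  "spread_out_assms M \<xi> \<eta> j \<longleftrightarrow>
     spread_out (distr M borel \<xi>) \<and>
     integrable M (\<lambda>\<omega>. \<xi> \<omega> ^ 3) \<and> integrable M (\<lambda>\<omega>. \<eta> \<omega> ^ 2) \<and>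
     (\<lambda>t. real (j t)) \<in> o[at_top](\<lambda>t. t powr (2 / 3))"

end

theory Submission
  imports Defs
begin

text \<open>Let \<open>F\<close> and \<open>G\<close> be the laws of \<open>\<xi>\<close> and \<open>\<eta>\<close>, let \<open>\<nu>\<close> be the measure with distribution
  function \<open>V\<close>, and let \<open>F0\<close> be the law on the half-line with density \<open>P(\<xi> > x) / m\<close>. A renewal process
  whose first step has law \<open>F0\<close> is stationary, so that its mean measure is \<open>L\<close>, Lebesgue measure on the
  half-line divided by \<open>m\<close>. For the perturbed walk this says \<open>F0 * \<nu> = G * L\<close>. All of these measures
  commute under convolution, and the \<open>k\<close>-th convolution power of \<open>L\<close> has the distribution function
  \<open>P k t = t ^ k / (m ^ k * k!)\<close>. Hence, if \<open>Z\<close> and \<open>W\<close> are sums of \<open>k\<close> independent variables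
  with laws \<open>F0\<close> and \<open>G\<close>,

    \<open>E V\<^sub>k (t - Z) = E (P k (t - W))\<close>

  for all \<open>k\<close> and \<open>t\<close> (lemma \<open>delay_identity\<close>). The identity is exact and has no remainder term, and its
  two sides are averages of monotone functions. So the asymptotics of \<open>V\<^sub>k (t)\<close> for growing \<open>k\<close> only
  depend on how large \<open>Z\<close> and \<open>W\<close> are on the scale \<open>t / k\<close>, on which \<open>P k\<close> varies.

  Under the nonlattice assumptions the truncated means of both laws are \<open>O (t powr (2 - r))\<close>, and \<open>k\<^sup>2 * t powr (1 - r)\<close>
  tends to 0. By Markov's inequality \<open>Z\<close> and \<open>W\<close> are negligible on the scale \<open>t / k\<close>, and
  \<open>V\<^sub>k (t) \<sim> P k t\<close> (lemma \<open>v_asymp_truncated_mean\<close>).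

  Under the spread-out assumptions both laws have second moments. Now \<open>Z\<close> and \<open>W\<close> deviate from their means by about
  \<open>sqrt k\<close>, which is negligible on the scale \<open>t / k\<close> as soon as \<open>k ^ 3 / t\<^sup>2\<close> tends to 0. The
  means themselves shift the argument \<open>t\<close> by \<open>k\<close> times the difference of the two means, which is
  \<open>\<gamma>\<^sub>0 * m\<close>. Shifting the argument of \<open>P k\<close> by this amount multiplies it by about
  \<open>exp (\<gamma>\<^sub>0 * m * k\<^sup>2 / t)\<close> (lemma \<open>v_asymp_second_moment\<close>).

  As to \<open>f\<close>, write \<open>f * V\<^sub>j = (f * V) * V\<^sub>k\<close> with \<open>k = j - 1\<close>. By the key renewal theorem \<open>f * V\<close> is
  bounded and converges to \<open>c\<close>, the integral of \<open>f\<close> divided by \<open>m\<close>. The only part of \<open>V\<^sub>k\<close> that could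
  spoil the convergence of the quotient to \<open>c\<close> is the mass that \<open>V\<^sub>k\<close> has close to \<open>t\<close>, and this mass is
  at most a constant times \<open>V\<^sub>k\<^sub>-\<^sub>1 (t)\<close>, which is of smaller order than \<open>V\<^sub>k (t)\<close> because \<open>k / t\<close> tends
  to 0 (lemma \<open>renewal_power_limit\<close>).

  The key renewal theorem follows from Blackwell's theorem, and the latter from the identity
  \<open>F0 * \<nu> = G * L\<close> once more. For a tent-like function \<open>g\<close>, the function \<open>Z = g * V\<close> is bounded, uniformly
  continuous and asymptotically harmonic for \<open>F\<close>. Since \<open>F\<close> is nonlattice, its increments over
  any fixed step vanish at infinity (lemma \<open>increment_tendsto_0\<close>), and by the identity its
  average with respect to \<open>F0\<close> converges to the integral of \<open>g\<close> divided by \<open>m\<close>. A spread-out law is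
  nonlattice, so this serves both cases.\<close>

section \<open>Two facts on limits\<close>

lemma filterlim_diff_at_top: "filterlim (\<lambda>t. t - c) at_top (at_top :: real filter)"
  using filterlim_tendsto_add_at_top[OF tendsto_const[of "- c"] filterlim_ident] by simp

lemma small_argument:
  fixes h :: "real \<Rightarrow> real"
  assumes "isCont h 0" "h 0 < l" "0 < b"
  obtains e where "0 < e" "e < b" "h e < l"
proof -
  have "(h \<longlongrightarrow> h 0) (at_right 0)"
    using assms(1) unfolding isCont_def by (rule tendsto_mono[OF at_le[OF subset_UNIV]])
  then have "eventually (\<lambda>e. h e < l) (at_right 0)" by (rule order_tendstoD) fact
  moreover have "eventually (\<lambda>e. e \<in> {0<..<b}) (at_right 0)" by (rule eventually_at_right_real) fact
  ultimately have "eventually (\<lambda>e. h e < l \<and> e \<in> {0<..<b}) (at_right 0)" by (rule eventually_conj)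
  from eventually_happens'[OF trivial_limit_at_right_real this]
  obtain e where "h e < l" "e \<in> {0<..<b}" by blast
  then show thesis by (intro that[of e]) simp_all
qed

section \<open>Convolution with a measure as an operator on functions\<close>

text \<open>Convolutions are handled as operators on nonnegative functions on the whole line; functions on
  the half-line are extended by 0. Convolution powers of measures then become iterates of operators,
  and Fubini's theorem becomes commutativity.\<close>

definition conv :: "real measure \<Rightarrow> (real \<Rightarrow> ennreal) \<Rightarrow> real \<Rightarrow> ennreal" where
  "conv \<mu> g t = (\<integral>\<^sup>+ y. g (t - y) \<partial>\<mu>)"

locale borel_sf = sigma_finite_measure \<mu> for \<mu> :: "real measure" +
  assumes sets_eq [measurable_cong, simp]: "sets \<mu> = sets borel"

lemma (in borel_sf) conv_measurable [measurable]:
  assumes [measurable]: "g \<in> borel_measurable borel"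
  shows "conv \<mu> g \<in> borel_measurable borel"
  unfolding conv_def[abs_def] by measurable

lemma (in borel_sf) conv_pow_measurable [measurable]:
  assumes "g \<in> borel_measurable borel"
  shows "(conv \<mu> ^^ n) g \<in> borel_measurable borel"
  using assms by (induction n) (simp_all add: conv_measurable)

lemma conv_commute:
  assumes "borel_sf \<mu>" "borel_sf \<nu>" and [measurable]: "g \<in> borel_measurable borel"
  shows "conv \<mu> (conv \<nu> g) = conv \<nu> (conv \<mu> g)"
proof
  fix t
  interpret m: borel_sf \<mu> by fact
  interpret n: borel_sf \<nu> by fact
  interpret p: pair_sigma_finite \<mu> \<nu> ..
  have [measurable]: "(\<lambda>(x, y). g (t - x - y)) \<in> borel_measurable (\<mu> \<Otimes>\<^sub>M \<nu>)" by measurable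
  have "conv \<mu> (conv \<nu> g) t = (\<integral>\<^sup>+ x. \<integral>\<^sup>+ y. g (t - x - y) \<partial>\<nu> \<partial>\<mu>)"
    by (simp add: conv_def)
  also have "\<dots> = (\<integral>\<^sup>+ y. \<integral>\<^sup>+ x. g (t - x - y) \<partial>\<mu> \<partial>\<nu>)"
    by (rule p.Fubini'[symmetric]) measurable
  also have "\<dots> = conv \<nu> (conv \<mu> g) t"
    by (simp add: conv_def algebra_simps)
  finally show "conv \<mu> (conv \<nu> g) t = conv \<nu> (conv \<mu> g) t" .
qed

lemma conv_pow_commute:
  assumes "borel_sf \<mu>" "borel_sf \<nu>" "g \<in> borel_measurable borel"
  shows "conv \<mu> ((conv \<nu> ^^ n) g) = (conv \<nu> ^^ n) (conv \<mu> g)"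
  using conv_commute[OF assms(1,2)] borel_sf.conv_pow_measurable[OF assms(2,3)]
  by (induction n) simp_all

lemma conv_mono: "(\<And>x. g x \<le> h x) \<Longrightarrow> conv \<mu> g t \<le> conv \<mu> h t"
  unfolding conv_def by (intro nn_integral_mono) auto

lemma conv_pow_mono: "(\<And>x. g x \<le> h x) \<Longrightarrow> (conv \<mu> ^^ n) g t \<le> (conv \<mu> ^^ n) h t"
  by (induction n arbitrary: t) (simp_all add: conv_mono)

context borel_sf
begin

lemma conv_add:
  assumes [measurable]: "g \<in> borel_measurable borel" "h \<in> borel_measurable borel"
  shows "conv \<mu> (\<lambda>x. g x + h x) t = conv \<mu> g t + conv \<mu> h t"
  unfolding conv_def by (rule nn_integral_add) measurable

lemma conv_cmult:
  assumes [measurable]: "g \<in> borel_measurable borel"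
  shows "conv \<mu> (\<lambda>x. c * g x) t = c * conv \<mu> g t"
  unfolding conv_def by (rule nn_integral_cmult) measurable

lemma conv_pow_add:
  assumes [measurable]: "g \<in> borel_measurable borel" "h \<in> borel_measurable borel"
  shows "(conv \<mu> ^^ n) (\<lambda>x. g x + h x) t = (conv \<mu> ^^ n) g t + (conv \<mu> ^^ n) h t"
proof (induction n arbitrary: t)
  case (Suc n)
  then have "(conv \<mu> ^^ n) (\<lambda>x. g x + h x) = (\<lambda>t. (conv \<mu> ^^ n) g t + (conv \<mu> ^^ n) h t)" by auto
  then show ?case by (simp add: conv_add)
qed simp

lemma conv_pow_cmult:
  assumes [measurable]: "g \<in> borel_measurable borel"
  shows "(conv \<mu> ^^ n) (\<lambda>x. c * g x) t = c * (conv \<mu> ^^ n) g t"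
proof (induction n arbitrary: t)
  case (Suc n)
  then have "(conv \<mu> ^^ n) (\<lambda>x. c * g x) = (\<lambda>t. c * (conv \<mu> ^^ n) g t)" by auto
  then show ?case by (simp add: conv_cmult)
qed simp

text \<open>The asymptotic estimates below all combine the same ingredients: a pointwise inequality between real
  functions, a main term and an error term. This passes from the pointwise inequality to the averages.\<close>

lemma conv_pow_affine_bound:
  fixes p q r :: "real \<Rightarrow> real"
  assumes [measurable]: "q \<in> borel_measurable borel" "r \<in> borel_measurable borel"
    and le: "\<And>u. p u \<le> q u + c * r u" and nn: "\<And>u. 0 \<le> q u" "\<And>u. 0 \<le> r u" "0 \<le> c" "0 \<le> Q" "0 \<le> R"
    and Q: "(conv \<mu> ^^ n) (\<lambda>u. ennreal (q u)) t \<le> ennreal Q"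
    and R: "(conv \<mu> ^^ n) (\<lambda>u. ennreal (r u)) t \<le> ennreal R"
  shows "(conv \<mu> ^^ n) (\<lambda>u. ennreal (p u)) t \<le> ennreal (Q + c * R)"
proof -
  have "(conv \<mu> ^^ n) (\<lambda>u. ennreal (p u)) t
      \<le> (conv \<mu> ^^ n) (\<lambda>u. ennreal (q u) + ennreal c * ennreal (r u)) t"
    using le nn by (intro conv_pow_mono)
      (simp add: ennreal_mult'[symmetric] ennreal_plus[symmetric] ennreal_leI del: ennreal_plus)
  also have "\<dots> = (conv \<mu> ^^ n) (\<lambda>u. ennreal (q u)) t + ennreal c * (conv \<mu> ^^ n) (\<lambda>u. ennreal (r u)) t"
    by (subst conv_pow_add) (simp_all add: conv_pow_cmult)
  also have "\<dots> \<le> ennreal Q + ennreal c * ennreal R"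
    by (intro add_mono mult_left_mono Q R) simp
  also have "\<dots> = ennreal (Q + c * R)"
    using nn by (simp add: ennreal_mult'[symmetric] ennreal_plus[symmetric] del: ennreal_plus)
  finally show ?thesis .
qed

end

definition exp_mom :: "real measure \<Rightarrow> real \<Rightarrow> ennreal" where
  "exp_mom \<mu> \<theta> = (\<integral>\<^sup>+ x. ennreal (exp (- \<theta> * x)) \<partial>\<mu>)"

text \<open>Exponential functions are eigenfunctions of convolution operators.\<close>

lemma (in borel_sf) conv_pow_exp:
  "(conv \<mu> ^^ n) (\<lambda>u. ennreal (exp (\<theta> * u))) t = ennreal (exp (\<theta> * t)) * exp_mom \<mu> \<theta> ^ n"
proof (induction n arbitrary: t)
  case (Suc n)
  then have "(conv \<mu> ^^ n) (\<lambda>u. ennreal (exp (\<theta> * u))) = (\<lambda>t. exp_mom \<mu> \<theta> ^ n * ennreal (exp (\<theta> * t)))"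
    by (auto simp: mult.commute)
  moreover have "conv \<mu> (\<lambda>t. ennreal (exp (\<theta> * t))) t = ennreal (exp (\<theta> * t)) * exp_mom \<mu> \<theta>"
    unfolding conv_def exp_mom_def
    by (subst nn_integral_cmult[symmetric])
       (auto simp: ennreal_mult'[symmetric] exp_add[symmetric] algebra_simps)
  ultimately show ?case
    using conv_cmult[of "\<lambda>t. ennreal (exp (\<theta> * t))" "exp_mom \<mu> \<theta> ^ n" t] by (simp add: mult_ac)
qed simp

locale pos_law = prob_space \<mu> for \<mu> :: "real measure" +
  assumes sets_pos [measurable_cong, simp]: "sets \<mu> = sets borel"
    and nonneg: "AE x in \<mu>. 0 \<le> x"

sublocale pos_law \<subseteq> borel_sf
  by unfold_locales simp

context pos_law
begin

lemma conv_const [simp]: "conv \<mu> (\<lambda>_. c) t = c"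
  unfolding conv_def by (simp add: emeasure_space_1)

lemma conv_pow_const [simp]: "(conv \<mu> ^^ n) (\<lambda>_. c) t = c"
proof (induction n arbitrary: t)
  case (Suc n)
  then have "(conv \<mu> ^^ n) (\<lambda>_. c) = (\<lambda>_. c)" by auto
  then show ?case by simp
qed simp

text \<open>Averaging over the past of \<open>t\<close> decreases a nondecreasing function.\<close>

lemma conv_pow_le_mono:
  assumes "\<And>x y. x \<le> y \<Longrightarrow> g x \<le> g y"
  shows "(conv \<mu> ^^ n) g t \<le> g t"
proof (induction n arbitrary: t)
  case (Suc n)
  have "(conv \<mu> ^^ Suc n) g t \<le> conv \<mu> g t"
    by (simp add: conv_mono Suc)
  also have "\<dots> \<le> (\<integral>\<^sup>+ y. g t \<partial>\<mu>)"
    unfolding conv_def using nonneg assms by (intro nn_integral_mono_AE) auto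
  also have "\<dots> = g t" by (simp add: emeasure_space_1)
  finally show ?case .
qed simp

end

section \<open>Measures recovered from their distribution functions\<close>

lemma interval_measure_cdf:
  assumes [measurable_cong, simp]: "sets \<rho> = sets borel"
    and fin: "\<And>t. emeasure \<rho> {..t} < \<infinity>"
  shows "interval_measure (\<lambda>t. measure \<rho> {..t}) = \<rho>"
proof -
  let ?F = "\<lambda>t. measure \<rho> {..t::real}"
  have fm: "{..t} \<in> fmeasurable \<rho>" for t using fin by (auto intro: fmeasurableI)
  have mono: "x \<le> y \<Longrightarrow> ?F x \<le> ?F y" for x y
    by (rule measure_mono_fmeasurable[OF _ _ fm]) auto
  have e: "emeasure \<rho> {..t} = ennreal (?F t)" for t
    using fin[of t] by (intro emeasure_eq_ennreal_measure) auto
  have rc: "continuous (at_right a) ?F" for a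
  proof -
    have "\<forall>e>0. \<exists>d>0. ?F (a + d) - ?F a < e"
    proof safe
      fix e :: real assume "e > 0"
      have "(\<lambda>n. measure \<rho> {..a + 1 / real (Suc n)}) \<longlonglongrightarrow> measure \<rho> (\<Inter>n. {..a + 1 / real (Suc n)})"
      proof (rule Lim_measure_decseq)
        show "decseq (\<lambda>n. {..a + 1 / real (Suc n)})"
        proof (rule antimonoI)
          fix i n :: nat assume "i \<le> n"
          then have "1 / real (Suc n) \<le> 1 / real (Suc i)" by (intro frac_le) auto
          then show "{..a + 1 / real (Suc n)} \<subseteq> {..a + 1 / real (Suc i)}" by auto
        qed
      qed (use fin in \<open>auto simp: less_top[symmetric]\<close>)
      also have "(\<Inter>n. {..a + 1 / real (Suc n)}) = {..a}"
      proof (safe; simp)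
        fix x assume "\<forall>n. x \<le> a + 1 / (1 + real n)"
        then have *: "x \<le> a + 1 / real (Suc n)" for n by (simp add: add.commute)
        have "(\<lambda>n. a + 1 / real (Suc n)) \<longlonglongrightarrow> a + 0"
          by (intro tendsto_add tendsto_const) (rule LIMSEQ_Suc[OF lim_1_over_n])
        then show "x \<le> a" using * by (intro LIMSEQ_le_const[of _ _ x]) auto
      next
        fix x and n :: nat assume "x \<le> a" then show "x \<le> a + 1 / (1 + real n)"
          by (simp add: add_increasing2)
      qed
      finally have "eventually (\<lambda>n. ?F (a + 1 / real (Suc n)) < ?F a + e) sequentially"
        using \<open>e > 0\<close> by (intro order_tendstoD) auto
      then obtain n where "?F (a + 1 / real (Suc n)) < ?F a + e"
        by (auto simp: eventually_sequentially)
      then show "\<exists>d>0. ?F (a + d) - ?F a < e"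
        by (intro exI[of _ "1 / real (Suc n)"]) auto
    qed
    then show ?thesis using continuous_at_right_real_increasing[of ?F a, OF mono] by simp
  qed
  let ?E = "range (\<lambda>(a, b). {a <.. b::real})"
  show ?thesis
  proof (rule measure_eqI_generator_eq[where E = "?E" and A = "\<lambda>n. {- real n <.. real n}" and \<Omega> = UNIV])
    show "Int_stable ?E"
    proof (rule Int_stableI, clarify)
      fix a b c d :: real
      have "{a<..b} \<inter> {c<..d} = {max a c <.. min b d}" by auto
      then show "{a<..b} \<inter> {c<..d} \<in> ?E" by auto
    qed
    show "\<And>X. X \<in> ?E \<Longrightarrow> emeasure (interval_measure ?F) X = emeasure \<rho> X"
    proof clarify
      fix a b :: real
      show "emeasure (interval_measure ?F) {a<..b} = emeasure \<rho> {a<..b}"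
      proof (cases "a \<le> b")
        case True
        have "emeasure \<rho> {a<..b} = emeasure \<rho> ({..b} - {..a})" by (rule arg_cong[of _ _ "emeasure \<rho>"]) auto
        also have "\<dots> = emeasure \<rho> {..b} - emeasure \<rho> {..a}"
          using fin True by (intro emeasure_Diff) (auto simp: less_top[symmetric])
        also have "\<dots> = ennreal (?F b - ?F a)"
          by (simp add: e ennreal_minus)
        finally show ?thesis using True mono rc by (simp add: emeasure_interval_measure_Ioc)
      qed simp
    qed
    show "sets (interval_measure ?F) = sigma_sets UNIV ?E"
      by (simp add: borel_sigma_sets_Ioc)
    show "sets \<rho> = sigma_sets UNIV ?E"
      by (simp add: borel_sigma_sets_Ioc)
    show "(\<Union>n. {- real n<..real n}) = UNIV"
    proof (safe; simp)
      fix x :: real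
      obtain n where "\<bar>x\<bar> < real n" using reals_Archimedean2 by blast
      then show "\<exists>n. - real n < x \<and> x \<le> real n" by (intro exI[of _ n]) auto
    qed
    show "\<And>n. emeasure (interval_measure ?F) {- real n<..real n} \<noteq> \<infinity>"
      using mono rc by (subst emeasure_interval_measure_Ioc) auto
  qed auto
qed

section \<open>The mean measure of the perturbed walk and its convolution powers\<close>

lemma (in prob_space) borel_sf_distr:
  assumes "X \<in> borel_measurable M"
  shows "borel_sf (distr M borel X)"
proof -
  interpret X: prob_space "distr M borel X" using assms by (rule prob_space_distr)
  show ?thesis by (intro borel_sf.intro borel_sf_axioms.intro) (simp_all add: X.sigma_finite_measure_axioms)
qed

lemma (in prob_space) nn_integral_indep_add:
  fixes X Y :: "'a \<Rightarrow> real"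
  assumes ind: "indep_var borel X borel Y" and [measurable]: "g \<in> borel_measurable borel"
  shows "(\<integral>\<^sup>+ \<omega>. g (t - (X \<omega> + Y \<omega>)) \<partial>M) = (\<integral>\<^sup>+ \<omega>. conv (distr M borel X) g (t - Y \<omega>) \<partial>M)"
proof -
  have [measurable]: "X \<in> borel_measurable M" "Y \<in> borel_measurable M"
    using ind by (auto dest: indep_var_rv1 indep_var_rv2)
  let ?F = "distr M borel X" and ?G = "distr M borel Y"
  interpret F: borel_sf ?F by (rule borel_sf_distr) simp
  interpret G: borel_sf ?G by (rule borel_sf_distr) simp
  interpret P: pair_sigma_finite ?F ?G ..
  have "(\<integral>\<^sup>+ \<omega>. g (t - (X \<omega> + Y \<omega>)) \<partial>M)
      = (\<integral>\<^sup>+ z. g (t - (fst z + snd z)) \<partial>distr M (borel \<Otimes>\<^sub>M borel) (\<lambda>\<omega>. (X \<omega>, Y \<omega>)))"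
    by (subst nn_integral_distr) auto
  also have "\<dots> = (\<integral>\<^sup>+ z. g (t - (fst z + snd z)) \<partial>(?F \<Otimes>\<^sub>M ?G))"
    using ind by (simp add: indep_var_distribution_eq)
  also have "\<dots> = (\<integral>\<^sup>+ y. \<integral>\<^sup>+ x. g (t - (x + y)) \<partial>?F \<partial>?G)"
    by (subst P.nn_integral_snd[symmetric]) auto
  also have "\<dots> = (\<integral>\<^sup>+ y. conv ?F g (t - y) \<partial>?G)"
    by (simp add: conv_def algebra_simps)
  also have "\<dots> = (\<integral>\<^sup>+ \<omega>. conv ?F g (t - Y \<omega>) \<partial>M)"
    by (subst nn_integral_distr) auto
  finally show ?thesis .
qed

locale prw_setup = prob_space M for M :: "'a measure" +
  fixes \<xi> \<eta> :: "'a \<Rightarrow> real" and xi eta :: "nat \<Rightarrow> 'a \<Rightarrow> real"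
  assumes xi_meas [measurable]: "\<xi> \<in> borel_measurable M"
    and eta_meas [measurable]: "\<eta> \<in> borel_measurable M"
    and xi_pos: "AE \<omega> in M. \<xi> \<omega> > 0" and eta_pos: "AE \<omega> in M. \<eta> \<omega> > 0"
    and indep: "indep_vars (\<lambda>_. borel) (\<lambda>i \<omega>. (xi i \<omega>, eta i \<omega>)) {1..}"
    and ident: "\<And>i. i \<ge> 1 \<Longrightarrow>
           distr M borel (\<lambda>\<omega>. (xi i \<omega>, eta i \<omega>)) = distr M borel (\<lambda>\<omega>. (\<xi> \<omega>, \<eta> \<omega>))"
begin

abbreviation "F \<equiv> distr M borel \<xi>"
abbreviation "G \<equiv> distr M borel \<eta>"

lemma pair_meas: "i \<ge> 1 \<Longrightarrow> (\<lambda>\<omega>. (xi i \<omega>, eta i \<omega>)) \<in> borel_measurable M"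
  using indep by (auto simp: indep_vars_def)

lemma borel_fst_snd: "fst \<in> borel_measurable (borel :: (real \<times> real) measure)"
    "snd \<in> borel_measurable (borel :: (real \<times> real) measure)"
  by (intro borel_measurable_continuous_onI continuous_intros)+

lemma xi_i_meas: "i \<ge> 1 \<Longrightarrow> xi i \<in> borel_measurable M"
  using measurable_compose[OF pair_meas borel_fst_snd(1)] by simp

lemma eta_i_meas: "i \<ge> 1 \<Longrightarrow> eta i \<in> borel_measurable M"
  using measurable_compose[OF pair_meas borel_fst_snd(2)] by simp

lemma law_xi: "i \<ge> 1 \<Longrightarrow> distr M borel (xi i) = F"
  using arg_cong[OF ident[of i], of "\<lambda>N. distr N borel fst"] pair_meas[of i]
  by (simp add: distr_distr borel_fst_snd comp_def borel_measurable_Pair)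

lemma law_eta: "i \<ge> 1 \<Longrightarrow> distr M borel (eta i) = G"
  using arg_cong[OF ident[of i], of "\<lambda>N. distr N borel snd"] pair_meas[of i]
  by (simp add: distr_distr borel_fst_snd comp_def borel_measurable_Pair)

lemma indep_xi: "indep_var borel (xi (Suc n)) borel (rw xi n)"
proof -
  have "indep_vars (\<lambda>_. borel) (\<lambda>i \<omega>. fst (xi i \<omega>, eta i \<omega>)) {1..}"
    by (rule indep_vars_compose2[OF indep]) (rule borel_fst_snd)
  then have "indep_vars (\<lambda>_. borel) xi (insert (Suc n) {1..n})"
    by (auto intro: indep_vars_subset)
  then show ?thesis using indep_vars_sum[of "{1..n}" "Suc n" xi] by (simp add: rw_def[abs_def])
qed

text \<open>Independence is applied to the family that takes the first component of the pairs up to index \<open>n\<close> and the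
  second one at index \<open>n + 1\<close>. So the two components of a single pair never occur together, and may depend on each other.\<close>

lemma indep_eta: "indep_var borel (eta (Suc n)) borel (rw xi n)"
proof -
  let ?X = "\<lambda>i \<omega>. if i \<le> n then xi i \<omega> else eta i \<omega>"
  have "indep_vars (\<lambda>_. borel) (\<lambda>i \<omega>. (if i \<le> n then fst else snd) (xi i \<omega>, eta i \<omega>)) {1..}"
    by (rule indep_vars_compose2[OF indep]) (simp add: borel_fst_snd)
  also have "(\<lambda>i \<omega>. (if i \<le> n then fst else snd) (xi i \<omega>, eta i \<omega>)) = ?X" by auto
  finally have "indep_vars (\<lambda>_. borel) ?X (insert (Suc n) {1..n})"
    by (auto intro: indep_vars_subset)
  then have "indep_var borel (?X (Suc n)) borel (\<lambda>\<omega>. \<Sum>i\<in>{1..n}. ?X i \<omega>)"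
    by (intro indep_vars_sum) auto
  moreover have "(\<lambda>\<omega>. \<Sum>i\<in>{1..n}. ?X i \<omega>) = rw xi n"
    by (auto simp: rw_def intro!: sum.cong)
  ultimately show ?thesis by simp
qed

lemma rw_meas [measurable]: "rw xi n \<in> borel_measurable M"
  using indep_xi by (rule indep_var_rv2)

lemma prw_meas [measurable]: "prw xi eta (Suc n) \<in> borel_measurable M"
proof -
  note eta_i_meas[of "Suc n", simplified, measurable]
  show ?thesis unfolding prw_def[abs_def] by simp
qed

sublocale F: pos_law F
  using prob_space_distr[OF xi_meas] xi_pos
  by (auto simp: pos_law_def pos_law_axioms_def AE_distr_iff elim: eventually_mono)

sublocale G: pos_law G
  using prob_space_distr[OF eta_meas] eta_pos
  by (auto simp: pos_law_def pos_law_axioms_def AE_distr_iff elim: eventually_mono)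

lemma law_rw:
  assumes [measurable]: "g \<in> borel_measurable borel"
  shows "(\<integral>\<^sup>+ \<omega>. g (t - rw xi n \<omega>) \<partial>M) = (conv F ^^ n) g t"
  using assms
proof (induction n arbitrary: g)
  case 0
  then show ?case by (simp add: rw_def emeasure_space_1)
next
  case (Suc n)
  have "(\<integral>\<^sup>+ \<omega>. g (t - rw xi (Suc n) \<omega>) \<partial>M) = (\<integral>\<^sup>+ \<omega>. g (t - (xi (Suc n) \<omega> + rw xi n \<omega>)) \<partial>M)"
    by (simp add: rw_def add.commute)
  also have "\<dots> = (\<integral>\<^sup>+ \<omega>. conv F g (t - rw xi n \<omega>) \<partial>M)"
    using nn_integral_indep_add[OF indep_xi Suc.prems] by (simp add: law_xi)
  also have "\<dots> = (conv F ^^ Suc n) g t"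
    using Suc.IH[OF F.conv_measurable[OF Suc.prems]] by (simp add: funpow_Suc_right del: funpow.simps)
  finally show ?case .
qed

lemma law_prw:
  assumes [measurable]: "g \<in> borel_measurable borel"
  shows "(\<integral>\<^sup>+ \<omega>. g (t - prw xi eta (Suc n) \<omega>) \<partial>M) = (conv F ^^ n) (conv G g) t"
proof -
  have "(\<integral>\<^sup>+ \<omega>. g (t - prw xi eta (Suc n) \<omega>) \<partial>M) = (\<integral>\<^sup>+ \<omega>. g (t - (eta (Suc n) \<omega> + rw xi n \<omega>)) \<partial>M)"
    by (simp add: prw_def add.commute)
  also have "\<dots> = (\<integral>\<^sup>+ \<omega>. conv G g (t - rw xi n \<omega>) \<partial>M)"
    using nn_integral_indep_add[OF indep_eta assms] by (simp add: law_eta)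
  also have "\<dots> = (conv F ^^ n) (conv G g) t"
    by (rule law_rw) simp
  finally show ?thesis .
qed

text \<open>The image of counting measure times \<open>M\<close> under the points of the walk. In this form sums over the
  points are integrals, and Tonelli's theorem applies.\<close>

definition \<nu> :: "real measure" where
  "\<nu> = distr (count_space (UNIV :: nat set) \<Otimes>\<^sub>M M) borel (\<lambda>(n, \<omega>). prw xi eta (Suc n) \<omega>)"

lemma sets_\<nu> [simp, measurable_cong]: "sets \<nu> = sets borel"
  by (simp add: \<nu>_def)

lemma nn_integral_\<nu>:
  assumes [measurable]: "h \<in> borel_measurable borel"
  shows "(\<integral>\<^sup>+ y. h y \<partial>\<nu>) = (\<Sum>n. \<integral>\<^sup>+ \<omega>. h (prw xi eta (Suc n) \<omega>) \<partial>M)"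
proof -
  interpret C: sigma_finite_measure "count_space (UNIV :: nat set)"
    by (rule sigma_finite_measure_count_space)
  have [measurable]: "(\<lambda>(n, \<omega>). prw xi eta (Suc n) \<omega>) \<in> borel_measurable (count_space UNIV \<Otimes>\<^sub>M M)"
    by (rule measurable_pair_measure_countable1) auto
  have "(\<integral>\<^sup>+ y. h y \<partial>\<nu>) = (\<integral>\<^sup>+ z. h (case z of (n, \<omega>) \<Rightarrow> prw xi eta (Suc n) \<omega>) \<partial>(count_space UNIV \<Otimes>\<^sub>M M))"
    unfolding \<nu>_def by (subst nn_integral_distr) auto
  also have "\<dots> = (\<integral>\<^sup>+ n. \<integral>\<^sup>+ \<omega>. h (prw xi eta (Suc n) \<omega>) \<partial>M \<partial>count_space UNIV)"
    by (subst nn_integral_fst[symmetric]) auto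
  finally show ?thesis by (simp add: nn_integral_count_space_nat)
qed

lemma conv_\<nu>:
  assumes [measurable]: "g \<in> borel_measurable borel"
  shows "conv \<nu> g t = (\<Sum>n. (conv F ^^ n) (conv G g) t)"
  unfolding conv_def[of \<nu>] by (subst nn_integral_\<nu>) (simp_all add: law_prw)

text \<open>This strict inequality is where the positivity of the steps enters: it makes the \<open>n\<close>-th point of the walk
  exceed \<open>t\<close> with probability exponentially close to 1, so that \<open>\<nu>\<close> is locally finite.\<close>

lemma exp_mom_F_less_1: "exp_mom F 1 < 1"
proof -
  have [measurable]: "(\<lambda>x::real. ennreal (exp (- 1 * x))) \<in> borel_measurable borel" by measurable
  have *: "AE x in F. 0 < x" using xi_pos by (simp add: AE_distr_iff)
  have one: "(\<integral>\<^sup>+ x. 1 \<partial>F) = 1" by (subst nn_integral_const) (simp only: F.emeasure_space_1 mult_1)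
  have "(\<integral>\<^sup>+ x. ennreal (exp (- 1 * x)) \<partial>F) < (\<integral>\<^sup>+ x. 1 \<partial>F)"
  proof (rule nn_integral_less)
    have "(\<integral>\<^sup>+ x. ennreal (exp (- 1 * x)) \<partial>F) \<le> (\<integral>\<^sup>+ x. 1 \<partial>F)"
      using F.nonneg by (intro nn_integral_mono_AE) (auto simp: ennreal_le_1)
    then show "(\<integral>\<^sup>+ x. ennreal (exp (- 1 * x)) \<partial>F) \<noteq> \<infinity>"
      unfolding one by (auto simp: top_unique)
    show "AE x in F. ennreal (exp (- 1 * x)) \<le> 1"
      using F.nonneg by (auto simp: ennreal_le_1)
    show "\<not> (AE x in F. 1 \<le> ennreal (exp (- 1 * x)))"
    proof
      assume "AE x in F. 1 \<le> ennreal (exp (- 1 * x))"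
      with * have "AE x in F. False"
        by eventually_elim (simp add: ennreal_1[symmetric] ennreal_le_iff del: ennreal_1)
      then show False using F.AE_False by simp
    qed
  qed auto
  then show ?thesis unfolding one by (simp add: exp_mom_def)
qed

lemma exp_mom_G_le_1: "exp_mom G 1 \<le> 1"
proof -
  have "(\<integral>\<^sup>+ x. ennreal (exp (- 1 * x)) \<partial>G) \<le> (\<integral>\<^sup>+ x. 1 \<partial>G)"
    using G.nonneg by (intro nn_integral_mono_AE) (auto simp: ennreal_le_1)
  also have "\<dots> = 1" by (subst nn_integral_const) (simp only: G.emeasure_space_1 mult_1)
  finally show ?thesis by (simp add: exp_mom_def)
qed

lemma conv_FG_exp_le:
  "(conv F ^^ n) (conv G (\<lambda>u. ennreal (exp u))) t \<le> ennreal (exp t) * exp_mom F 1 ^ n"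
proof -
  have "conv G (\<lambda>u. ennreal (exp u)) x \<le> ennreal (exp x)" for x
    using G.conv_pow_exp[of 1 1 x] exp_mom_G_le_1 mult_left_mono[of "exp_mom G 1" 1 "ennreal (exp x)"] by simp
  then have "(conv F ^^ n) (conv G (\<lambda>u. ennreal (exp u))) t \<le> (conv F ^^ n) (\<lambda>u. ennreal (exp u)) t"
    by (rule conv_pow_mono)
  then show ?thesis using F.conv_pow_exp[of n 1 t] by simp
qed

lemma conv_\<nu>_exp_finite: "conv \<nu> (\<lambda>u. ennreal (exp u)) t < \<infinity>"
proof -
  obtain r where r: "exp_mom F 1 = ennreal r" "0 \<le> r" "r < 1"
    using exp_mom_F_less_1 by (cases "exp_mom F 1") (auto simp: ennreal_less_iff ennreal_1[symmetric] simp del: ennreal_1)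
  have "conv \<nu> (\<lambda>u. ennreal (exp u)) t \<le> (\<Sum>n. ennreal (exp t) * exp_mom F 1 ^ n)"
    by (subst conv_\<nu>) (auto intro!: suminf_le conv_FG_exp_le simp del: ennreal_suminf_cmult)
  also have "\<dots> = (\<Sum>n. ennreal (exp t * r ^ n))"
    using r by (simp add: ennreal_power ennreal_mult)
  also have "\<dots> = ennreal (\<Sum>n. exp t * r ^ n)"
    using r by (intro suminf_ennreal_eq) (auto intro!: summable_sums summable_mult summable_geometric)
  finally show ?thesis by (simp add: le_less_trans)
qed

abbreviation H :: "real \<Rightarrow> ennreal" where "H \<equiv> indicator {0..}"

lemma conv_H: "sets \<mu> = sets borel \<Longrightarrow> conv \<mu> H t = emeasure \<mu> {..t}"
  unfolding conv_def
  by (subst nn_integral_indicator[symmetric]) (auto intro!: nn_integral_cong simp: indicator_def simp del: nn_integral_indicator)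

lemma conv_\<nu>_H_finite: "conv \<nu> H t < \<infinity>"
proof -
  have "conv \<nu> H t \<le> conv \<nu> (\<lambda>u. ennreal (exp u)) t"
    by (rule conv_mono) (auto simp: indicator_def ennreal_1[symmetric] simp del: ennreal_1)
  then show ?thesis using conv_\<nu>_exp_finite by (rule le_less_trans)
qed

lemma \<nu>_finite: "emeasure \<nu> {..t} < \<infinity>"
  using conv_\<nu>_H_finite by (simp add: conv_H)

lemma AE_prw_pos: "AE \<omega> in M. prw xi eta (Suc n) \<omega> > 0"
proof -
  have pos: "AE \<omega> in M. xi i \<omega> > 0" if "i \<ge> 1" for i
  proof -
    have "AE x in F. x > 0" using xi_pos by (simp add: AE_distr_iff)
    then have "AE x in distr M borel (xi i). x > 0" by (simp only: law_xi[OF that])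
    then show ?thesis using that by (simp add: AE_distr_iff xi_i_meas)
  qed
  have "AE x in G. x > 0" using eta_pos by (simp add: AE_distr_iff)
  then have "AE x in distr M borel (eta (Suc n)). x > 0" by (simp only: law_eta[of "Suc n", simplified])
  then have e: "AE \<omega> in M. eta (Suc n) \<omega> > 0" by (simp add: AE_distr_iff eta_i_meas)
  have "AE \<omega> in M. \<forall>i\<in>{1..n}. xi i \<omega> > 0"
    by (rule AE_finite_allI) (auto intro: pos)
  with e show ?thesis
  proof eventually_elim
    case (elim \<omega>)
    have "0 \<le> (\<Sum>i\<in>{1..n}. xi i \<omega>)" using elim by (intro sum_nonneg) (auto intro: less_imp_le)
    then show ?case using elim by (simp add: prw_def rw_def)
  qed
qed

lemma \<nu>_nonpos_null: "emeasure \<nu> {..0} = 0"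
proof -
  have "emeasure \<nu> {..0} = (\<integral>\<^sup>+ y. indicator {..0} y \<partial>\<nu>)" by simp
  also have "\<dots> = (\<Sum>n. \<integral>\<^sup>+ \<omega>. indicator {..0} (prw xi eta (Suc n) \<omega>) \<partial>M)"
    by (rule nn_integral_\<nu>) simp
  also have "\<dots> = (\<Sum>n. 0)"
  proof (rule arg_cong[of _ _ suminf], rule ext)
    fix n
    have "(\<integral>\<^sup>+ \<omega>. indicator {..0} (prw xi eta (Suc n) \<omega>) \<partial>M) = (\<integral>\<^sup>+ \<omega>. 0 \<partial>M)"
      using AE_prw_pos[of n] by (intro nn_integral_cong_AE) (auto simp: indicator_def)
    then show "(\<integral>\<^sup>+ \<omega>. indicator {..0} (prw xi eta (Suc n) \<omega>) \<partial>M) = 0" by simp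
  qed
  finally show ?thesis by simp
qed

abbreviation "V \<equiv> prw_mean M xi eta"

lemma V_eq: "V t = measure \<nu> {..t}"
proof (cases "t < 0")
  case True
  have "emeasure \<nu> {..t} \<le> emeasure \<nu> {..0}" using True by (intro emeasure_mono) auto
  then show ?thesis using True by (simp add: prw_mean_def measure_def \<nu>_nonpos_null)
next
  case False
  have "(\<integral>\<^sup>+ \<omega>. prw_count xi eta t \<omega> \<partial>M) = (\<Sum>n. \<integral>\<^sup>+ \<omega>. indicator {..t} (prw xi eta (Suc n) \<omega>) \<partial>M)"
    unfolding prw_count_def
    by (subst nn_integral_suminf[symmetric]) (auto intro!: nn_integral_cong arg_cong[of _ _ suminf] simp: indicator_def)
  also have "\<dots> = emeasure \<nu> {..t}"
    by (subst nn_integral_\<nu>[symmetric]) auto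
  finally show ?thesis using False by (simp add: prw_mean_def measure_def)
qed

lemma interval_measure_V: "interval_measure V = \<nu>"
  using interval_measure_cdf[OF sets_\<nu> \<nu>_finite] by (simp add: V_eq[abs_def])

lemma borel_sf_cdf:
  assumes [simp]: "sets \<rho> = sets borel" and fin: "\<And>t. emeasure \<rho> {..t::real} < \<infinity>"
  shows "borel_sf \<rho>"
proof -
  have sp: "space \<rho> = UNIV" using sets_eq_imp_space_eq[of \<rho> borel] by simp
  have "sigma_finite_measure \<rho>"
  proof
    show "\<exists>A. countable A \<and> A \<subseteq> sets \<rho> \<and> \<Union>A = space \<rho> \<and> (\<forall>a\<in>A. emeasure \<rho> a \<noteq> \<infinity>)"
    proof (intro exI conjI)
      show "countable (range (\<lambda>n. {..real n}))" by simp
      show "\<Union> (range (\<lambda>n. {..real n})) = space \<rho>" by (auto simp: sp intro: real_arch_simple)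
    qed (use fin in \<open>auto simp: less_top\<close>)
  qed
  then show ?thesis by (simp add: borel_sf_def borel_sf_axioms_def)
qed

sublocale \<nu>: borel_sf \<nu>
  by (rule borel_sf_cdf) (auto intro: \<nu>_finite[unfolded infinity_ennreal_def])

abbreviation "Vj \<equiv> stieltjes_conv_power V"

lemma H_meas: "H \<in> borel_measurable borel" by simp

lemma AE_\<nu>: "AE y in \<nu>. 0 < y"
  by (rule AE_I[OF _ \<nu>_nonpos_null]) auto

lemma conv_\<nu>_pow_H_vanish: "t < 0 \<Longrightarrow> (conv \<nu> ^^ n) H t = 0"
proof (induction n arbitrary: t)
  case (Suc n)
  have "(conv \<nu> ^^ Suc n) H t = (\<integral>\<^sup>+ y. 0 \<partial>\<nu>)"
    unfolding funpow.simps comp_def conv_def[of \<nu> "(conv \<nu> ^^ n) H"]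
    using AE_\<nu> Suc by (intro nn_integral_cong_AE) auto
  then show ?case by simp
qed (auto simp: indicator_def)

lemma conv_\<nu>_pow_H_mono: "s \<le> t \<Longrightarrow> (conv \<nu> ^^ n) H s \<le> (conv \<nu> ^^ n) H t"
  by (induction n arbitrary: s t) (auto simp: conv_def indicator_def intro!: nn_integral_mono)

lemma conv_\<nu>_pow_H_finite: "(conv \<nu> ^^ n) H t < \<infinity>"
proof (induction n arbitrary: t)
  case (Suc n)
  have "(conv \<nu> ^^ Suc n) H t \<le> (\<integral>\<^sup>+ y. (conv \<nu> ^^ n) H t * indicator {..t} y \<partial>\<nu>)"
    unfolding funpow.simps comp_def conv_def[of \<nu> "(conv \<nu> ^^ n) H"]
    using AE_\<nu> conv_\<nu>_pow_H_vanish
    by (intro nn_integral_mono_AE) (auto simp: indicator_def intro!: conv_\<nu>_pow_H_mono elim!: eventually_mono)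
  also have "\<dots> = (conv \<nu> ^^ n) H t * emeasure \<nu> {..t}"
    by (subst nn_integral_cmult) auto
  also have "\<dots> < \<infinity>" using Suc \<nu>_finite by (simp add: ennreal_mult_less_top)
  finally show ?case .
qed (auto simp: indicator_def)

text \<open>The recursion of \<^const>\<open>stieltjes_conv_power\<close> takes its integrand from one power and its measure from
  another. The induction therefore carries two statements along: the value of the \<open>j\<close>-th power, and that
  its Stieltjes measure acts as the \<open>j\<close>-th iterate of the operator of \<open>\<nu>\<close>.\<close>

lemma Vj_conv_pow:
  "ennreal (Vj (Suc n) t) = (conv \<nu> ^^ Suc n) H t \<and> 0 \<le> Vj (Suc n) t \<and>
   (sets (interval_measure (Vj (Suc n))) = sets borel \<and>
    (\<forall>g\<in>borel_measurable borel. conv (interval_measure (Vj (Suc n))) g = (conv \<nu> ^^ Suc n) g))"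
proof (induction n arbitrary: t)
  case 0
  have "ennreal (V t) = conv \<nu> H t" using \<nu>_finite[of t]
    by (simp add: V_eq conv_H emeasure_eq_ennreal_measure)
  moreover have "0 \<le> V t" by (simp add: V_eq)
  ultimately show ?case by (simp add: interval_measure_V)
next
  case (Suc n)
  let ?I = "interval_measure (Vj (Suc n))"
  have IH: "ennreal (Vj (Suc n) t) = (conv \<nu> ^^ Suc n) H t" "0 \<le> Vj (Suc n) t"
     "g \<in> borel_measurable borel \<Longrightarrow> conv ?I g = (conv \<nu> ^^ Suc n) g" for t g
    using Suc by blast+
  have Vr: "Vj (Suc n) = (\<lambda>t. enn2real ((conv \<nu> ^^ Suc n) H t))"
    using IH(1,2) by (metis enn2real_ennreal)
  have [measurable]: "Vj (Suc n) \<in> borel_measurable borel"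
    unfolding Vr using \<nu>.conv_pow_measurable[OF H_meas] by measurable
  have v0: "Vj (Suc n) t = 0" if "t < 0" for t
    using conv_\<nu>_pow_H_vanish[OF that, of "Suc n"] by (simp add: Vr del: funpow.simps)
  have st: "Vj (Suc (Suc n)) t = enn2real ((conv \<nu> ^^ Suc (Suc n)) H t)" for t
  proof -
    have "Vj (Suc (Suc n)) t = (LINT y|\<nu>. indicator {0..t} y *\<^sub>R Vj (Suc n) (t - y))"
      by (simp add: stieltjes_conv_def set_lebesgue_integral_def interval_measure_V)
    also have "\<dots> = enn2real (\<integral>\<^sup>+ y. ennreal (indicator {0..t} y *\<^sub>R Vj (Suc n) (t - y)) \<partial>\<nu>)"
      using IH(2) by (intro integral_eq_nn_integral) auto
    also have "(\<integral>\<^sup>+ y. ennreal (indicator {0..t} y *\<^sub>R Vj (Suc n) (t - y)) \<partial>\<nu>) = (\<integral>\<^sup>+ y. ennreal (Vj (Suc n) (t - y)) \<partial>\<nu>)"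
      using AE_\<nu> v0 by (intro nn_integral_cong_AE) (auto simp: indicator_def elim!: eventually_mono)
    also have "\<dots> = (conv \<nu> ^^ Suc (Suc n)) H t"
      unfolding IH(1) by (simp add: conv_def[of \<nu> "conv \<nu> _"])
    finally show ?thesis .
  qed
  have A: "ennreal (Vj (Suc (Suc n)) t) = (conv \<nu> ^^ Suc (Suc n)) H t" for t
    unfolding st using conv_\<nu>_pow_H_finite[of "Suc (Suc n)" t] by (simp del: funpow.simps)
  define \<rho> where "\<rho> = distr (?I \<Otimes>\<^sub>M \<nu>) borel (\<lambda>(x, y). x + y)"
  have [simp, measurable_cong]: "sets ?I = sets borel" by simp
  have cr: "conv \<rho> g t = (conv \<nu> ^^ Suc (Suc n)) g t" if [measurable]: "g \<in> borel_measurable borel" for g t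
  proof -
    have "conv \<rho> g t = (\<integral>\<^sup>+ z. g (t - (case z of (x, y) \<Rightarrow> x + y)) \<partial>(?I \<Otimes>\<^sub>M \<nu>))"
      unfolding conv_def \<rho>_def by (rule nn_integral_distr) measurable
    also have "\<dots> = (\<integral>\<^sup>+ x. \<integral>\<^sup>+ y. g (t - (x + y)) \<partial>\<nu> \<partial>?I)"
      by (subst \<nu>.nn_integral_fst[symmetric]) auto
    also have "\<dots> = conv ?I (conv \<nu> g) t"
      by (simp add: conv_def algebra_simps)
    also have "\<dots> = (conv \<nu> ^^ Suc (Suc n)) g t"
      by (subst IH(3)) (simp_all add: funpow_swap1)
    finally show ?thesis .
  qed
  have r: "emeasure \<rho> {..t} = (conv \<nu> ^^ Suc (Suc n)) H t" for t
    using cr[OF H_meas, of t] conv_H[of \<rho> t] by (simp add: \<rho>_def)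
  have "interval_measure (\<lambda>t. measure \<rho> {..t}) = \<rho>"
    using conv_\<nu>_pow_H_finite by (intro interval_measure_cdf) (simp_all add: \<rho>_def r[unfolded \<rho>_def] del: funpow.simps)
  moreover have "measure \<rho> {..t} = Vj (Suc (Suc n)) t" for t
    by (simp only: measure_def r st)
  ultimately have "interval_measure (Vj (Suc (Suc n))) = \<rho>" by (simp del: funpow.simps)
  moreover have "0 \<le> Vj (Suc (Suc n)) t" by (simp only: st enn2real_nonneg)
  ultimately show ?case using A cr by (auto simp: \<rho>_def simp del: funpow.simps)
qed

lemma Vj_eq: "0 \<le> t \<Longrightarrow> ennreal (Vj n t) = (conv \<nu> ^^ n) H t"
  using Vj_conv_pow[of _ t] by (cases n) auto

lemma Vj_nonneg: "0 \<le> Vj n t"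
  using Vj_conv_pow[of _ t] by (cases n) auto

lemma stieltjes_conv_Vj:
  assumes f: "set_borel_measurable borel {0..} f" and f0: "\<And>y. y \<ge> 0 \<Longrightarrow> f y \<ge> 0"
  shows "stieltjes_conv f (Vj (Suc n)) t
    = enn2real ((conv \<nu> ^^ Suc n) (\<lambda>x. ennreal (indicator {0..} x * f x)) t)"
proof -
  let ?I = "interval_measure (Vj (Suc n))"
  have fm [measurable]: "(\<lambda>x. indicator {0..} x * f x) \<in> borel_measurable borel"
    using f by (simp add: set_borel_measurable_def)
  have neg: "AE y in ?I. 0 \<le> y"
  proof (rule AE_I)
    have "emeasure ?I {..0} = (conv \<nu> ^^ Suc n) H 0"
      using Vj_conv_pow[of n] conv_H[of ?I 0] H_meas by metis
    also have "\<dots> = (\<integral>\<^sup>+ y. 0 \<partial>\<nu>)"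
      unfolding funpow.simps comp_def conv_def[of \<nu> "(conv \<nu> ^^ n) H"]
      using AE_\<nu> by (intro nn_integral_cong_AE) (auto simp: conv_\<nu>_pow_H_vanish elim!: eventually_mono)
    finally show "emeasure ?I {..0} = 0" by simp
  qed auto
  have *: "indicator {0..t} y *\<^sub>R f (t - y) = indicator {0..} y * (indicator {0..} (t - y) * f (t - y))" for y
    by (auto simp: indicator_def)
  have "stieltjes_conv f (Vj (Suc n)) t = (LINT y|?I. indicator {0..} y * (indicator {0..} (t - y) * f (t - y)))"
    unfolding stieltjes_conv_def set_lebesgue_integral_def * ..
  also have "\<dots> = enn2real (\<integral>\<^sup>+ y. ennreal (indicator {0..} y * (indicator {0..} (t - y) * f (t - y))) \<partial>?I)"
  proof (rule integral_eq_nn_integral)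
    have "(\<lambda>y. indicator {0..} (t - y) * f (t - y)) \<in> borel_measurable borel"
      by (rule measurable_compose[OF _ fm]) measurable
    then have "(\<lambda>y. indicator {0..} y * (indicator {0..} (t - y) * f (t - y))) \<in> borel_measurable borel"
      by (rule borel_measurable_times[rotated]) simp
    then show "(\<lambda>y. indicator {0..} y * (indicator {0..} (t - y) * f (t - y))) \<in> borel_measurable ?I"
      by (subst measurable_cong_sets[of ?I borel borel borel]) auto
    show "AE y in ?I. 0 \<le> indicator {0..} y * (indicator {0..} (t - y) * f (t - y))"
      using f0 by (intro AE_I2) (simp add: indicator_def)
  qed
  also have "(\<integral>\<^sup>+ y. ennreal (indicator {0..} y * (indicator {0..} (t - y) * f (t - y))) \<partial>?I)
      = (\<integral>\<^sup>+ y. ennreal (indicator {0..} (t - y) * f (t - y)) \<partial>?I)"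
    using neg by (intro nn_integral_cong_AE) (auto simp: indicator_def elim!: eventually_mono)
  also have "\<dots> = conv ?I (\<lambda>x. ennreal (indicator {0..} x * f x)) t"
    by (simp add: conv_def)
  also have "\<dots> = (conv \<nu> ^^ Suc n) (\<lambda>x. ennreal (indicator {0..} x * f x)) t"
  proof -
    have "(\<lambda>x. ennreal (indicator {0..} x * f x)) \<in> borel_measurable borel" by measurable
    then show ?thesis using Vj_conv_pow[of n t] by simp
  qed
  finally show ?thesis .
qed

end

section \<open>The stationary delay\<close>

definition lconv :: "(real \<Rightarrow> ennreal) \<Rightarrow> real \<Rightarrow> ennreal" where
  "lconv g t = (\<integral>\<^sup>+ x. g (t - x) * indicator {0..} x \<partial>lborel)"

lemma lconv_measurable [measurable]:
  assumes [measurable]: "g \<in> borel_measurable borel"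
  shows "lconv g \<in> borel_measurable borel"
  unfolding lconv_def[abs_def] by measurable

lemma lconv_shift:
  assumes [measurable]: "g \<in> borel_measurable borel" and "0 \<le> z"
  shows "lconv g t = (\<integral>\<^sup>+ x. g (t - x) * (if 0 \<le> x \<and> x < z then 1 else 0) \<partial>lborel) + lconv g (t - z)"
proof -
  have "lconv g (t - z) = (\<integral>\<^sup>+ x. g (t - z - x) * indicator {0..} x \<partial>distr lborel borel (\<lambda>x. - z + x))"
    unfolding lconv_def by (subst lborel_distr_plus) (rule refl)
  also have "\<dots> = (\<integral>\<^sup>+ x. g (t - x) * indicator {z..} x \<partial>lborel)"
    by (subst nn_integral_distr) (auto intro!: nn_integral_cong simp: indicator_def)
  finally have "(\<integral>\<^sup>+ x. g (t - x) * (if 0 \<le> x \<and> x < z then 1 else 0) \<partial>lborel) + lconv g (t - z)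
    = (\<integral>\<^sup>+ x. g (t - x) * (if 0 \<le> x \<and> x < z then 1 else 0) + g (t - x) * indicator {z..} x \<partial>lborel)"
    by (simp add: nn_integral_add)
  also have "\<dots> = lconv g t"
    unfolding lconv_def using \<open>0 \<le> z\<close> by (intro nn_integral_cong) (auto simp: indicator_def)
  finally show ?thesis ..
qed

lemma lconv_exp: "lconv (\<lambda>u. ennreal (exp u)) t = ennreal (exp t)"
proof -
  interpret prob_space "density lborel (exponential_density 1)"
    by (rule prob_space_exponential_density) simp
  have "1 = (\<integral>\<^sup>+ x. ennreal (exponential_density 1 x) \<partial>lborel)"
    using emeasure_space_1 by (simp add: emeasure_density)
  also have "ennreal (exp t) * \<dots> = (\<integral>\<^sup>+ x. ennreal (exp t) * ennreal (exponential_density 1 x) \<partial>lborel)"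
    by (subst nn_integral_cmult) auto
  also have "\<dots> = lconv (\<lambda>u. ennreal (exp u)) t"
    unfolding lconv_def
    by (intro nn_integral_cong)
       (auto simp: exponential_density_def indicator_def ennreal_mult'[symmetric] exp_add[symmetric])
  finally show ?thesis by simp
qed

lemma lconv_mono: "(\<And>x. g x \<le> h x) \<Longrightarrow> lconv g t \<le> lconv h t"
  unfolding lconv_def by (intro nn_integral_mono mult_right_mono) auto

lemma power_over_fact_le_exp: "0 \<le> (u::real) \<Longrightarrow> u ^ k / fact k \<le> exp u"
proof -
  assume "0 \<le> u"
  have "(\<Sum>n\<in>{k}. u ^ n /\<^sub>R fact n) \<le> (\<Sum>n. u ^ n /\<^sub>R fact n)"
    using \<open>0 \<le> u\<close> by (intro sum_le_suminf summable_exp_generic) auto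
  then show ?thesis by (simp add: exp_def divide_inverse mult.commute)
qed

locale prw_finite_mean = prw_setup +
  assumes xi_int: "integrable M \<xi>"
begin

definition m :: real where "m = (LINT \<omega>|M. \<xi> \<omega>)"

lemma m_pos: "m > 0"
proof -
  have "AE \<omega> in M. 0 \<le> \<xi> \<omega>" using xi_pos by eventually_elim simp
  then have "0 \<le> m" unfolding m_def by (rule integral_nonneg_AE)
  moreover have "m \<noteq> 0"
  proof
    assume "m = 0"
    then have "AE \<omega> in M. \<xi> \<omega> = 0"
      using integral_nonneg_eq_0_iff_AE[OF xi_int] \<open>AE \<omega> in M. 0 \<le> \<xi> \<omega>\<close> by (simp add: m_def)
    with xi_pos have "AE \<omega> in M. False" by eventually_elim simp
    then show False by simp
  qed
  ultimately show ?thesis by simp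
qed

lemma nn_mean: "(\<integral>\<^sup>+ z. ennreal z \<partial>F) = ennreal m"
proof -
  have "(\<integral>\<^sup>+ z. ennreal z \<partial>F) = (\<integral>\<^sup>+ \<omega>. ennreal (\<xi> \<omega>) \<partial>M)" by (simp add: nn_integral_distr)
  also have "\<dots> = ennreal m"
    unfolding m_def using xi_pos by (intro nn_integral_eq_integral xi_int) (auto elim!: eventually_mono)
  finally show ?thesis .
qed

text \<open>The inner integral is \<open>P(\<xi> > x)\<close> for \<open>x \<ge> 0\<close>, so that \<open>F0\<close> is the stationary delay distribution of the
  renewal process with step law \<open>F\<close>. In the form of a double integral its integrals are obtained by Tonelli's theorem.\<close>

definition F0 :: "real measure" where
  "F0 = density lborel (\<lambda>x. ennreal (1 / m) * (\<integral>\<^sup>+ z. (if 0 \<le> x \<and> x < z then 1 else 0) \<partial>F))"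

lemma sets_F0 [simp, measurable_cong]: "sets F0 = sets borel"
  by (simp add: F0_def)

lemma nn_integral_F0:
  assumes [measurable]: "h \<in> borel_measurable borel"
  shows "(\<integral>\<^sup>+ x. h x \<partial>F0) =
    ennreal (1 / m) * (\<integral>\<^sup>+ z. \<integral>\<^sup>+ x. h x * (if 0 \<le> x \<and> x < z then 1 else 0) \<partial>lborel \<partial>F)"
proof -
  interpret P: pair_sigma_finite F "lborel :: real measure" ..
  have [measurable]: "(\<lambda>p::real \<times> real. if 0 \<le> fst p \<and> fst p < snd p then 1 else (0::ennreal)) \<in> borel_measurable (borel \<Otimes>\<^sub>M F)"
    by measurable
  have "(\<integral>\<^sup>+ x. h x \<partial>F0) = (\<integral>\<^sup>+ x. ennreal (1 / m) * (\<integral>\<^sup>+ z. (if 0 \<le> x \<and> x < z then 1 else 0) \<partial>F) * h x \<partial>lborel)"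
    unfolding F0_def by (rule nn_integral_density) measurable
  also have "\<dots> = (\<integral>\<^sup>+ x. ennreal (1 / m) * (\<integral>\<^sup>+ z. h x * (if 0 \<le> x \<and> x < z then 1 else 0) \<partial>F) \<partial>lborel)"
    by (intro nn_integral_cong) (subst nn_integral_cmult, auto simp: mult_ac)
  also have "\<dots> = ennreal (1 / m) * (\<integral>\<^sup>+ x. \<integral>\<^sup>+ z. h x * (if 0 \<le> x \<and> x < z then 1 else 0) \<partial>F \<partial>lborel)"
    by (rule nn_integral_cmult) measurable
  also have "(\<integral>\<^sup>+ x. \<integral>\<^sup>+ z. h x * (if 0 \<le> x \<and> x < z then 1 else 0) \<partial>F \<partial>lborel)
      = (\<integral>\<^sup>+ z. \<integral>\<^sup>+ x. h x * (if 0 \<le> x \<and> x < z then 1 else 0) \<partial>lborel \<partial>F)"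
    by (rule P.Fubini') measurable
  finally show ?thesis .
qed

lemma nn_integral_one_below: "(\<integral>\<^sup>+ x. (if 0 \<le> x \<and> x < z then 1 else 0) \<partial>lborel) = ennreal z"
proof -
  have "(\<integral>\<^sup>+ x. (if 0 \<le> x \<and> x < z then 1 else 0) \<partial>lborel) = (\<integral>\<^sup>+ x. indicator {0..<z} x \<partial>lborel)"
    by (intro nn_integral_cong) (auto simp: indicator_def)
  also have "\<dots> = ennreal z" by (cases "0 \<le> z") (auto simp: ennreal_neg)
  finally show ?thesis .
qed

sublocale F0: pos_law F0
proof (intro pos_law.intro prob_spaceI pos_law_axioms.intro)
  have "emeasure F0 UNIV = (\<integral>\<^sup>+ x. 1 \<partial>F0)" by (simp add: F0_def)
  also have "\<dots> = ennreal (1 / m) * ennreal m"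
    by (subst nn_integral_F0) (simp_all add: nn_integral_one_below nn_mean)
  also have "\<dots> = 1" using m_pos by (simp add: ennreal_mult'[symmetric])
  finally show "emeasure F0 (space F0) = 1" by (simp add: F0_def)
  show "AE x in F0. 0 \<le> x"
    unfolding F0_def
  proof (subst AE_density, simp, intro AE_I2 impI)
    fix x :: real assume "0 < ennreal (1 / m) * (\<integral>\<^sup>+ z. (if 0 \<le> x \<and> x < z then 1 else 0) \<partial>F)"
    then show "0 \<le> x" by (cases "0 \<le> x") auto
  qed
qed simp

text \<open>Let \<open>J g\<close> be the integral of \<open>g\<close> over the past. Convolution of \<open>g\<close> with \<open>m * F0\<close> is \<open>J g - F * J g\<close>, and \<open>\<nu>\<close> is
  the sum of the laws \<open>F ^ n * G\<close>; so \<open>m * F0 * \<nu> * g\<close> is a telescoping sum with value \<open>G * J g\<close>. The growth bound on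
  \<open>g\<close> makes the last term vanish. The terms are written additively, because \<^typ>\<open>ennreal\<close> has no cancellation.\<close>

lemma delay_step:
  assumes g [measurable]: "g \<in> borel_measurable borel" and bd: "\<And>u. g u \<le> C * ennreal (exp u)" "C < \<infinity>"
  shows "conv F0 (conv \<nu> g) t = conv G (\<lambda>u. ennreal (1 / m) * lconv g u) t"
proof -
  define B where "B t = (\<integral>\<^sup>+ z. \<integral>\<^sup>+ x. g (t - x) * (if 0 \<le> x \<and> x < z then 1 else 0) \<partial>lborel \<partial>F)" for t
  have B [measurable]: "B \<in> borel_measurable borel" unfolding B_def[abs_def] by measurable
  have c0: "conv F0 g = (\<lambda>t. ennreal (1 / m) * B t)"
    by (auto simp: conv_def nn_integral_F0 B_def)
  have BJ: "B t + conv F (lconv g) t = lconv g t" for t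
  proof -
    have "B t + conv F (lconv g) t =
       (\<integral>\<^sup>+ z. (\<integral>\<^sup>+ x. g (t - x) * (if 0 \<le> x \<and> x < z then 1 else 0) \<partial>lborel) + lconv g (t - z) \<partial>F)"
      unfolding B_def conv_def by (subst nn_integral_add) auto
    also have "\<dots> = (\<integral>\<^sup>+ z. lconv g t \<partial>F)"
      using F.nonneg by (intro nn_integral_cong_AE) (auto simp: lconv_shift[OF g, symmetric] elim!: eventually_mono)
    also have "\<dots> = lconv g t" by (subst nn_integral_const) (simp only: F.emeasure_space_1 mult_1_right)
    finally show ?thesis .
  qed
  \<comment> \<open>\<open>a n = b n + a (n + 1)\<close> is the telescoping relation.\<close>
  define a where "a n = (conv F ^^ n) (conv G (lconv g)) t" for n
  define b where "b n = (conv F ^^ n) (conv G B) t" for n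
  have ab: "b n + a (Suc n) = a n" for n
  proof -
    have "a (Suc n) = (conv F ^^ n) (conv G (conv F (lconv g))) t"
      using conv_commute[OF F.borel_sf_axioms G.borel_sf_axioms lconv_measurable[OF g]]
      by (simp add: a_def funpow_Suc_right del: funpow.simps)
    then have "b n + a (Suc n) = (conv F ^^ n) (\<lambda>x. conv G B x + conv G (conv F (lconv g)) x) t"
      by (simp add: b_def F.conv_pow_add)
    also have "(\<lambda>x. conv G B x + conv G (conv F (lconv g)) x) = conv G (lconv g)"
      using BJ by (subst G.conv_add[symmetric]) auto
    finally show ?thesis by (simp add: a_def)
  qed
  have lb: "lconv g u \<le> C * ennreal (exp u)" for u
  proof -
    have "lconv g u \<le> lconv (\<lambda>u. C * ennreal (exp u)) u" by (rule lconv_mono) (rule bd)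
    also have "\<dots> = C * lconv (\<lambda>u. ennreal (exp u)) u"
      unfolding lconv_def by (subst nn_integral_cmult[symmetric]) (auto simp: mult_ac)
    finally show ?thesis by (simp add: lconv_exp)
  qed
  have ale: "a n \<le> C * (ennreal (exp t) * exp_mom F 1 ^ n)" for n
  proof -
    have "a n \<le> (conv F ^^ n) (conv G (\<lambda>u. C * ennreal (exp u))) t"
      unfolding a_def by (intro conv_pow_mono conv_mono lb)
    also have "conv G (\<lambda>u. C * ennreal (exp u)) = (\<lambda>u. C * conv G (\<lambda>u. ennreal (exp u)) u)"
      by (auto simp: G.conv_cmult)
    also have "(conv F ^^ n) (\<lambda>u. C * conv G (\<lambda>u. ennreal (exp u)) u) t = C * (conv F ^^ n) (conv G (\<lambda>u. ennreal (exp u))) t"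
      by (rule F.conv_pow_cmult) simp
    also have "\<dots> \<le> C * (ennreal (exp t) * exp_mom F 1 ^ n)"
      by (intro mult_left_mono conv_FG_exp_le) simp
    finally show ?thesis .
  qed
  obtain r where r: "exp_mom F 1 = ennreal r" "0 \<le> r" "r < 1"
    using exp_mom_F_less_1 by (cases "exp_mom F 1") (auto simp: ennreal_less_iff ennreal_1[symmetric] simp del: ennreal_1)
  obtain c where c: "C = ennreal c" "0 \<le> c" using bd(2) by (cases C) auto
  have a0: "a \<longlonglongrightarrow> 0"
  proof (rule tendsto_sandwich[of "\<lambda>_. 0"])
    have "(\<lambda>n. ennreal (c * (exp t * r ^ n))) \<longlonglongrightarrow> ennreal (c * (exp t * 0))"
      using r by (intro tendsto_ennrealI tendsto_mult tendsto_const LIMSEQ_realpow_zero) auto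
    then show "(\<lambda>n. C * (ennreal (exp t) * exp_mom F 1 ^ n)) \<longlonglongrightarrow> 0"
      using r c by (simp add: ennreal_power ennreal_mult)
  qed (auto simp: ale)
  have "(\<Sum>i<n. b i) + a n = a 0" for n
    by (induction n) (simp, metis (no_types) ab add.assoc sum.lessThan_Suc)
  moreover have "(\<lambda>n. (\<Sum>i<n. b i) + a n) \<longlonglongrightarrow> (\<Sum>i. b i) + 0"
    by (intro tendsto_add a0 summable_LIMSEQ) auto
  ultimately have "(\<Sum>i. b i) = a 0" by (simp add: LIMSEQ_const_iff)
  then have VB: "conv \<nu> B t = conv G (lconv g) t"
    by (simp add: conv_\<nu> a_def b_def)
  have "conv F0 (conv \<nu> g) t = conv \<nu> (\<lambda>t. ennreal (1 / m) * B t) t"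
    using conv_commute[OF F0.borel_sf_axioms \<nu>.borel_sf_axioms g] c0 by simp
  also have "\<dots> = ennreal (1 / m) * conv G (lconv g) t"
    using VB by (simp add: \<nu>.conv_cmult)
  also have "\<dots> = conv G (\<lambda>u. ennreal (1 / m) * lconv g u) t"
    by (rule G.conv_cmult[symmetric]) simp
  finally show ?thesis .
qed

text \<open>The distribution function of the \<open>k\<close>-th convolution power of Lebesgue measure on the half-line divided by \<open>m\<close>.\<close>

definition P :: "nat \<Rightarrow> real \<Rightarrow> real" where
  "P k u = (if u < 0 then 0 else u ^ k / (m ^ k * fact k))"

lemma P_nonneg: "0 \<le> P k u"
  using m_pos by (simp add: P_def)

lemma P_meas [measurable]: "P k \<in> borel_measurable borel"
  unfolding P_def[abs_def] by measurable

lemma lconv_P: "ennreal (1 / m) * lconv (\<lambda>u. ennreal (P k u)) t = ennreal (P (Suc k) t)"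
proof (cases "t < 0")
  case True
  have "lconv (\<lambda>u. ennreal (P k u)) t = (\<integral>\<^sup>+ x. 0 \<partial>(lborel :: real measure))"
    unfolding lconv_def using True by (intro nn_integral_cong) (auto simp: P_def indicator_def)
  then show ?thesis using True by (simp add: P_def)
next
  case False
  let ?f = "\<lambda>x. (t - x) ^ k / (m ^ k * fact k)" and ?F = "\<lambda>x. - ((t - x) ^ Suc k / (m ^ k * fact (Suc k)))"
  have "lconv (\<lambda>u. ennreal (P k u)) t = (\<integral>\<^sup>+ x. ennreal (?f x) * indicator {0..t} x \<partial>lborel)"
    unfolding lconv_def by (intro nn_integral_cong) (auto simp: P_def indicator_def)
  also have "\<dots> = ennreal (?F t - ?F 0)"
  proof (rule nn_integral_FTC_Icc[where F = ?F])
    fix x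
    have "((\<lambda>x. t - x) has_real_derivative - 1) (at x)" (is ?D)
      by (auto intro!: derivative_eq_intros)
    have "(?F has_real_derivative - ((1 + of_nat k) * (- 1 * (t - x) ^ k) / (m ^ k * fact (Suc k)))) (at x)"
      by (rule DERIV_minus DERIV_cdivide DERIV_power_Suc \<open>?D\<close>)+
    moreover have "- ((1 + of_nat k) * (- 1 * (t - x) ^ k) / (m ^ k * fact (Suc k))) = ?f x"
    proof -
      have "(1 + real k) \<noteq> 0" by simp
      then show ?thesis by (simp add: divide_simps)
    qed
    ultimately show "(?F has_real_derivative ?f x) (at x)" by (rule DERIV_cong)
  qed (use False m_pos in auto)
  also have "?F t - ?F 0 = t ^ Suc k / (m ^ k * fact (Suc k))" by simp
  finally have "ennreal (1 / m) * lconv (\<lambda>u. ennreal (P k u)) t = ennreal (1 / m) * ennreal (t ^ Suc k / (m ^ k * fact (Suc k)))"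
    by (simp only:)
  also have "\<dots> = ennreal (1 / m * (t ^ Suc k / (m ^ k * fact (Suc k))))"
    using m_pos by (intro ennreal_mult'[symmetric]) simp
  also have "1 / m * (t ^ Suc k / (m ^ k * fact (Suc k))) = P (Suc k) t"
    using False by (simp add: P_def)
  finally show ?thesis .
qed

lemma P_le_exp: "ennreal (P k u) \<le> ennreal (1 / m ^ k) * ennreal (exp u)"
proof -
  have "P k u \<le> 1 / m ^ k * exp u"
  proof (cases "u < 0")
    case False
    have "P k u = 1 / m ^ k * (u ^ k / fact k)" using False by (simp add: P_def)
    also have "\<dots> \<le> 1 / m ^ k * exp u"
      using m_pos False by (intro mult_left_mono power_over_fact_le_exp) auto
    finally show ?thesis .
  qed (use m_pos in \<open>simp add: P_def\<close>)
  then show ?thesis using m_pos by (simp add: ennreal_mult'[symmetric] ennreal_leI)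
qed

text \<open>The identity on which all asymptotics rest: \<open>k\<close> applications of the preceding one, which may be
  interleaved since convolution operators commute.\<close>

lemma delay_identity: "(conv F0 ^^ k) ((conv \<nu> ^^ k) H) = (conv G ^^ k) (\<lambda>u. ennreal (P k u))"
proof (induction k)
  case 0
  then show ?case by (auto simp: P_def indicator_def)
next
  case (Suc k)
  have Pm: "(\<lambda>u. ennreal (P j u)) \<in> borel_measurable borel" for j by measurable
  have "(conv F0 ^^ Suc k) ((conv \<nu> ^^ Suc k) H) = conv F0 ((conv F0 ^^ k) (conv \<nu> ((conv \<nu> ^^ k) H)))"
    by simp
  also have "(conv F0 ^^ k) (conv \<nu> ((conv \<nu> ^^ k) H)) = conv \<nu> ((conv F0 ^^ k) ((conv \<nu> ^^ k) H))"
    by (rule conv_pow_commute[symmetric]) (auto intro: \<nu>.conv_pow_measurable F0.borel_sf_axioms \<nu>.borel_sf_axioms)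
  also have "\<dots> = conv \<nu> ((conv G ^^ k) (\<lambda>u. ennreal (P k u)))" by (simp only: Suc.IH)
  also have "\<dots> = (conv G ^^ k) (conv \<nu> (\<lambda>u. ennreal (P k u)))"
    by (rule conv_pow_commute[OF \<nu>.borel_sf_axioms G.borel_sf_axioms Pm])
  also have "conv F0 \<dots> = (conv G ^^ k) (conv F0 (conv \<nu> (\<lambda>u. ennreal (P k u))))"
    by (rule conv_pow_commute[OF F0.borel_sf_axioms G.borel_sf_axioms]) (rule \<nu>.conv_measurable[OF Pm])
  also have "conv F0 (conv \<nu> (\<lambda>u. ennreal (P k u))) = conv G (\<lambda>u. ennreal (P (Suc k) u))"
  proof
    fix t
    show "conv F0 (conv \<nu> (\<lambda>u. ennreal (P k u))) t = conv G (\<lambda>u. ennreal (P (Suc k) u)) t"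
      using delay_step[OF Pm P_le_exp[of k], of t] by (simp add: lconv_P)
  qed
  finally show ?case by (simp add: funpow_swap1)
qed

lemma conv_window: "sets \<mu> = sets borel \<Longrightarrow> conv \<mu> (indicator {0..<h}) t = emeasure \<mu> {t - h<..t}"
  unfolding conv_def
  by (subst nn_integral_indicator[symmetric]) (auto intro!: nn_integral_cong simp: indicator_def simp del: nn_integral_indicator)

text \<open>The averages over a delay with law \<open>F0\<close> of the mass of a window are at most its length divided by \<open>m\<close>. As
  the delay is at most some \<open>b\<close> with probability above \<open>1/2\<close>, a window of length \<open>h\<close> inside all the delayed windows of length \<open>h + b\<close>
  has at most twice the mass allowed for the latter.\<close>

lemma window_bound: "\<exists>C\<ge>0. \<forall>t. emeasure \<nu> {t - h<..t} \<le> ennreal C"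
proof (cases "h \<le> 0")
  case True
  then show ?thesis by (intro exI[of _ 0]) auto
next
  case False
  have "(\<lambda>n. measure F0 {..real n}) \<longlonglongrightarrow> measure F0 (\<Union>n. {..real n})"
    by (intro F0.finite_Lim_measure_incseq) (auto simp: incseq_def)
  moreover have "(\<Union>n. {..real n}) = UNIV" by (auto intro: real_arch_simple)
  moreover have "space F0 = UNIV" by (simp add: F0_def)
  ultimately have "(\<lambda>n. measure F0 {..real n}) \<longlonglongrightarrow> 1" using F0.prob_space by simp
  then have "eventually (\<lambda>n. measure F0 {..real n} > 1 / 2) sequentially"
    by (rule order_tendstoD) simp
  \<comment> \<open>The delay is at most \<open>b\<close> with probability above \<open>1 / 2\<close>.\<close>
  then obtain b :: nat where b: "measure F0 {..real b} > 1 / 2" by (auto simp: eventually_sequentially)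
  let ?b = "real b" and ?g = "indicator {0..<h + real b} :: real \<Rightarrow> ennreal"
  have g: "?g u \<le> 1 * ennreal (exp u)" for u
    using ennreal_leI[of 1 "exp u"] by (auto simp: indicator_def)
  have l: "lconv ?g u \<le> ennreal (h + ?b)" for u
  proof -
    have "lconv ?g u \<le> (\<integral>\<^sup>+ x. indicator {u - (h + ?b)<..u} x \<partial>lborel)"
      unfolding lconv_def by (intro nn_integral_mono) (auto simp: indicator_def)
    also have "\<dots> = ennreal (h + ?b)" using False by simp
    finally show ?thesis .
  qed
  have "emeasure \<nu> {t - h<..t} \<le> ennreal (2 * (h + ?b) / m)" for t
  proof -
    have "ennreal (1 / 2) * emeasure \<nu> {t - h<..t} \<le> emeasure F0 {..?b} * emeasure \<nu> {t - h<..t}"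
      using b unfolding F0.emeasure_eq_measure by (intro mult_right_mono ennreal_leI) simp_all
    also have "\<dots> = (\<integral>\<^sup>+ x. emeasure \<nu> {t - h<..t} * indicator {..?b} x \<partial>F0)"
      by (subst nn_integral_cmult) (auto simp: mult.commute)
    also have "\<dots> \<le> (\<integral>\<^sup>+ x. emeasure \<nu> {t + ?b - x - (h + ?b)<..t + ?b - x} \<partial>F0)"
      using F0.nonneg by (intro nn_integral_mono_AE)
        (auto simp: indicator_def intro!: emeasure_mono elim!: eventually_mono)
    also have "\<dots> = conv F0 (conv \<nu> ?g) (t + ?b)"
      unfolding conv_def[of F0] by (simp add: conv_window)
    also have "\<dots> = conv G (\<lambda>u. ennreal (1 / m) * lconv ?g u) (t + ?b)"
      by (rule delay_step[OF _ g]) auto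
    also have "\<dots> \<le> conv G (\<lambda>u. ennreal (1 / m) * ennreal (h + ?b)) (t + ?b)"
      by (intro conv_mono mult_left_mono l) simp
    also have "\<dots> = ennreal (1 / m) * ennreal (h + ?b)" by simp
    also have "\<dots> = ennreal ((h + ?b) / m)" using m_pos by (simp add: ennreal_mult'[symmetric])
    finally have "ennreal 2 * (ennreal (1 / 2) * emeasure \<nu> {t - h<..t}) \<le> ennreal 2 * ennreal ((h + ?b) / m)"
      by (intro mult_left_mono) auto
    moreover have "ennreal 2 * (ennreal (1 / 2) * x) = x" for x
      unfolding mult.assoc[symmetric] by (subst ennreal_mult'[symmetric]) auto
    moreover have "ennreal 2 * ennreal ((h + ?b) / m) = ennreal (2 * (h + ?b) / m)"
      by (subst ennreal_mult'[symmetric]) auto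
    ultimately show ?thesis by (simp only:)
  qed
  then show ?thesis using False m_pos by (intro exI[of _ "2 * (h + ?b) / m"]) auto
qed

end

section \<open>Asymptotically harmonic functions of a nonlattice law\<close>

text \<open>If the positive differences of elements come arbitrarily close to 0, take \<open>s' < s\<close> with difference \<open>e \<le> \<epsilon>\<close>: the
  elements \<open>(n - k) * s' + k * s\<close> with \<open>k \<le> n\<close> form a progression with gap \<open>e\<close> that starts at \<open>n * s'\<close>, and for large
  \<open>n\<close> it reaches beyond \<open>(n + 1) * s'\<close>. Otherwise let \<open>d > 0\<close> be the infimum of the differences and choose
  a difference \<open>e < 2 * d\<close>. An element strictly between two neighbours of such a progression would have
  distance at least \<open>d\<close> from both, so there is none, and all elements are multiples of \<open>e\<close>.\<close>

lemma semigroup_eventually_dense: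
  fixes S :: "real set"
  assumes S0: "0 \<in> S" and nn: "\<And>s. s \<in> S \<Longrightarrow> 0 \<le> s" and add: "\<And>s s'. s \<in> S \<Longrightarrow> s' \<in> S \<Longrightarrow> s + s' \<in> S"
    and p: "p \<in> S" "0 < p"
    and nl: "\<And>d. d > 0 \<Longrightarrow> \<not> S \<subseteq> {d * real n | n. True}" and "0 < \<epsilon>"
  shows "\<exists>x0. \<forall>x\<ge>x0. \<exists>s\<in>S. \<bar>x - s\<bar> \<le> \<epsilon>"
proof -
  have mult: "real k * s \<in> S" if "s \<in> S" for k s
    using that by (induction k) (auto simp: S0 distrib_right intro: add)
  have lattice_pt: "real n * s' + real k * (s - s') \<in> S" if "s \<in> S" "s' \<in> S" "k \<le> n" for s s' k n
  proof -
    have "real (n - k) * s' + real k * s \<in> S" by (intro add mult that)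
    then show ?thesis using \<open>k \<le> n\<close> by (simp add: of_nat_diff algebra_simps)
  qed
  show ?thesis
  proof (cases "\<exists>s\<in>S. \<exists>s'\<in>S. s' < s \<and> s - s' \<le> \<epsilon>")
    case True
    then obtain r r' where r: "r \<in> S" "r' \<in> S" "r' < r" "r - r' \<le> \<epsilon>" by auto
    \<comment> \<open>Adding \<open>p\<close> makes the smaller element positive, so that its multiples tend to infinity.\<close>
    define s s' e where "s = r + p" and "s' = r' + p" and "e = s - s'"
    have s: "s \<in> S" "s' \<in> S" "0 < s'" "0 < e" "e \<le> \<epsilon>"
      using r p nn[OF r(2)] by (auto simp: s_def s'_def e_def intro: add)
    show ?thesis
    proof (intro exI allI impI)
      fix x assume x: "s' * (s' / e + 1) \<le> x"
      have xp: "0 \<le> x" using x s by (intro order_trans[OF _ x]) auto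
      define n where "n = nat \<lfloor>x / s'\<rfloor>"
      have n: "real n \<le> x / s'" "x / s' < real n + 1"
        using xp s by (simp_all add: n_def)
      have n': "real n * s' \<le> x" "x < real n * s' + s'"
        using n s by (simp_all add: field_simps)
      define k where "k = nat \<lfloor>(x - real n * s') / e\<rfloor>"
      have k: "real k \<le> (x - real n * s') / e" "(x - real n * s') / e < real k + 1"
        using n' s by (simp_all add: k_def)
      have "(x - real n * s') / e \<le> s' / e" using n' s by (intro divide_right_mono) auto
      moreover have "s' / e + 1 \<le> x / s'" using x s by (simp add: field_simps)
      ultimately have "real k < real n + 1" using k n by linarith
      then have "k \<le> n" by linarith
      then have "real n * s' + real k * e \<in> S" unfolding e_def by (intro lattice_pt s)
      moreover have "\<bar>x - (real n * s' + real k * e)\<bar> \<le> \<epsilon>"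
      proof -
        have "real k * e \<le> x - real n * s'" "x - real n * s' < real k * e + e"
          using k s by (simp_all add: field_simps)
        then show ?thesis using s by auto
      qed
      ultimately show "\<exists>s\<in>S. \<bar>x - s\<bar> \<le> \<epsilon>" by blast
    qed
  next
    case False
    define D where "D = {s - s' | s s'. s \<in> S \<and> s' \<in> S \<and> s' < s}"
    have Dn: "D \<noteq> {}" using p S0 by (auto simp: D_def intro: exI[of _ p] exI[of _ 0])
    have De: "x \<in> D \<Longrightarrow> \<epsilon> \<le> x" for x using False by (force simp: D_def)
    define d where "d = Inf D"
    have d: "0 < d" using cInf_greatest[OF Dn De] \<open>0 < \<epsilon>\<close> by (auto simp: d_def)
    have dl: "d \<le> x" if "x \<in> D" for x
      unfolding d_def by (rule cInf_lower[OF that]) (use De in \<open>auto intro!: bdd_belowI\<close>)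
    have "Inf D < 2 * d" using d by (simp add: d_def)
    then obtain e where e: "e \<in> D" "e < 2 * d" using cInf_lessD[OF Dn] by blast
    then obtain s s' where s: "s \<in> S" "s' \<in> S" "s' < s" "e = s - s'" by (auto simp: D_def)
    have "S \<subseteq> {e * real n | n. True}"
    proof
      fix r assume r: "r \<in> S"
      have ep: "0 < e" using s by simp
      \<comment> \<open>With this many steps the progression starting at \<open>N * s'\<close> reaches beyond \<open>N * s' + r\<close>.\<close>
      obtain N where N: "r / e \<le> real N" using real_arch_simple by blast
      define k where "k = nat \<lfloor>r / e\<rfloor>"
      have rp: "0 \<le> r / e" using nn[OF r] ep by simp
      have k: "real k \<le> r / e" "r / e < real k + 1" using rp by (simp_all add: k_def)
      have kN: "k \<le> N" using k N by linarith
      have k': "real k * e \<le> r" "r < real k * e + e" using k ep by (simp_all add: field_simps)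
      have y: "real N * s' + r \<in> S" by (intro add mult s r)
      have z: "real N * s' + real k * e \<in> S" unfolding s(4) by (intro lattice_pt s kN)
      have "r = real k * e"
      proof (rule ccontr)
        assume ne: "r \<noteq> real k * e"
        with k' have "r - real k * e \<in> D"
          unfolding D_def using y z by (intro CollectI exI[of _ "real N * s' + r"] exI[of _ "real N * s' + real k * e"]) auto
        then have 1: "d \<le> r - real k * e" by (rule dl)
        have "real k < r / e" using ne k ep by (auto simp: less_le)
        then have "Suc k \<le> N" using N by linarith
        then have z': "real N * s' + real (Suc k) * e \<in> S" unfolding s(4) by (intro lattice_pt s)
        have "real (Suc k) * e - r \<in> D"
          unfolding D_def using y z' k'(2)
          by (intro CollectI exI[of _ "real N * s' + real (Suc k) * e"] exI[of _ "real N * s' + r"]) (auto simp: algebra_simps)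
        then have "d \<le> real (Suc k) * e - r" by (rule dl)
        with 1 e show False by (simp add: algebra_simps)
      qed
      then show "r \<in> {e * real n | n. True}" by (auto simp: mult.commute)
    qed
    then show ?thesis using nl[of e] s by simp
  qed
qed

lemma AE_in_support:
  fixes \<mu> :: "real measure"
  assumes [simp]: "sets \<mu> = sets borel"
  shows "AE x in \<mu>. \<forall>\<delta>>0. emeasure \<mu> {x - \<delta><..<x + \<delta>} \<noteq> 0"
proof -
  have "AE x in \<mu>. \<forall>pq::rat \<times> rat. emeasure \<mu> {real_of_rat (fst pq)<..<real_of_rat (snd pq)} = 0 \<longrightarrow>
      x \<notin> {real_of_rat (fst pq)<..<real_of_rat (snd pq)}"
  proof (subst AE_all_countable, rule allI)
    fix pq :: "rat \<times> rat"
    let ?I = "{real_of_rat (fst pq)<..<real_of_rat (snd pq)}"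
    show "AE x in \<mu>. emeasure \<mu> ?I = 0 \<longrightarrow> x \<notin> ?I"
    proof (cases "emeasure \<mu> ?I = 0")
      case True
      then have "AE x in \<mu>. x \<notin> ?I" by (intro AE_not_in null_setsI) auto
      then show ?thesis by simp
    qed simp
  qed
  then show ?thesis
  proof eventually_elim
    case (elim x)
    show ?case
    proof (intro allI impI notI)
      fix \<delta> :: real assume d: "0 < \<delta>" and z: "emeasure \<mu> {x - \<delta><..<x + \<delta>} = 0"
      obtain p where p: "x - \<delta> < real_of_rat p" "real_of_rat p < x" using of_rat_dense[of "x - \<delta>" x] d by auto
      obtain q where q: "x < real_of_rat q" "real_of_rat q < x + \<delta>" using of_rat_dense[of x "x + \<delta>"] d by auto
      have "emeasure \<mu> {real_of_rat p<..<real_of_rat q} \<le> emeasure \<mu> {x - \<delta><..<x + \<delta>}"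
        using p q by (intro emeasure_mono) auto
      then have "emeasure \<mu> {real_of_rat p<..<real_of_rat q} = 0" using z by simp
      then show False using elim[rule_format, of "(p, q)"] p q by auto
    qed
  qed
qed

lemma (in pos_law) tail_tendsto_0: "((\<lambda>x. measure \<mu> {x<..}) \<longlongrightarrow> 0) at_top"
proof -
  interpret R: real_distribution \<mu>
    by unfold_locales (use sets_pos sets_eq_imp_space_eq[OF sets_pos] in auto)
  have "((\<lambda>x. 1 - cdf \<mu> x) \<longlongrightarrow> 1 - 1) at_top"
    by (intro tendsto_diff tendsto_const R.cdf_lim_at_top_prob)
  moreover have "1 - cdf \<mu> x = measure \<mu> {x<..}" for x
  proof -
    have "measure \<mu> (space \<mu> - {..x}) = 1 - measure \<mu> {..x}" by (rule prob_compl) simp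
    moreover have "space \<mu> - {..x} = {x<..}" using sets_eq_imp_space_eq[OF sets_pos] by auto
    ultimately show ?thesis by (simp add: cdf_def)
  qed
  ultimately show ?thesis by simp
qed

lemma (in pos_law) integrable_bounded:
  fixes w :: "real \<Rightarrow> real"
  assumes "w \<in> borel_measurable borel" "\<And>x. \<bar>w x\<bar> \<le> C"
  shows "integrable \<mu> w"
  by (rule integrable_const_bound[of _ C]) (use assms in auto)

text \<open>A maximum principle. Let \<open>w (t) = Z (t) - Z (t - h)\<close> and suppose that its limit superior \<open>\<alpha>\<close> is positive. As \<open>w (t)\<close>
  is nearly an average of the values \<open>w (t - y)\<close>, which are nearly bounded by \<open>\<alpha>\<close>, it can only be close to \<open>\<alpha>\<close> if \<open>w (t - y)\<close>
  is close to \<open>\<alpha>\<close> for \<open>y\<close> in the support of the law. The shifts \<open>s\<close> with the property that \<open>w (t - s)\<close> is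
  close to \<open>\<alpha>\<close> whenever \<open>w (t)\<close> is sufficiently close to \<open>\<alpha>\<close> form a semigroup, which is therefore asymptotically dense. So \<open>w\<close> exceeds
  \<open>\<alpha> / 2\<close> at arbitrarily many consecutive points at distance \<open>h\<close>, and \<open>Z\<close> would be unbounded.\<close>

lemma (in pos_law) limsup_increment_le_0:
  fixes Z :: "real \<Rightarrow> real"
  assumes pos: "AE x in \<mu>. 0 < x" and nl: "nonlattice \<mu>"
    and [measurable]: "Z \<in> borel_measurable borel" and bd: "\<And>t. \<bar>Z t\<bar> \<le> C"
    and uc: "\<And>\<epsilon>. 0 < \<epsilon> \<Longrightarrow> \<exists>\<delta>>0. \<forall>x y. \<bar>x - y\<bar> < \<delta> \<longrightarrow> \<bar>Z x - Z y\<bar> < \<epsilon>"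
    and har: "((\<lambda>t. Z t - (LINT y|\<mu>. Z (t - y))) \<longlongrightarrow> 0) at_top"
    and h: "0 < h" and a: "0 < a"
  shows "eventually (\<lambda>t. Z t - Z (t - h) < a) at_top"
proof (rule ccontr)
  assume contr: "\<not> ?thesis"
  define w where "w t = Z t - Z (t - h)" for t
  have [measurable]: "w \<in> borel_measurable borel" unfolding w_def[abs_def] by measurable
  have C: "0 \<le> C" using bd[of 0] by linarith
  have wbd: "\<bar>w t\<bar> \<le> 2 * C" for t using bd[of t] bd[of "t - h"] by (simp add: w_def)
  have wuc: "\<exists>\<delta>>0. \<forall>x y. \<bar>x - y\<bar> < \<delta> \<longrightarrow> \<bar>w x - w y\<bar> < \<epsilon>" if "0 < \<epsilon>" for \<epsilon>
  proof -
    obtain \<delta> where d: "0 < \<delta>" "\<And>x y. \<bar>x - y\<bar> < \<delta> \<Longrightarrow> \<bar>Z x - Z y\<bar> < \<epsilon> / 2"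
      using uc[of "\<epsilon> / 2"] \<open>0 < \<epsilon>\<close> by auto
    have "\<bar>w x - w y\<bar> < \<epsilon>" if "\<bar>x - y\<bar> < \<delta>" for x y
    proof -
      have "\<bar>Z x - Z y\<bar> < \<epsilon> / 2" "\<bar>Z (x - h) - Z (y - h)\<bar> < \<epsilon> / 2" using that by (intro d(2); simp)+
      then show ?thesis unfolding w_def abs_less_iff by (intro conjI) linarith+
    qed
    then show ?thesis using d(1) by auto
  qed
  have Zint: "integrable \<mu> (\<lambda>y. Z (t - y))" for t
    by (rule integrable_bounded[of _ C]) (use bd in auto)
  have wint: "integrable \<mu> (\<lambda>y. w (t - y))" for t
    by (rule integrable_bounded[of _ "2 * C"]) (use wbd in auto)
  have whar: "((\<lambda>t. w t - (LINT y|\<mu>. w (t - y))) \<longlongrightarrow> 0) at_top"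
  proof -
    from filterlim_compose[OF har filterlim_diff_at_top] tendsto_diff[OF har]
    have "((\<lambda>t. (Z t - (LINT y|\<mu>. Z (t - y))) - (Z (t - h) - (LINT y|\<mu>. Z (t - h - y)))) \<longlongrightarrow> 0 - 0) at_top"
      by blast
    moreover have "w t - (LINT y|\<mu>. w (t - y)) = (Z t - (LINT y|\<mu>. Z (t - y))) - (Z (t - h) - (LINT y|\<mu>. Z (t - h - y)))" for t
      using Zint[of t] Zint[of "t - h"] by (simp add: w_def algebra_simps)
    ultimately show ?thesis by simp
  qed
  \<comment> \<open>The limit superior of \<open>w\<close> is the infimum of its eventual upper bounds.\<close>
  define A where "A = {b. eventually (\<lambda>t. w t \<le> b) at_top}"
  have Ag: "a \<le> b" if "b \<in> A" for b
  proof (rule ccontr)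
    assume "\<not> a \<le> b"
    then have "eventually (\<lambda>t. w t < a) at_top" using that unfolding A_def by (auto elim: eventually_mono)
    then show False using contr by (simp add: w_def)
  qed
  have An: "2 * C \<in> A" using wbd by (auto simp: A_def abs_le_iff)
  define \<alpha> where "\<alpha> = Inf A"
  have \<alpha>: "0 < \<alpha>" using cInf_greatest[of A a] Ag An a by (fastforce simp: \<alpha>_def)
  have up: "eventually (\<lambda>t. w t \<le> \<alpha> + e) at_top" if "0 < e" for e
  proof -
    have "Inf A < \<alpha> + e" using that by (simp add: \<alpha>_def)
    then obtain b where "b \<in> A" "b < \<alpha> + e" using cInf_lessD[of A "\<alpha> + e"] An by blast
    then show ?thesis unfolding A_def by (auto elim: eventually_mono)
  qed
  have fr: "\<not> eventually (\<lambda>t. w t \<le> \<alpha> - e) at_top" if "0 < e" for e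
  proof
    assume "eventually (\<lambda>t. w t \<le> \<alpha> - e) at_top"
    then have "\<alpha> - e \<in> A" by (simp add: A_def)
    then have "\<alpha> \<le> \<alpha> - e" unfolding \<alpha>_def by (rule cInf_lower) (rule bdd_belowI[OF Ag])
    then show False using that by simp
  qed
  define S where "S = {s. 0 \<le> s \<and> (\<forall>\<epsilon>>0. \<exists>\<epsilon>'>0. eventually (\<lambda>t. w t \<ge> \<alpha> - \<epsilon>' \<longrightarrow> w (t - s) \<ge> \<alpha> - \<epsilon>) at_top)}"
  have S0: "0 \<in> S" by (auto simp: S_def)
  have Sadd: "s + s' \<in> S" if s: "s \<in> S" and s': "s' \<in> S" for s s'
  proof -
    have "\<exists>e'>0. eventually (\<lambda>t. w t \<ge> \<alpha> - e' \<longrightarrow> w (t - (s + s')) \<ge> \<alpha> - \<epsilon>) at_top" if "0 < \<epsilon>" for \<epsilon>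
    proof -
      obtain e1 where e1: "0 < e1" "eventually (\<lambda>t. w t \<ge> \<alpha> - e1 \<longrightarrow> w (t - s') \<ge> \<alpha> - \<epsilon>) at_top"
        using s' \<open>0 < \<epsilon>\<close> by (auto simp: S_def)
      obtain e2 where e2: "0 < e2" "eventually (\<lambda>t. w t \<ge> \<alpha> - e2 \<longrightarrow> w (t - s) \<ge> \<alpha> - e1) at_top"
        using s e1(1) by (auto simp: S_def)
      from eventually_compose_filterlim[OF e1(2) filterlim_diff_at_top]
      have "eventually (\<lambda>t. w (t - s) \<ge> \<alpha> - e1 \<longrightarrow> w (t - s - s') \<ge> \<alpha> - \<epsilon>) at_top" .
      with e2(2) have "eventually (\<lambda>t. w t \<ge> \<alpha> - e2 \<longrightarrow> w (t - (s + s')) \<ge> \<alpha> - \<epsilon>) at_top"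
        by eventually_elim (simp add: algebra_simps)
      then show ?thesis using e2(1) by blast
    qed
    then show ?thesis using s s' by (auto simp: S_def)
  qed
  have supp: "s \<in> S" if s: "\<forall>\<delta>>0. emeasure \<mu> {s - \<delta><..<s + \<delta>} \<noteq> 0" and "0 \<le> s" for s
    unfolding S_def
  proof (intro CollectI conjI allI impI \<open>0 \<le> s\<close>)
    fix \<epsilon> :: real assume e: "0 < \<epsilon>"
    obtain \<delta> where d: "0 < \<delta>" "\<And>x y. \<bar>x - y\<bar> < \<delta> \<Longrightarrow> \<bar>w x - w y\<bar> < \<epsilon> / 2"
      using wuc[of "\<epsilon> / 2"] e by auto
    let ?N = "{s - \<delta><..<s + \<delta>}"
    define p where "p = measure \<mu> ?N"
    have p: "0 < p" using s d(1) unfolding p_def by (simp add: emeasure_eq_measure zero_less_measure_iff)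
    \<comment> \<open>If \<open>w (t - s)\<close> were below \<open>\<alpha> - \<epsilon>\<close>, the law would put mass \<open>p\<close> on arguments where \<open>w\<close> is below \<open>\<alpha> - \<epsilon> / 2\<close>, a loss of \<open>8 * e'\<close>; all other errors amount to at most \<open>4 * e'\<close>.\<close>
    define e' where "e' = p * \<epsilon> / 16"
    have e': "0 < e'" using p e by (simp add: e'_def)
    obtain T1 where T1: "\<And>t. T1 \<le> t \<Longrightarrow> w t \<le> \<alpha> + e'" using up[OF e'] by (auto simp: eventually_at_top_linorder)
    define K where "K = 2 * C + \<alpha> + \<epsilon>"
    have K: "0 < K" using C \<alpha> e by (simp add: K_def)
    from filterlim_compose[OF tail_tendsto_0 filterlim_diff_at_top]
    have tl: "eventually (\<lambda>t. measure \<mu> {t - T1<..} < e' / K) at_top"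
      by (rule order_tendstoD) (use e' K in simp)
    have hr: "eventually (\<lambda>t. w t - (LINT y|\<mu>. w (t - y)) < e') at_top"
      using order_tendstoD(2)[OF whar e'] .
    have "eventually (\<lambda>t. w t \<ge> \<alpha> - e' \<longrightarrow> w (t - s) \<ge> \<alpha> - \<epsilon>) at_top"
      using tl hr
    proof eventually_elim
      case (elim t)
      show ?case
      proof (intro impI, rule ccontr)
        assume wt: "\<alpha> - e' \<le> w t" and "\<not> \<alpha> - \<epsilon> \<le> w (t - s)"
        then have ws: "w (t - s) < \<alpha> - \<epsilon>" by simp
        have I: "integrable \<mu> (\<lambda>y. \<epsilon> / 2 * indicator ?N y - K * indicator {t - T1<..} y)"
          by (rule integrable_bounded[of _ "\<epsilon> + K"]) (use e K in \<open>auto simp: indicator_def\<close>)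
        have "(LINT y|\<mu>. \<epsilon> / 2 * indicator ?N y - K * indicator {t - T1<..} y) \<le> (LINT y|\<mu>. \<alpha> + e' - w (t - y))"
        proof (rule integral_mono[OF I])
          show "integrable \<mu> (\<lambda>y. \<alpha> + e' - w (t - y))" using wint by simp
          fix y
          have 1: "\<alpha> + e' - w (t - y) \<ge> - 2 * C" using wbd[of "t - y"] \<alpha> e' by (simp add: abs_le_iff)
          have 2: "0 \<le> \<alpha> + e' - w (t - y)" if "y \<le> t - T1" using T1[of "t - y"] that by simp
          have 3: "\<epsilon> / 2 \<le> \<alpha> + e' - w (t - y)" if "y \<in> ?N"
          proof -
            have "\<bar>(t - y) - (t - s)\<bar> < \<delta>" using that by auto
            then have "w (t - y) < \<alpha> - \<epsilon> / 2" using d(2)[of "t - y" "t - s"] ws unfolding abs_less_iff by linarith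
            then show ?thesis using e' by simp
          qed
          show "\<epsilon> / 2 * indicator ?N y - K * indicator {t - T1<..} y \<le> \<alpha> + e' - w (t - y)"
            using 1 2 3 \<alpha> e C by (cases "y \<le> t - T1"; cases "y \<in> ?N") (auto simp: K_def)
        qed
        also have "(LINT y|\<mu>. \<alpha> + e' - w (t - y)) = \<alpha> + e' - (LINT y|\<mu>. w (t - y))"
          using wint[of t] by (simp add: prob_space)
        also have "\<dots> \<le> 3 * e'" using elim(2) wt by simp
        also have "(LINT y|\<mu>. \<epsilon> / 2 * indicator ?N y - K * indicator {t - T1<..} y) = \<epsilon> / 2 * p - K * measure \<mu> {t - T1<..}"
          by (subst Bochner_Integration.integral_diff)
             (auto simp: p_def emeasure_eq_measure less_top[symmetric])
        finally have "\<epsilon> / 2 * p - K * measure \<mu> {t - T1<..} \<le> 3 * e'" .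
        moreover have "K * measure \<mu> {t - T1<..} \<le> e'" using elim(1) K by (simp add: field_simps)
        moreover have "\<epsilon> / 2 * p = 8 * e'" by (simp add: e'_def)
        ultimately show False using e' by linarith
      qed
    qed
    then show "\<exists>\<epsilon>'>0. eventually (\<lambda>t. \<alpha> - \<epsilon>' \<le> w t \<longrightarrow> \<alpha> - \<epsilon> \<le> w (t - s)) at_top" using e' by blast
  qed
  have AES: "AE s in \<mu>. s \<in> S \<and> 0 < s"
    using AE_in_support[OF sets_pos] pos by eventually_elim (auto intro: supp)
  obtain p where p: "p \<in> S" "0 < p"
  proof -
    have "\<not> (\<forall>p. \<not> (p \<in> S \<and> 0 < p))"
    proof
      assume "\<forall>p. \<not> (p \<in> S \<and> 0 < p)"
      with AES have "AE s in \<mu>. False" by simp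
      then show False by simp
    qed
    then show ?thesis using that by blast
  qed
  have nlS: "\<not> S \<subseteq> {d * real n | n. True}" if "d > 0" for d
  proof
    assume "S \<subseteq> {d * real n | n. True}"
    then have "AE s in \<mu>. s \<in> {d * real n | n. True}" using AES by (auto elim: eventually_mono)
    then show False using nl that by (auto simp: nonlattice_def)
  qed
  obtain \<delta> where d: "0 < \<delta>" "\<And>x y. \<bar>x - y\<bar> < \<delta> \<Longrightarrow> \<bar>w x - w y\<bar> < \<alpha> / 4"
    using wuc[of "\<alpha> / 4"] \<alpha> by auto
  obtain x0 where x0: "\<And>x. x0 \<le> x \<Longrightarrow> \<exists>s\<in>S. \<bar>x - s\<bar> \<le> \<delta> / 2"
    using semigroup_eventually_dense[OF S0 _ Sadd p nlS, of "\<delta> / 2"] d(1) by (auto simp: S_def)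
  have ind: "\<exists>\<epsilon>'>0. eventually (\<lambda>t. w t \<ge> \<alpha> - \<epsilon>' \<longrightarrow> (\<forall>i<K. w (t - (x0 + real i * h)) \<ge> \<alpha> / 2)) at_top" for K :: nat
  proof (induction K)
    case 0 show ?case by (auto intro: exI[of _ 1])
  next
    case (Suc K)
    then obtain e1 where e1: "0 < e1" "eventually (\<lambda>t. w t \<ge> \<alpha> - e1 \<longrightarrow> (\<forall>i<K. w (t - (x0 + real i * h)) \<ge> \<alpha> / 2)) at_top"
      by blast
    obtain s where s: "s \<in> S" "\<bar>x0 + real K * h - s\<bar> \<le> \<delta> / 2" using x0[of "x0 + real K * h"] h by auto
    obtain e2 where e2: "0 < e2" "eventually (\<lambda>t. w t \<ge> \<alpha> - e2 \<longrightarrow> w (t - s) \<ge> \<alpha> - \<alpha> / 4) at_top"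
      using s(1) \<alpha> unfolding S_def by (auto dest!: spec[of _ "\<alpha> / 4"])
    have "eventually (\<lambda>t. w t \<ge> \<alpha> - min e1 e2 \<longrightarrow> (\<forall>i<Suc K. w (t - (x0 + real i * h)) \<ge> \<alpha> / 2)) at_top"
      using e1(2) e2(2)
    proof eventually_elim
      case (elim t)
      have "\<bar>w (t - (x0 + real K * h)) - w (t - s)\<bar> < \<alpha> / 4"
      proof (rule d(2))
        have "\<bar>t - (x0 + real K * h) - (t - s)\<bar> = \<bar>x0 + real K * h - s\<bar>" by simp
        also have "\<dots> < \<delta>" using s(2) d(1) by linarith
        finally show "\<bar>t - (x0 + real K * h) - (t - s)\<bar> < \<delta>" .
      qed
      then have "\<alpha> / 2 \<le> w (t - (x0 + real K * h))" if "\<alpha> - \<alpha> / 4 \<le> w (t - s)"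
        using that unfolding abs_less_iff by linarith
      then show ?case using elim by (auto simp: less_Suc_eq)
    qed
    then show ?case using e1(1) e2(1) by (intro exI[of _ "min e1 e2"]) auto
  qed
  obtain K :: nat where K: "2 * C / (\<alpha> / 2) < real K" using reals_Archimedean2 by blast
  obtain e' where e': "0 < e'" "eventually (\<lambda>t. w t \<ge> \<alpha> - e' \<longrightarrow> (\<forall>i<K. w (t - (x0 + real i * h)) \<ge> \<alpha> / 2)) at_top"
    using ind[of K] by blast
  have "\<exists>t. (\<forall>i<K. w (t - (x0 + real i * h)) \<ge> \<alpha> / 2)"
  proof (rule ccontr)
    assume "\<not> ?thesis"
    with e'(2) have "eventually (\<lambda>t. w t \<le> \<alpha> - e') at_top" by (auto elim!: eventually_mono)
    then show False using fr[OF e'(1)] by simp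
  qed
  then obtain t where t: "\<And>i. i < K \<Longrightarrow> w (t - (x0 + real i * h)) \<ge> \<alpha> / 2" by blast
  \<comment> \<open>The increments telescope, so their sum is bounded by twice the bound of \<open>Z\<close>.\<close>
  have tele: "(\<Sum>i<n. w (t - (x0 + real i * h))) = Z (t - x0) - Z (t - x0 - real n * h)" for n
    by (induction n) (simp_all add: w_def algebra_simps)
  have "real K * (\<alpha> / 2) \<le> (\<Sum>i<K. w (t - (x0 + real i * h)))"
    using sum_bounded_below[of "{..<K}" "\<alpha> / 2"] t by simp
  also have "\<dots> \<le> 2 * C" unfolding tele using bd[of "t - x0"] bd[of "t - x0 - real K * h"] by (simp add: abs_le_iff)
  finally show False using K \<alpha> by (simp add: field_simps)
qed

lemma (in pos_law) increment_tendsto_0: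
  fixes Z :: "real \<Rightarrow> real"
  assumes pos: "AE x in \<mu>. 0 < x" and nl: "nonlattice \<mu>"
    and Zm: "Z \<in> borel_measurable borel" and bd: "\<And>t. \<bar>Z t\<bar> \<le> C"
    and uc: "\<And>\<epsilon>. 0 < \<epsilon> \<Longrightarrow> \<exists>\<delta>>0. \<forall>x y. \<bar>x - y\<bar> < \<delta> \<longrightarrow> \<bar>Z x - Z y\<bar> < \<epsilon>"
    and har: "((\<lambda>t. Z t - (LINT y|\<mu>. Z (t - y))) \<longlongrightarrow> 0) at_top"
    and h: "0 < h"
  shows "((\<lambda>t. Z t - Z (t - h)) \<longlongrightarrow> 0) at_top"
proof (rule order_tendstoI)
  fix a :: real assume "0 < a"
  then show "eventually (\<lambda>t. Z t - Z (t - h) < a) at_top"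
    by (intro limsup_increment_le_0[OF pos nl Zm bd uc har h])
next
  fix a :: real assume "a < 0"
  have "eventually (\<lambda>t. (- Z t) - (- Z (t - h)) < - a) at_top"
  proof (rule limsup_increment_le_0[OF pos nl, where Z = "\<lambda>t. - Z t"])
    show "((\<lambda>t. - Z t - (LINT y|\<mu>. - Z (t - y))) \<longlongrightarrow> 0) at_top"
      using tendsto_minus[OF har] by simp
    show "\<exists>\<delta>>0. \<forall>x y. \<bar>x - y\<bar> < \<delta> \<longrightarrow> \<bar>- Z x - - Z y\<bar> < \<epsilon>" if "0 < \<epsilon>" for \<epsilon>
      using uc[OF that] by (simp add: abs_minus_commute)
  qed (use Zm bd h \<open>a < 0\<close> in auto)
  then show "eventually (\<lambda>t. a < Z t - Z (t - h)) at_top"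
    by (rule eventually_mono) simp
qed

section \<open>Blackwell's theorem\<close>

context prw_setup
begin

lemma renewal_equation:
  assumes [measurable]: "g \<in> borel_measurable borel"
  shows "conv \<nu> g t = conv G g t + conv F (conv \<nu> g) t"
proof -
  let ?a = "\<lambda>n. (conv F ^^ n) (conv G g)"
  have "conv \<nu> g = (\<lambda>u. \<Sum>n. ?a n u)" by (rule ext) (rule conv_\<nu>[OF assms])
  then have "conv F (conv \<nu> g) t = conv F (\<lambda>u. \<Sum>n. ?a n u) t" by simp
  also have "\<dots> = (\<Sum>n. conv F (?a n) t)"
    unfolding conv_def[of F "\<lambda>u. \<Sum>n. ?a n u"]
    by (subst nn_integral_suminf) (auto simp: conv_def[of F "(conv F ^^ _) _", symmetric] conv_def[symmetric])
  also have "\<dots> = (\<Sum>n. ?a (Suc n) t)" by simp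
  finally have "conv G g t + conv F (conv \<nu> g) t = ?a 0 t + (\<Sum>n. ?a (Suc n) t)" by simp
  also have "\<dots> = (\<Sum>n. ?a n t)"
    by (subst suminf_offset[of _ 1]) (auto simp del: funpow.simps simp: funpow_0)
  finally show ?thesis by (simp add: conv_\<nu>)
qed

end

locale prw_nonlattice = prw_finite_mean +
  assumes nonlattice_F: "nonlattice F"
begin

text \<open>By \<open>renewal_equation\<close>, \<open>Z = g * V\<close> is asymptotically harmonic for \<open>F\<close>, so its increments vanish at infinity
  and it is asymptotically equal to its own average over a delay with law \<open>F0\<close>. By \<open>delay_step\<close> that average
  equals the integral of \<open>g\<close> divided by \<open>m\<close>, up to the effect of the perturbation, which dies out.\<close>

lemma lipschitz_renewal:
  fixes g :: "real \<Rightarrow> real"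
  assumes [measurable]: "g \<in> borel_measurable borel"
    and g01: "\<And>x. 0 \<le> g x" "\<And>x. g x \<le> 1" and g0: "\<And>x. x < 0 \<Longrightarrow> g x = 0" "\<And>x. c \<le> x \<Longrightarrow> g x = 0"
    and lip: "\<And>x y. \<bar>g x - g y\<bar> \<le> K * \<bar>x - y\<bar>" and K: "0 < K" and c: "0 \<le> c"
  shows "((\<lambda>t. enn2real (conv \<nu> (\<lambda>u. ennreal (g u)) t)) \<longlongrightarrow> enn2real (\<integral>\<^sup>+ x. ennreal (g x) \<partial>lborel) / m) at_top"
proof -
  define g' where "g' u = ennreal (g u)" for u
  have [measurable]: "g' \<in> borel_measurable borel" unfolding g'_def[abs_def] by measurable
  have g'ind: "g' u \<le> indicator {0..<c} u" for u
    using g0[of u] g01(2)[of u] by (auto simp: g'_def indicator_def ennreal_le_1 not_le not_less)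
  define Z where "Z t = enn2real (conv \<nu> g' t)" for t
  obtain C where C: "0 \<le> C" "\<And>t. emeasure \<nu> {t - c<..t} \<le> ennreal C" using window_bound[of c] by blast
  have cle: "conv \<nu> g' t \<le> ennreal C" for t
  proof -
    have "conv \<nu> g' t \<le> conv \<nu> (indicator {0..<c}) t" by (rule conv_mono) (rule g'ind)
    also have "\<dots> \<le> ennreal C" using C by (simp add: conv_window)
    finally show ?thesis .
  qed
  have Z: "conv \<nu> g' t = ennreal (Z t)" for t
    using le_less_trans[OF cle[of t] ennreal_less_top] by (simp add: Z_def)
  have Z0: "0 \<le> Z t" for t by (simp add: Z_def)
  have ZC: "Z t \<le> C" for t using cle[of t] C(1) by (simp add: Z)
  have Zm [measurable]: "Z \<in> borel_measurable borel" unfolding Z_def[abs_def] by measurable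
  have Zbd: "\<bar>Z t\<bar> \<le> C" for t using Z0 ZC by simp
  have Zlip1: "Z x \<le> Z y + K * \<bar>x - y\<bar> * C" for x y
  proof -
    have "conv \<nu> g' x \<le> (\<integral>\<^sup>+ s. g' (y - s) + ennreal (K * \<bar>x - y\<bar>) * indicator {0..<c} (x - s) \<partial>\<nu>)"
      unfolding conv_def
    proof (rule nn_integral_mono)
      fix s
      have "g (x - s) \<le> g (y - s) + K * \<bar>x - y\<bar> * indicator {0..<c} (x - s)"
        using lip[of "x - s" "y - s"] g0[of "x - s"] g01(1)[of "y - s"]
        by (auto simp: indicator_def not_less abs_le_iff)
      then show "g' (x - s) \<le> g' (y - s) + ennreal (K * \<bar>x - y\<bar>) * indicator {0..<c} (x - s)"
        using K g01(1) by (auto simp: g'_def indicator_def ennreal_plus[symmetric] intro!: ennreal_leI simp del: ennreal_plus)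
    qed
    also have "\<dots> = conv \<nu> g' y + ennreal (K * \<bar>x - y\<bar>) * conv \<nu> (indicator {0..<c}) x"
      unfolding conv_def
      by (subst nn_integral_add, measurable, subst nn_integral_cmult, measurable)
    also have "\<dots> \<le> ennreal (Z y) + ennreal (K * \<bar>x - y\<bar>) * ennreal C"
      using C by (intro add_mono mult_left_mono) (auto simp: conv_window Z)
    also have "\<dots> = ennreal (Z y + K * \<bar>x - y\<bar> * C)"
      using K C Z0 by (simp add: ennreal_mult'[symmetric] ennreal_plus[symmetric] del: ennreal_plus)
    finally have "ennreal (Z x) \<le> ennreal (Z y + K * \<bar>x - y\<bar> * C)" by (simp only: Z)
    moreover have "0 \<le> Z y + K * \<bar>x - y\<bar> * C" using K C Z0[of y] by simp
    ultimately show ?thesis by (simp only: ennreal_le_iff)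
  qed
  have Zuc: "\<exists>\<delta>>0. \<forall>x y. \<bar>x - y\<bar> < \<delta> \<longrightarrow> \<bar>Z x - Z y\<bar> < \<epsilon>" if e: "0 < \<epsilon>" for \<epsilon>
  proof (intro exI[of _ "\<epsilon> / (K * (C + 1))"] conjI allI impI)
    show "0 < \<epsilon> / (K * (C + 1))" using e K C by simp
    fix x y assume d: "\<bar>x - y\<bar> < \<epsilon> / (K * (C + 1))"
    have "K * \<bar>x - y\<bar> * C \<le> K * \<bar>x - y\<bar> * (C + 1)" using K by (intro mult_left_mono) auto
    also have "\<dots> = \<bar>x - y\<bar> * (K * (C + 1))" by simp
    also have "\<dots> < \<epsilon>" using d K C by (subst pos_less_divide_eq[symmetric]) auto
    finally have "K * \<bar>x - y\<bar> * C < \<epsilon>" .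
    moreover have "K * \<bar>y - x\<bar> * C = K * \<bar>x - y\<bar> * C" by (simp add: abs_minus_commute)
    ultimately show "\<bar>Z x - Z y\<bar> < \<epsilon>"
      using Zlip1[of x y] Zlip1[of y x] unfolding abs_less_iff by linarith
  qed
  have FZ: "conv F (conv \<nu> g') t = ennreal (LINT y|F. Z (t - y))" for t
    unfolding conv_def[of F] Z
    by (intro nn_integral_eq_integral F.integrable_bounded[of _ C]) (use Zbd Z0 in auto)
  have har: "((\<lambda>t. Z t - (LINT y|F. Z (t - y))) \<longlongrightarrow> 0) at_top"
  proof -
    have le: "Z t - (LINT y|F. Z (t - y)) \<le> measure G {t - c<..}" and ge: "0 \<le> Z t - (LINT y|F. Z (t - y))" for t
    proof -
      have I0: "0 \<le> (LINT y|F. Z (t - y))" by (intro integral_nonneg_AE) (auto simp: Z0)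
      have eq: "ennreal (Z t) = conv G g' t + ennreal (LINT y|F. Z (t - y))"
        using renewal_equation[of g' t] by (simp add: Z[symmetric] FZ)
      also have "\<dots> \<le> ennreal (measure G {t - c<..}) + ennreal (LINT y|F. Z (t - y))"
      proof (rule add_right_mono)
        have "conv G g' t \<le> conv G (indicator {0..<c}) t" by (rule conv_mono) (rule g'ind)
        also have "\<dots> = emeasure G {t - c<..t}" by (rule conv_window) simp
        also have "\<dots> \<le> emeasure G {t - c<..}" by (intro emeasure_mono) auto
        finally show "conv G g' t \<le> ennreal (measure G {t - c<..})" by (simp add: G.emeasure_eq_measure)
      qed
      also have "\<dots> = ennreal (measure G {t - c<..} + (LINT y|F. Z (t - y)))" using I0 by simp
      finally have "Z t \<le> measure G {t - c<..} + (LINT y|F. Z (t - y))"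
        using I0 by (subst (asm) ennreal_le_iff) auto
      then show "Z t - (LINT y|F. Z (t - y)) \<le> measure G {t - c<..}" by simp
      have "ennreal (LINT y|F. Z (t - y)) \<le> ennreal (Z t)" unfolding eq by simp
      then show "0 \<le> Z t - (LINT y|F. Z (t - y))" using Z0 by simp
    qed
    note lim = filterlim_compose[OF G.tail_tendsto_0 filterlim_diff_at_top[of c]]
    show ?thesis
      by (rule tendsto_sandwich[OF _ _ tendsto_const lim]) (use le ge in auto)
  qed
  have Fpos: "AE x in F. 0 < x" using xi_pos by (simp add: AE_distr_iff)
  have incr: "((\<lambda>t. Z t - Z (t - h)) \<longlongrightarrow> 0) at_top" if "0 \<le> h" for h
    using F.increment_tendsto_0[OF Fpos nonlattice_F Zm Zbd Zuc har, of h] that by (cases "h = 0") auto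
  have Zi: "integrable F0 (\<lambda>x. Z (t - x))" for t
    by (rule F0.integrable_bounded[of _ C]) (use Zbd in auto)
  have A: "((\<lambda>t. LINT x|F0. Z t - Z (t - x)) \<longlongrightarrow> (LINT x|F0. 0)) at_top"
  proof (rule integral_dominated_convergence_at_top[where w = "\<lambda>_. 2 * C"])
    show "AE x in F0. ((\<lambda>t. Z t - Z (t - x)) \<longlongrightarrow> 0) at_top"
      using F0.nonneg by eventually_elim (rule incr)
    have "\<bar>Z t - Z (t - x)\<bar> \<le> 2 * C" for t x using Zbd[of t] Zbd[of "t - x"] by linarith
    then show "\<forall>\<^sub>F t in at_top. AE x in F0. norm (Z t - Z (t - x)) \<le> 2 * C" by simp
  qed auto
  define I where "I = enn2real (\<integral>\<^sup>+ x. g' x \<partial>lborel)"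
  have lint: "(\<integral>\<^sup>+ x. g' x \<partial>lborel) \<le> ennreal c"
  proof -
    have "(\<integral>\<^sup>+ x. g' x \<partial>lborel) \<le> (\<integral>\<^sup>+ x. indicator {0..<c} x \<partial>lborel)" by (intro nn_integral_mono g'ind)
    then show ?thesis using c by simp
  qed
  have refl: "(\<integral>\<^sup>+ x. g' (u - x) \<partial>lborel) = (\<integral>\<^sup>+ x. g' x \<partial>lborel)" for u
    using nn_integral_real_affine[of g' "-1" u] by (simp add: algebra_simps)
  define L where "L u = enn2real (lconv g' u)" for u
  have Lle: "lconv g' u \<le> (\<integral>\<^sup>+ x. g' x \<partial>lborel)" for u
    unfolding lconv_def refl[of u, symmetric] by (intro nn_integral_mono) (auto simp: indicator_def)
  have L: "lconv g' u = ennreal (L u)" for u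
    using le_less_trans[OF order_trans[OF Lle[of u] lint] ennreal_less_top] by (simp add: L_def)
  have Lbd: "\<bar>L u\<bar> \<le> c" for u
    using order_trans[OF Lle[of u] lint] c unfolding L by (simp add: L_def)
  have Leq: "L u = I" if "c \<le> u" for u
  proof -
    have "lconv g' u = (\<integral>\<^sup>+ x. g' (u - x) \<partial>lborel)"
      unfolding lconv_def using that g0(2) by (intro nn_integral_cong) (auto simp: indicator_def g'_def not_le)
    then show ?thesis by (simp add: L_def I_def refl)
  qed
  have [measurable]: "L \<in> borel_measurable borel" unfolding L_def[abs_def] by measurable
  have "((\<lambda>t. LINT y|G. 1 / m * L (t - y)) \<longlongrightarrow> (LINT y|G. 1 / m * I)) at_top"
  proof (rule integral_dominated_convergence_at_top[where w = "\<lambda>_. 1 / m * c"])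
    show "AE y in G. ((\<lambda>t. 1 / m * L (t - y)) \<longlongrightarrow> 1 / m * I) at_top"
    proof (rule AE_I2)
      fix y
      have "eventually (\<lambda>t. 1 / m * L (t - y) = 1 / m * I) at_top"
        using eventually_ge_at_top[of "c + y"] by eventually_elim (simp add: Leq)
      then show "((\<lambda>t. 1 / m * L (t - y)) \<longlongrightarrow> 1 / m * I) at_top" by (rule tendsto_eventually)
    qed
    show "\<forall>\<^sub>F t in at_top. AE y in G. norm (1 / m * L (t - y)) \<le> 1 / m * c"
      using Lbd m_pos by (auto simp: abs_mult divide_right_mono)
  qed auto
  moreover have "(LINT y|G. 1 / m * I) = I / m" using G.prob_space by simp
  moreover have "(LINT y|G. 1 / m * L (t - y)) = (LINT x|F0. Z (t - x))" for t
  proof -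
    have "ennreal (LINT x|F0. Z (t - x)) = conv F0 (conv \<nu> g') t"
      unfolding conv_def[of F0] Z
      by (intro nn_integral_eq_integral[symmetric] Zi) (use Z0 in auto)
    also have "\<dots> = conv G (\<lambda>u. ennreal (1 / m) * lconv g' u) t"
    proof (rule delay_step)
      fix u
      show "g' u \<le> 1 * ennreal (exp u)"
        using g'ind[of u] ennreal_leI[of 1 "exp u"] by (auto simp: indicator_def split: if_splits intro: order_trans)
    qed auto
    also have "\<dots> = (\<integral>\<^sup>+ y. ennreal (1 / m * L (t - y)) \<partial>G)"
      unfolding conv_def L using m_pos by (simp add: ennreal_mult'[symmetric])
    also have "\<dots> = ennreal (LINT y|G. 1 / m * L (t - y))"
    proof (intro nn_integral_eq_integral G.integrable_bounded[of _ "1 / m * c"])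
      show "\<bar>1 / m * L (t - y)\<bar> \<le> 1 / m * c" for y using Lbd m_pos by (auto simp: abs_mult divide_right_mono)
      show "AE y in G. 0 \<le> 1 / m * L (t - y)" using m_pos by (simp add: L_def)
    qed measurable
    finally show ?thesis using m_pos Z0 by (subst (asm) ennreal_inj) (auto intro!: integral_nonneg_AE simp: L_def)
  qed
  ultimately have "((\<lambda>t. LINT x|F0. Z (t - x)) \<longlongrightarrow> I / m) at_top" by (simp only:)
  from tendsto_add[OF A this] have "((\<lambda>t. (LINT x|F0. Z t - Z (t - x)) + (LINT x|F0. Z (t - x))) \<longlongrightarrow> I / m) at_top"
    by simp
  moreover have "(LINT x|F0. Z t - Z (t - x)) + (LINT x|F0. Z (t - x)) = Z t" for t
    using Zi[of t] F0.prob_space by simp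
  ultimately show ?thesis by (simp add: Z_def I_def g'_def[abs_def])
qed

definition trapezoid :: "real \<Rightarrow> real \<Rightarrow> real \<Rightarrow> real" where
  "trapezoid h \<delta> x = max 0 (min 1 (min (x / \<delta>) ((h - x) / \<delta>)))"

lemma trapezoid_bounds: "0 \<le> trapezoid h \<delta> x" "trapezoid h \<delta> x \<le> 1"
  by (auto simp: trapezoid_def)

lemma trapezoid_eq_0: "0 < \<delta> \<Longrightarrow> x < 0 \<or> h \<le> x \<Longrightarrow> trapezoid h \<delta> x = 0"
proof -
  assume "0 < \<delta>" "x < 0 \<or> h \<le> x"
  then have "x / \<delta> \<le> 0 \<or> (h - x) / \<delta> \<le> 0" by (auto simp: divide_simps)
  then have "min (x / \<delta>) ((h - x) / \<delta>) \<le> 0" by (auto simp: min_def)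
  then have "min 1 (min (x / \<delta>) ((h - x) / \<delta>)) \<le> 0" by linarith
  then show ?thesis unfolding trapezoid_def by (rule max_absorb1)
qed

lemma trapezoid_eq_1: "0 < \<delta> \<Longrightarrow> \<delta> \<le> x \<Longrightarrow> x \<le> h - \<delta> \<Longrightarrow> trapezoid h \<delta> x = 1"
proof -
  assume "0 < \<delta>" "\<delta> \<le> x" "x \<le> h - \<delta>"
  then have "1 \<le> x / \<delta>" "1 \<le> (h - x) / \<delta>" by (auto simp: field_simps)
  then show ?thesis by (simp add: trapezoid_def)
qed

lemma trapezoid_le: "0 < \<delta> \<Longrightarrow> ennreal (trapezoid h \<delta> x) \<le> indicator {0..<h} x"
  using trapezoid_eq_0[of \<delta> x h] trapezoid_bounds(2)[of h \<delta> x] by (auto simp: indicator_def ennreal_le_1)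

lemma trapezoid_ge: "0 < \<delta> \<Longrightarrow> indicator {\<delta>..h - \<delta>} x \<le> ennreal (trapezoid h \<delta> x)"
  using trapezoid_eq_1[of \<delta> x h] by (auto simp: indicator_def)

lemma trapezoid_renewal:
  assumes "0 < \<delta>" "2 * \<delta> < h"
  obtains I where "h - 2 * \<delta> \<le> I" "I \<le> h"
    "((\<lambda>t. enn2real (conv \<nu> (\<lambda>u. ennreal (trapezoid h \<delta> u)) t)) \<longlongrightarrow> I / m) at_top"
proof
  let ?I = "enn2real (\<integral>\<^sup>+ x. ennreal (trapezoid h \<delta> x) \<partial>lborel)"
  have [measurable]: "trapezoid h \<delta> \<in> borel_measurable borel" unfolding trapezoid_def[abs_def] by measurable
  have up: "(\<integral>\<^sup>+ x. ennreal (trapezoid h \<delta> x) \<partial>lborel) \<le> ennreal h"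
  proof -
    have "(\<integral>\<^sup>+ x. ennreal (trapezoid h \<delta> x) \<partial>lborel) \<le> (\<integral>\<^sup>+ x. indicator {0..<h} x \<partial>lborel)"
      by (intro nn_integral_mono trapezoid_le assms)
    then show ?thesis using assms by simp
  qed
  have lo: "ennreal (h - 2 * \<delta>) \<le> (\<integral>\<^sup>+ x. ennreal (trapezoid h \<delta> x) \<partial>lborel)"
  proof -
    have "(\<integral>\<^sup>+ x. indicator {\<delta>..h - \<delta>} x \<partial>lborel) \<le> (\<integral>\<^sup>+ x. ennreal (trapezoid h \<delta> x) \<partial>lborel)"
      by (intro nn_integral_mono trapezoid_ge assms)
    then show ?thesis using assms by simp
  qed
  have "enn2real (ennreal (h - 2 * \<delta>)) \<le> ?I"
    using lo by (rule enn2real_mono) (use up in \<open>auto intro: le_less_trans\<close>)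
  then show "h - 2 * \<delta> \<le> ?I" using assms by simp
  show "?I \<le> h" using enn2real_mono[OF up] assms by simp
  show "((\<lambda>t. enn2real (conv \<nu> (\<lambda>u. ennreal (trapezoid h \<delta> u)) t)) \<longlongrightarrow> ?I / m) at_top"
  proof (rule lipschitz_renewal[where c = h and K = "1 / \<delta>"])
    fix x y
    have *: "\<bar>max 0 (min 1 (min a b)) - max 0 (min 1 (min c d))\<bar> \<le> max \<bar>a - c\<bar> \<bar>b - d\<bar>" for a b c d :: real
    proof -
      have 1: "\<bar>max 0 u - max 0 v\<bar> \<le> \<bar>u - v\<bar>" and 2: "\<bar>min 1 u - min 1 v\<bar> \<le> \<bar>u - v\<bar>" for u v :: real
        by (simp_all add: max_def min_def)
      have 3: "\<bar>min a b - min c d\<bar> \<le> max \<bar>a - c\<bar> \<bar>b - d\<bar>"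
      proof -
        define M where "M = max \<bar>a - c\<bar> \<bar>b - d\<bar>"
        have "\<bar>a - c\<bar> \<le> M" "\<bar>b - d\<bar> \<le> M" by (simp_all add: M_def)
        then have "a - c \<le> M" "c - a \<le> M" "b - d \<le> M" "d - b \<le> M" by linarith+
        then show ?thesis unfolding M_def[symmetric] by (simp add: min_def abs_le_iff)
      qed
      show ?thesis by (rule order_trans[OF 1 order_trans[OF 2 3]])
    qed
    have 1: "x / \<delta> - y / \<delta> = (x - y) / \<delta>" "(h - x) / \<delta> - (h - y) / \<delta> = - ((x - y) / \<delta>)"
      by (simp_all add: diff_divide_distrib)
    show "\<bar>trapezoid h \<delta> x - trapezoid h \<delta> y\<bar> \<le> 1 / \<delta> * \<bar>x - y\<bar>"
    proof -
      have "\<bar>trapezoid h \<delta> x - trapezoid h \<delta> y\<bar> \<le> max \<bar>(x - y) / \<delta>\<bar> \<bar>- ((x - y) / \<delta>)\<bar>"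
        using *[of "x / \<delta>" "(h - x) / \<delta>" "y / \<delta>" "(h - y) / \<delta>"] unfolding trapezoid_def 1 .
      also have "\<dots> = \<bar>x - y\<bar> / \<delta>" unfolding abs_minus_cancel using assms(1) by simp
      finally show ?thesis by simp
    qed
  next
    fix x show "x < 0 \<Longrightarrow> trapezoid h \<delta> x = 0" using assms by (intro trapezoid_eq_0) auto
    show "h \<le> x \<Longrightarrow> trapezoid h \<delta> x = 0" using assms by (intro trapezoid_eq_0) auto
  qed (use assms trapezoid_bounds in auto)
qed

text \<open>Indicators of intervals lie between trapezoids whose integrals differ by at most \<open>4 * \<delta>\<close>; the upper
  trapezoid is shifted by \<open>\<delta>\<close> to keep its support in the half-line.\<close>

lemma blackwell:
  assumes h: "0 < h"
  shows "((\<lambda>t. measure \<nu> {t - h<..t}) \<longlongrightarrow> h / m) at_top"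
proof -
  have fin: "emeasure \<nu> {a<..t} < \<infinity>" for a t
    by (rule le_less_trans[OF emeasure_mono \<nu>_finite[of t]]) auto
  have W: "conv \<nu> (indicator {0..<h}) t = emeasure \<nu> {t - h<..t}" for t by (rule conv_window) simp
  show ?thesis
  proof (rule order_tendstoI)
    fix a assume a: "a < h / m"
    define \<delta> where "\<delta> = min (h / 4) ((h - a * m) / 4)"
    have am: "a * m < h" using a m_pos by (simp add: field_simps)
    have d: "0 < \<delta>" "2 * \<delta> < h" using h am by (auto simp: \<delta>_def)
    from trapezoid_renewal[OF d] obtain I where I: "h - 2 * \<delta> \<le> I"
      "((\<lambda>t. enn2real (conv \<nu> (\<lambda>u. ennreal (trapezoid h \<delta> u)) t)) \<longlongrightarrow> I / m) at_top" by metis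
    have "a < I / m" using I(1) am m_pos by (auto simp: \<delta>_def field_simps min_def split: if_splits)
    from order_tendstoD(1)[OF I(2) this]
    show "eventually (\<lambda>t. a < measure \<nu> {t - h<..t}) at_top"
    proof eventually_elim
      case (elim t)
      have "conv \<nu> (\<lambda>u. ennreal (trapezoid h \<delta> u)) t \<le> emeasure \<nu> {t - h<..t}"
        unfolding W[symmetric] by (intro conv_mono trapezoid_le d)
      then have "enn2real (conv \<nu> (\<lambda>u. ennreal (trapezoid h \<delta> u)) t) \<le> measure \<nu> {t - h<..t}"
        unfolding measure_def using fin by (intro enn2real_mono) auto
      then show ?case using elim by simp
    qed
  next
    fix a assume a: "h / m < a"
    define \<delta> where "\<delta> = (a * m - h) / 4"
    have am: "h < a * m" using a m_pos by (simp add: field_simps)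
    have d: "0 < \<delta>" "2 * \<delta> < h + 2 * \<delta>" using h am by (auto simp: \<delta>_def)
    from trapezoid_renewal[OF d] obtain I where I: "I \<le> h + 2 * \<delta>"
      "((\<lambda>t. enn2real (conv \<nu> (\<lambda>u. ennreal (trapezoid (h + 2 * \<delta>) \<delta> u)) t)) \<longlongrightarrow> I / m) at_top" by metis
    note I2 = filterlim_compose[OF I(2) filterlim_diff_at_top[of "- \<delta>", simplified]]
    have "I / m < a" using I(1) am m_pos by (auto simp: \<delta>_def field_simps)
    from order_tendstoD(2)[OF I2 this]
    show "eventually (\<lambda>t. measure \<nu> {t - h<..t} < a) at_top"
    proof eventually_elim
      case (elim t)
      have le: "indicator {0..<h} x \<le> ennreal (trapezoid (h + 2 * \<delta>) \<delta> (x + \<delta>))" for x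
        using trapezoid_ge[OF d(1), of "h + 2 * \<delta>" "x + \<delta>"] by (auto simp: indicator_def split: if_splits)
      have "emeasure \<nu> {t - h<..t} \<le> conv \<nu> (\<lambda>u. ennreal (trapezoid (h + 2 * \<delta>) \<delta> u)) (t + \<delta>)"
        unfolding W[symmetric] unfolding conv_def
      proof (rule nn_integral_mono)
        fix x show "indicator {0..<h} (t - x) \<le> ennreal (trapezoid (h + 2 * \<delta>) \<delta> (t + \<delta> - x))"
          using le[of "t - x"] by (simp add: algebra_simps)
      qed
      moreover have "conv \<nu> (\<lambda>u. ennreal (trapezoid (h + 2 * \<delta>) \<delta> u)) (t + \<delta>) < top"
      proof -
        have "conv \<nu> (\<lambda>u. ennreal (trapezoid (h + 2 * \<delta>) \<delta> u)) (t + \<delta>) \<le> conv \<nu> H (t + \<delta>)"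
          using trapezoid_bounds(2)[of "h + 2 * \<delta>" \<delta>] trapezoid_eq_0[OF d(1)]
          by (intro conv_mono) (auto simp: indicator_def ennreal_le_1)
        then show ?thesis using conv_\<nu>_H_finite[of "t + \<delta>"] by (auto intro: le_less_trans)
      qed
      ultimately have "measure \<nu> {t - h<..t} \<le> enn2real (conv \<nu> (\<lambda>u. ennreal (trapezoid (h + 2 * \<delta>) \<delta> u)) (t + \<delta>))"
        unfolding measure_def by (intro enn2real_mono) auto
      then show ?case using elim by simp
    qed
  qed
qed

end

section \<open>The key renewal theorem\<close>

context prw_nonlattice
begin

lemma step_function_renewal:
  fixes a :: "nat \<Rightarrow> real" and st :: "real \<Rightarrow> ennreal"
  assumes h: "0 < h" and a0: "\<And>n. 0 \<le> a n" and sa: "summable a"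
    and st_def: "st = (\<lambda>x. \<Sum>n. ennreal (a n) * indicator {real n * h..<real (Suc n) * h} x)"
  obtains Y C where "\<And>t. conv \<nu> st t = ennreal (Y t)" "\<And>t. 0 \<le> Y t" "\<And>t. Y t \<le> C"
    "(Y \<longlongrightarrow> (\<Sum>n. a n) * h / m) at_top"
    "(\<integral>\<^sup>+ x. st x \<partial>lborel) = ennreal ((\<Sum>n. a n) * h)"
proof -
  define W where "W t = measure \<nu> {t - h<..t}" for t
  obtain C where C: "0 \<le> C" "\<And>t. emeasure \<nu> {t - h<..t} \<le> ennreal C" using window_bound[of h] by blast
  have eW: "emeasure \<nu> {t - h<..t} = ennreal (W t)" for t
    unfolding W_def using le_less_trans[OF C(2)[of t] ennreal_less_top] by (intro emeasure_eq_ennreal_measure) auto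
  have W: "0 \<le> W t" "W t \<le> C" for t
    using C(2)[of t] C(1) unfolding eW by (simp_all add: W_def)
  define Y where "Y t = (\<Sum>n. a n * W (t - real n * h))" for t
  have sm: "summable (\<lambda>n. a n * W (t - real n * h))" for t
    by (rule summable_comparison_test'[OF summable_mult2[OF sa, of C]]) (use a0 W in \<open>auto simp: abs_mult intro!: mult_left_mono\<close>)
  have ind: "indicator {real n * h..<real (Suc n) * h} x = (indicator {0..<h} (x - real n * h) :: ennreal)" for n x
    by (auto simp: indicator_def algebra_simps)
  have cW: "conv \<nu> (indicator {real n * h..<real (Suc n) * h}) t = ennreal (W (t - real n * h))" for n t
  proof -
    have "conv \<nu> (indicator {real n * h..<real (Suc n) * h}) t = conv \<nu> (indicator {0..<h}) (t - real n * h)"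
      unfolding conv_def ind by (intro nn_integral_cong) (simp add: algebra_simps)
    then show ?thesis using eW[of "t - real n * h"] by (simp add: conv_window)
  qed
  have "conv \<nu> st t = ennreal (Y t)" for t
  proof -
    have "conv \<nu> st t = (\<Sum>n. conv \<nu> (\<lambda>x. ennreal (a n) * indicator {real n * h..<real (Suc n) * h} x) t)"
      unfolding conv_def st_def by (rule nn_integral_suminf) measurable
    also have "\<dots> = (\<Sum>n. ennreal (a n * W (t - real n * h)))"
      by (simp add: \<nu>.conv_cmult cW ennreal_mult' a0 del: of_nat_Suc)
    also have "\<dots> = ennreal (Y t)"
      unfolding Y_def by (rule suminf_ennreal_eq) (use a0 W sm in \<open>auto intro!: summable_sums\<close>)
    finally show ?thesis .
  qed
  moreover have "0 \<le> Y t" for t unfolding Y_def by (intro suminf_nonneg sm) (use a0 W in auto)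
  moreover have "Y t \<le> (\<Sum>n. a n * C)" for t
    unfolding Y_def by (intro suminf_le sm summable_mult2 sa mult_left_mono W a0)
  moreover have "(Y \<longlongrightarrow> (\<Sum>n. a n) * h / m) at_top"
  proof -
    have lim: "((\<lambda>t. a n * W (t - real n * h)) \<longlongrightarrow> a n * (h / m)) at_top" for n
    proof -
      from filterlim_compose[OF blackwell[OF h] filterlim_diff_at_top] show ?thesis
        unfolding W_def by (intro tendsto_mult tendsto_const)
    qed
    have bd: "eventually (\<lambda>(n, t). norm (a n * W (t - real n * h)) \<le> a n * C) (at_top \<times>\<^sub>F at_top)"
      using a0 W by (intro always_eventually) (auto simp: abs_mult intro!: mult_left_mono)
    have "(Y \<longlongrightarrow> (\<Sum>n. a n * (h / m))) at_top"
      unfolding Y_def using tannerys_theorem[OF lim bd summable_mult2[OF sa]] by simp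
    also have "(\<Sum>n. a n * (h / m)) = (\<Sum>n. a n) * h / m"
      using suminf_mult2[OF sa, of "h / m"] by simp
    finally show ?thesis .
  qed
  moreover have "(\<integral>\<^sup>+ x. st x \<partial>lborel) = ennreal ((\<Sum>n. a n) * h)"
  proof -
    have "(\<integral>\<^sup>+ x. st x \<partial>lborel) = (\<Sum>n. \<integral>\<^sup>+ x. ennreal (a n) * indicator {real n * h..<real (Suc n) * h} x \<partial>lborel)"
      unfolding st_def by (rule nn_integral_suminf) measurable
    also have "\<dots> = (\<Sum>n. ennreal (a n * h))"
    proof (rule arg_cong[of _ _ suminf], rule ext)
      fix n
      have "real n * h \<le> real (Suc n) * h" "real (Suc n) * h - real n * h = h" using h by (auto simp: algebra_simps)
      then show "(\<integral>\<^sup>+ x. ennreal (a n) * indicator {real n * h..<real (Suc n) * h} x \<partial>lborel) = ennreal (a n * h)"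
        using a0 by (subst nn_integral_cmult_indicator) (simp_all add: ennreal_mult' del: of_nat_Suc)
    qed
    also have "\<dots> = ennreal ((\<Sum>n. a n) * h)"
      unfolding suminf_mult2[OF sa]
      by (rule suminf_ennreal_eq) (use a0 h sa in \<open>auto intro!: summable_sums summable_mult2\<close>)
    finally show ?thesis .
  qed
  ultimately show thesis by (rule that)
qed

text \<open>The function is enclosed between the step functions of its upper and its lower Riemann sums.
  The limits of the two renewal functions differ by as little as the sums do.\<close>

lemma key_renewal:
  fixes f :: "real \<Rightarrow> real"
  assumes f: "set_borel_measurable borel {0..} f" and f0: "\<And>y. y \<ge> 0 \<Longrightarrow> f y \<ge> 0"
    and dri: "directly_riemann_integrable f"
  defines "f' \<equiv> \<lambda>x. ennreal (indicator {0..} x * f x)"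
  shows "\<exists>C\<ge>0. \<forall>t. conv \<nu> f' t \<le> ennreal C"
    and "((\<lambda>t. enn2real (conv \<nu> f' t)) \<longlongrightarrow> 1 / m * (LINT y:{0..}|lborel. f y)) at_top"
proof -
  have fm: "(\<lambda>x. indicator {0..} x * f x) \<in> borel_measurable borel"
    using f by (simp add: set_borel_measurable_def)
  have f'm [measurable]: "f' \<in> borel_measurable borel" unfolding f'_def using fm by measurable
  define \<Phi> where "\<Phi> = (LINT y:{0..}|lborel. f y)"
  have \<Phi>: "\<Phi> = enn2real (\<integral>\<^sup>+ x. f' x \<partial>lborel)"
    unfolding \<Phi>_def set_lebesgue_integral_def f'_def
    using fm f0 by (subst integral_eq_nn_integral) (auto simp: indicator_def)
  have main: "\<exists>u l Y y C. (\<forall>t. conv \<nu> f' t \<le> ennreal (Y t)) \<and> (\<forall>t. ennreal (y t) \<le> conv \<nu> f' t)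
      \<and> (\<forall>t. 0 \<le> Y t \<and> Y t \<le> C \<and> 0 \<le> y t) \<and> (Y \<longlongrightarrow> u / m) at_top \<and> (y \<longlongrightarrow> l / m) at_top
      \<and> l \<le> \<Phi> \<and> \<Phi> \<le> u \<and> upper_sum f h = ennreal u \<and> lower_sum f h = ennreal l \<and> 0 \<le> l \<and> 0 \<le> u" if h: "0 < h" for h
  proof -
    let ?I = "\<lambda>n. {real n * h..<real (Suc n) * h}"
    let ?S = "\<lambda>n. SUP y\<in>?I n. ennreal (f y)" and ?L = "\<lambda>n. INF y\<in>?I n. ennreal (f y)"
    have ne: "?I n \<noteq> {}" for n using h by (auto simp: algebra_simps)
    have "ennreal h * (\<Sum>n. ?S n) < \<infinity>" using dri h unfolding directly_riemann_integrable_def upper_sum_def by blast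
    then have Sfin: "(\<Sum>n. ?S n) < top" using h by (auto simp: ennreal_mult_less_top)
    have LS: "?L n \<le> ?S n" for n using ne by (intro INF_le_SUP)
    have "(\<Sum>n. ?L n) \<le> (\<Sum>n. ?S n)" by (rule suminf_le[OF LS]) auto
    then have Lfin: "(\<Sum>n. ?L n) < top" using Sfin by (rule le_less_trans)
    define A where "A n = enn2real (?S n)" for n
    define A' where "A' n = enn2real (?L n)" for n
    have S: "?S n = ennreal (A n)" for n
      using ennreal_suminf_lessD[OF Sfin, of n] by (simp add: A_def)
    have L: "?L n = ennreal (A' n)" for n
      using ennreal_suminf_lessD[OF Lfin, of n] by (simp add: A'_def)
    have M0: "0 \<le> A n" "0 \<le> A' n" for n by (simp_all add: A_def A'_def)
    have Ms: "summable A" using Sfin M0(1) unfolding S by (intro summable_suminf_not_top) auto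
    have Ms': "summable A'" using Lfin M0(2) unfolding L by (intro summable_suminf_not_top) auto
    define st where "st = (\<lambda>x. \<Sum>n. ennreal (A n) * indicator {real n * h..<real (Suc n) * h} x)"
    define st' where "st' = (\<lambda>x. \<Sum>n. ennreal (A' n) * indicator {real n * h..<real (Suc n) * h} x)"
    obtain Y C where Y: "\<And>t. conv \<nu> st t = ennreal (Y t)" "\<And>t. 0 \<le> Y t" "\<And>t. Y t \<le> C"
      "(Y \<longlongrightarrow> (\<Sum>n. A n) * h / m) at_top" "(\<integral>\<^sup>+ x. st x \<partial>lborel) = ennreal ((\<Sum>n. A n) * h)"
      by (rule step_function_renewal[OF h M0(1) Ms st_def]) (rule that)
    obtain y C' where y: "\<And>t. conv \<nu> st' t = ennreal (y t)" "\<And>t. 0 \<le> y t" "\<And>t. y t \<le> C'"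
      "(y \<longlongrightarrow> (\<Sum>n. A' n) * h / m) at_top" "(\<integral>\<^sup>+ x. st' x \<partial>lborel) = ennreal ((\<Sum>n. A' n) * h)"
      by (rule step_function_renewal[OF h M0(2) Ms' st'_def]) (rule that)
    have single: "(\<Sum>n. ennreal (a n) * indicator (?I n) x) = ennreal (a (nat \<lfloor>x / h\<rfloor>))" if x: "0 \<le> x" for x a
    proof -
      let ?k = "nat \<lfloor>x / h\<rfloor>"
      have iff: "x \<in> ?I n \<longleftrightarrow> n = ?k" for n
      proof -
        have "x \<in> ?I n \<longleftrightarrow> real n \<le> x / h \<and> x / h < real n + 1" using h by (auto simp: field_simps)
        also have "\<dots> \<longleftrightarrow> \<lfloor>x / h\<rfloor> = int n" by (simp add: floor_eq_iff)
        also have "\<dots> \<longleftrightarrow> n = ?k" using x h by auto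
        finally show ?thesis .
      qed
      have "(\<Sum>n. ennreal (a n) * indicator (?I n) x) = (\<Sum>n\<in>{?k}. ennreal (a n) * indicator (?I n) x)"
        using iff by (intro suminf_finite) (auto simp: indicator_def simp del: of_nat_Suc)
      also have "\<dots> = ennreal (a ?k)" using iff[of ?k] by (simp add: indicator_def del: of_nat_Suc)
      finally show ?thesis .
    qed
    have mem: "x \<in> ?I (nat \<lfloor>x / h\<rfloor>)" if x: "0 \<le> x" for x
    proof -
      let ?k = "nat \<lfloor>x / h\<rfloor>"
      have "real ?k \<le> x / h" "x / h < real ?k + 1" using x h by (simp_all)
      then show ?thesis using h by (auto simp: field_simps)
    qed
    have neg: "(\<Sum>n. ennreal (a n) * indicator (?I n) x) = 0" if "x < 0" for x a
    proof -
      have "x \<notin> ?I n" for n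
      proof
        assume "x \<in> ?I n" then have "real n * h < 0" using that by auto
        moreover have "0 \<le> real n * h" using h by simp
        ultimately show False by simp
      qed
      then have "(indicator (?I n) x :: ennreal) = 0" for n by (simp only: indicator_simps not_False_eq_True)
      then show ?thesis by simp
    qed
    have le: "f' x \<le> st x" and ge: "st' x \<le> f' x" for x
    proof -
      have "f' x \<le> st x \<and> st' x \<le> f' x"
      proof (cases "x < 0")
        case True
        then show ?thesis unfolding st_def st'_def neg[OF True] by (simp add: f'_def)
      next
        case False
        then have x: "0 \<le> x" by simp
        have "?L (nat \<lfloor>x / h\<rfloor>) \<le> ennreal (f x)" by (rule INF_lower[OF mem[OF x]])
        moreover have "ennreal (f x) \<le> ?S (nat \<lfloor>x / h\<rfloor>)" by (rule SUP_upper[OF mem[OF x]])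
        ultimately show ?thesis unfolding st_def st'_def single[OF x] S L using x by (simp add: f'_def)
      qed
      then show "f' x \<le> st x" "st' x \<le> f' x" by auto
    qed
    have I1: "(\<integral>\<^sup>+ x. f' x \<partial>lborel) \<le> ennreal ((\<Sum>n. A n) * h)"
      unfolding Y(5)[symmetric] by (intro nn_integral_mono le)
    have I2: "ennreal ((\<Sum>n. A' n) * h) \<le> (\<integral>\<^sup>+ x. f' x \<partial>lborel)"
      unfolding y(5)[symmetric] by (intro nn_integral_mono ge)
    have u0: "0 \<le> (\<Sum>n. A n) * h" "0 \<le> (\<Sum>n. A' n) * h"
      using h M0 Ms Ms' by (auto intro!: mult_nonneg_nonneg suminf_nonneg)
    have P1: "\<Phi> \<le> (\<Sum>n. A n) * h" unfolding \<Phi> using enn2real_mono[OF I1] u0 by simp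
    have P2: "(\<Sum>n. A' n) * h \<le> \<Phi>"
      using enn2real_mono[OF I2 le_less_trans[OF I1 ennreal_less_top]] u0 unfolding \<Phi> by simp
    have U: "upper_sum f h = ennreal ((\<Sum>n. A n) * h)"
    proof -
      have "(\<Sum>n. ennreal (A n)) = ennreal (\<Sum>n. A n)"
        by (rule suminf_ennreal_eq[OF M0(1) summable_sums[OF Ms]])
      then have "upper_sum f h = ennreal h * ennreal (\<Sum>n. A n)" unfolding upper_sum_def S by (simp only:)
      also have "\<dots> = ennreal (h * (\<Sum>n. A n))"
        by (rule ennreal_mult[symmetric]) (use h suminf_nonneg[OF Ms M0(1)] in simp_all)
      finally show ?thesis by (simp only: mult.commute)
    qed
    have Lo: "lower_sum f h = ennreal ((\<Sum>n. A' n) * h)"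
    proof -
      have "(\<Sum>n. ennreal (A' n)) = ennreal (\<Sum>n. A' n)"
        by (rule suminf_ennreal_eq[OF M0(2) summable_sums[OF Ms']])
      then have "lower_sum f h = ennreal h * ennreal (\<Sum>n. A' n)" unfolding lower_sum_def L by (simp only:)
      also have "\<dots> = ennreal (h * (\<Sum>n. A' n))"
        by (rule ennreal_mult[symmetric]) (use h suminf_nonneg[OF Ms' M0(2)] in simp_all)
      finally show ?thesis by (simp only: mult.commute)
    qed
    have yY: "conv \<nu> f' t \<le> ennreal (Y t)" "ennreal (y t) \<le> conv \<nu> f' t" for t
      unfolding Y(1)[symmetric] y(1)[symmetric] by (intro conv_mono le ge)+
    show ?thesis
      by (intro exI[of _ "(\<Sum>n. A n) * h"] exI[of _ "(\<Sum>n. A' n) * h"] exI[of _ Y] exI[of _ y] exI[of _ C] conjI allI)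
         (rule yY Y(2-4) y(2,4) P1 P2 U Lo u0)+
  qed
  show bd: "\<exists>C\<ge>0. \<forall>t. conv \<nu> f' t \<le> ennreal C"
  proof -
    obtain Y :: "real \<Rightarrow> real" and C where Y: "\<And>t. conv \<nu> f' t \<le> ennreal (Y t)" "\<And>t. 0 \<le> Y t" "\<And>t. Y t \<le> C"
      using main[OF zero_less_one] by metis
    then show ?thesis
      by (intro exI[of _ C]) (use order_trans[OF Y(2) Y(3)] in \<open>auto intro: order_trans[OF Y(1)] ennreal_leI\<close>)
  qed
  have fin: "conv \<nu> f' t < top" for t using bd by (auto intro: le_less_trans)
  have small: "\<exists>h>0. \<forall>u l. upper_sum f h = ennreal u \<longrightarrow> lower_sum f h = ennreal l \<longrightarrow> 0 \<le> l \<longrightarrow> l \<le> u \<longrightarrow> u - l < e" if e: "0 < e" for e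
  proof -
    have "((\<lambda>h. upper_sum f h - lower_sum f h) \<longlongrightarrow> 0) (at_right 0)"
      using dri unfolding directly_riemann_integrable_def by blast
    then have "eventually (\<lambda>h. upper_sum f h - lower_sum f h < ennreal e) (at_right 0)"
      by (rule order_tendstoD) (use e in simp)
    then obtain b where b: "0 < b" "\<And>h. 0 < h \<Longrightarrow> h < b \<Longrightarrow> upper_sum f h - lower_sum f h < ennreal e"
      by (auto simp: eventually_at_right_field)
    show ?thesis
      using b(1) b(2)[of "b / 2"] e by (intro exI[of _ "b / 2"]) (auto simp: ennreal_minus ennreal_less_iff)
  qed
  show "((\<lambda>t. enn2real (conv \<nu> f' t)) \<longlongrightarrow> 1 / m * (LINT y:{0..}|lborel. f y)) at_top"
    unfolding \<Phi>_def[symmetric]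
  proof (rule order_tendstoI)
    fix a assume "a < 1 / m * \<Phi>"
    then have a: "a * m < \<Phi>" using m_pos by (simp add: field_simps)
    obtain h where h: "0 < h" "\<And>u l. upper_sum f h = ennreal u \<Longrightarrow> lower_sum f h = ennreal l \<Longrightarrow> 0 \<le> l \<Longrightarrow> l \<le> u \<Longrightarrow> u - l < \<Phi> - a * m"
      using small[of "\<Phi> - a * m"] a by auto
    obtain u l y where y: "\<And>t. ennreal (y t) \<le> conv \<nu> f' t" "\<And>t. 0 \<le> y t" "(y \<longlongrightarrow> l / m) at_top"
      "l \<le> \<Phi>" "\<Phi> \<le> u" "upper_sum f h = ennreal u" "lower_sum f h = ennreal l" "0 \<le> l"
      using main[OF h(1)] by metis
    have "u - l < \<Phi> - a * m" using y by (intro h(2)) auto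
    then have "a < l / m" using y m_pos by (simp add: field_simps)
    from order_tendstoD(1)[OF y(3) this]
    show "eventually (\<lambda>t. a < enn2real (conv \<nu> f' t)) at_top"
    proof eventually_elim
      case (elim t)
      have "enn2real (ennreal (y t)) \<le> enn2real (conv \<nu> f' t)" by (rule enn2real_mono[OF y(1) fin])
      then show ?case using elim y(2)[of t] by simp
    qed
  next
    fix a assume "1 / m * \<Phi> < a"
    then have a: "\<Phi> < a * m" using m_pos by (simp add: field_simps)
    obtain h where h: "0 < h" "\<And>u l. upper_sum f h = ennreal u \<Longrightarrow> lower_sum f h = ennreal l \<Longrightarrow> 0 \<le> l \<Longrightarrow> l \<le> u \<Longrightarrow> u - l < a * m - \<Phi>"
      using small[of "a * m - \<Phi>"] a by auto
    obtain u l Y where y: "\<And>t. conv \<nu> f' t \<le> ennreal (Y t)" "\<And>t. 0 \<le> Y t" "(Y \<longlongrightarrow> u / m) at_top"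
      "l \<le> \<Phi>" "\<Phi> \<le> u" "upper_sum f h = ennreal u" "lower_sum f h = ennreal l" "0 \<le> l"
      using main[OF h(1)] by metis
    have "u - l < a * m - \<Phi>" using y by (intro h(2)) auto
    then have "u / m < a" using y m_pos by (simp add: field_simps)
    from order_tendstoD(2)[OF y(3) this]
    show "eventually (\<lambda>t. enn2real (conv \<nu> f' t) < a) at_top"
    proof eventually_elim
      case (elim t)
      have "enn2real (conv \<nu> f' t) \<le> enn2real (ennreal (Y t))" by (rule enn2real_mono[OF y(1)]) simp
      then show ?case using elim y(2)[of t] by simp
    qed
  qed
qed

end

section \<open>Asymptotics under bounds on truncated means\<close>

definition (in pos_law) trunc_mean :: "real \<Rightarrow> real" where
  "trunc_mean B = (LINT x|\<mu>. min x B)"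

lemma (in pos_law) nn_trunc_mean: "0 \<le> B \<Longrightarrow> (\<integral>\<^sup>+ x. ennreal (min x B) \<partial>\<mu>) = ennreal (trunc_mean B)"
  unfolding trunc_mean_def
proof (rule nn_integral_eq_integral)
  assume B: "0 \<le> B"
  show "integrable \<mu> (\<lambda>x. min x B)"
    by (rule integrable_const_bound[of _ B]) (use nonneg B in \<open>auto elim!: eventually_mono\<close>)
  show "AE x in \<mu>. 0 \<le> min x B" using nonneg B by (auto elim!: eventually_mono)
qed

lemma (in pos_law) trunc_mean_nonneg: "0 \<le> B \<Longrightarrow> 0 \<le> trunc_mean B"
  unfolding trunc_mean_def using nonneg by (intro integral_nonneg_AE) (auto elim!: eventually_mono)

lemma (in pos_law) trunc_mean_mono: "0 \<le> B \<Longrightarrow> B \<le> B' \<Longrightarrow> trunc_mean B \<le> trunc_mean B'"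
proof -
  assume B: "0 \<le> B" "B \<le> B'"
  have "ennreal (trunc_mean B) \<le> ennreal (trunc_mean B')"
    using B by (simp add: nn_trunc_mean[symmetric]) (intro nn_integral_mono ennreal_leI, auto)
  then show ?thesis using trunc_mean_nonneg[of B'] B by (simp add: ennreal_le_iff)
qed

text \<open>In terms of a sum \<open>Z\<close> of \<open>n\<close> independent variables: \<open>E min B Z \<le> n * E min B X\<close>.\<close>

lemma (in pos_law) conv_pow_trunc:
  assumes B: "0 \<le> B"
  shows "(conv \<mu> ^^ n) (\<lambda>u. ennreal (min B (max 0 (s - u)))) t
    \<le> ennreal (min B (max 0 (s - t)) + real n * trunc_mean B)"
proof (induction n arbitrary: t)
  case (Suc n)
  let ?p = "\<lambda>u. ennreal (min B (max 0 (s - u)))"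
  have tm: "0 \<le> trunc_mean B" by (rule trunc_mean_nonneg[OF B])
  have "(conv \<mu> ^^ Suc n) ?p t \<le> conv \<mu> (\<lambda>t. ?p t + ennreal (real n * trunc_mean B)) t"
    using B tm Suc by (auto intro!: conv_mono simp: ennreal_plus)
  also have "\<dots> = conv \<mu> ?p t + ennreal (real n * trunc_mean B)"
    by (subst conv_add) simp_all
  also have "conv \<mu> ?p t \<le> (\<integral>\<^sup>+ x. ?p t + ennreal (min x B) \<partial>\<mu>)"
    unfolding conv_def
  proof (rule nn_integral_mono_AE)
    show "AE x in \<mu>. ennreal (min B (max 0 (s - (t - x)))) \<le> ?p t + ennreal (min x B)"
      using nonneg
    proof eventually_elim
      case (elim x)
      have "min B (max 0 (s - (t - x))) \<le> min B (max 0 (s - t)) + min x B" using elim B by auto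
      then show ?case
        using elim B by (simp add: ennreal_plus[symmetric] ennreal_leI del: ennreal_plus)
    qed
  qed
  also have "\<dots> = ?p t + (\<integral>\<^sup>+ x. ennreal (min x B) \<partial>\<mu>)"
    by (subst nn_integral_add) (simp_all add: emeasure_space_1)
  also have "\<dots> = ?p t + ennreal (trunc_mean B)" using B by (simp add: nn_trunc_mean)
  finally show ?case using B tm
    by (simp add: ennreal_plus[symmetric] algebra_simps add_left_mono del: ennreal_plus)
qed (use B in simp)

context prw_finite_mean
begin

text \<open>The real-valued \<open>k\<close>-th convolution power of \<open>V\<close>. It also agrees with the indicator of the half-line for \<open>k = 0\<close>,
  and is the form in which \<open>V\<^sub>k\<close> enters all estimates.\<close>

definition v :: "nat \<Rightarrow> real \<Rightarrow> real" where
  "v k t = enn2real ((conv \<nu> ^^ k) H t)"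

lemma v_eq: "ennreal (v k t) = (conv \<nu> ^^ k) H t"
  using conv_\<nu>_pow_H_finite[of k t] by (simp add: v_def)

lemma v_nonneg: "0 \<le> v k t" by (simp add: v_def)

lemma v_mono: "s \<le> t \<Longrightarrow> v k s \<le> v k t"
  using conv_\<nu>_pow_H_mono[of s t k] by (simp add: v_eq[symmetric] v_nonneg)

lemma v_eq_Vj: "0 \<le> t \<Longrightarrow> Vj k t = v k t"
  using Vj_eq[of t k] Vj_nonneg[of k t] v_nonneg[of k t] by (simp add: v_eq[symmetric])

lemma v_meas [measurable]: "v k \<in> borel_measurable borel"
  unfolding v_def[abs_def] using \<nu>.conv_pow_measurable[OF H_meas] by measurable

lemma delay_identity_v: "(conv F0 ^^ k) (\<lambda>u. ennreal (v k u)) = (conv G ^^ k) (\<lambda>u. ennreal (P k u))"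
  unfolding v_eq using delay_identity[of k] by simp

lemma P_mono: "s \<le> t \<Longrightarrow> P k s \<le> P k t"
  using m_pos by (auto simp: P_def intro!: divide_right_mono power_mono)

lemma P_pos: "0 < t \<Longrightarrow> 0 < P k t"
  using m_pos by (simp add: P_def)

text \<open>For \<open>\<alpha>\<close> the mean shift per step, this is asymptotically \<open>P k (t + \<alpha> * k)\<close>.\<close>

definition profile :: "real \<Rightarrow> nat \<Rightarrow> real \<Rightarrow> real" where
  "profile \<alpha> k t = P k t * exp (\<alpha> * (real k)\<^sup>2 / t)"

lemma profile_pos: "0 < t \<Longrightarrow> 0 < profile \<alpha> k t" by (simp add: profile_def P_pos)

lemma v_0: "0 \<le> t \<Longrightarrow> v 0 t = 1"
  by (simp add: v_def indicator_def)

lemma P_0: "0 \<le> t \<Longrightarrow> P 0 t = 1"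
  by (simp add: P_def)

lemma P_exp_bound:
  assumes "0 < s"
  shows "P k x \<le> P k s * exp (real k * (x - s) / s)"
proof (cases "x < 0")
  case True
  then show ?thesis using P_nonneg[of k s] by (simp add: P_def[of k x])
next
  case False
  have "x / s \<le> exp ((x - s) / s)"
    using exp_ge_add_one_self[of "(x - s) / s"] assms by (simp add: diff_divide_distrib)
  then have "(x / s) ^ k \<le> exp ((x - s) / s) ^ k" using assms False by (intro power_mono) auto
  also have "\<dots> = exp (real k * (x - s) / s)" by (simp add: exp_of_nat_mult[symmetric])
  finally have "P k s * (x / s) ^ k \<le> P k s * exp (real k * (x - s) / s)"
    by (intro mult_left_mono P_nonneg)
  moreover have "P k s * (x / s) ^ k = P k x" using assms False by (simp add: P_def power_divide)
  ultimately show ?thesis by simp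
qed

text \<open>Bernoulli's inequality: \<open>P k\<close> lies above its tangents. On the negative half-line the tangent at a point \<open>c > 0\<close> is
  negative because \<open>k \<ge> 1\<close>.\<close>

lemma P_tangent:
  assumes c: "0 < c" and k: "1 \<le> k"
  shows "P k c * (1 + real k * ((x - c) / c)) \<le> P k x"
proof (cases "x < 0")
  case True
  have "1 \<le> real k" using k by simp
  then have "1 + real k * ((x - c) / c) \<le> 1 + real k * (- 1)"
    using True c by (intro add_left_mono mult_left_mono) (auto simp: field_simps)
  also have "\<dots> \<le> 0" using \<open>1 \<le> real k\<close> by simp
  finally have "P k c * (1 + real k * ((x - c) / c)) \<le> 0" using P_nonneg by (intro mult_nonneg_nonpos)
  then show ?thesis using P_nonneg[of k x] by linarith
next
  case False
  have "1 + real k * (x / c - 1) \<le> (x / c) ^ k"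
    using Bernoulli_inequality[of "x / c - 1" k] c False by simp
  moreover have "x / c - 1 = (x - c) / c" using c by (simp add: field_simps)
  ultimately have "1 + real k * ((x - c) / c) \<le> (x / c) ^ k" by (simp only:)
  then have "P k c * (1 + real k * ((x - c) / c)) \<le> P k c * (x / c) ^ k"
    by (intro mult_left_mono P_nonneg)
  also have "P k c * (x / c) ^ k = P k x" using c False by (simp add: P_def power_divide)
  finally show ?thesis .
qed

text \<open>By the delay identity \<open>v k s\<close> is at least the average of \<open>P k\<close> over \<open>s - W\<close>, and \<open>P k (s - W)\<close> loses at most the
  fraction \<open>k * min s W / s\<close> of \<open>P k s\<close>.\<close>

lemma v_lower_truncated_mean:
  assumes s: "0 < s" and k: "1 \<le> k"
  shows "P k s * (1 - (real k)\<^sup>2 * G.trunc_mean s / s) \<le> v k s"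
proof -
  have pw: "P k s \<le> P k x + P k s * (real k / s) * min s (max 0 (s - x))" for x
  proof -
    consider "s \<le> x" | "x < 0" | "0 \<le> x" "x < s" by linarith
    then show ?thesis
    proof cases
      case 1
      then have "P k s \<le> P k x" by (rule P_mono)
      moreover have "0 \<le> P k s * (real k / s) * min s (max 0 (s - x))" using s P_nonneg by simp
      ultimately show ?thesis by linarith
    next
      case 2
      then have "P k s * (real k / s) * min s (max 0 (s - x)) = P k s * real k" using s by simp
      moreover have "P k s * 1 \<le> P k s * real k" using k by (intro mult_left_mono P_nonneg) simp
      ultimately show ?thesis using P_nonneg[of k x] by simp
    next
      case 3
      have "P k s * (1 + real k * ((x - s) / s)) = P k s - P k s * (real k / s) * (s - x)"
        using s by (simp add: field_simps)
      moreover have "min s (max 0 (s - x)) = s - x" using 3 by auto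
      ultimately show ?thesis using P_tangent[OF s k, of x] by simp
    qed
  qed
  define c where "c = P k s * (real k / s)"
  have c0: "0 \<le> c" using s P_nonneg by (simp add: c_def)
  have tm: "0 \<le> G.trunc_mean s" using s by (intro G.trunc_mean_nonneg) simp
  have "(conv G ^^ k) (\<lambda>_. ennreal (P k s)) s \<le> ennreal (v k s + c * (real k * G.trunc_mean s))"
  proof (rule G.conv_pow_affine_bound)
    show "P k s \<le> P k x + c * min s (max 0 (s - x))" for x using pw[of x] by (simp add: c_def)
    show "(conv G ^^ k) (\<lambda>x. ennreal (P k x)) s \<le> ennreal (v k s)"
      unfolding delay_identity_v[symmetric]
      by (rule F0.conv_pow_le_mono) (auto intro!: ennreal_leI v_mono)
    show "(conv G ^^ k) (\<lambda>x. ennreal (min s (max 0 (s - x)))) s \<le> ennreal (real k * G.trunc_mean s)"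
      using G.conv_pow_trunc[of s k s s] s by simp
  qed (use s c0 tm P_nonneg v_nonneg in auto)
  then have "P k s \<le> v k s + c * (real k * G.trunc_mean s)"
    unfolding G.conv_pow_const using c0 tm v_nonneg[of k s] by (subst (asm) ennreal_le_iff) auto
  then show ?thesis using s by (simp add: c_def field_simps power2_eq_square)
qed

text \<open>Evaluate the delay identity at \<open>t + B\<close> with \<open>B = \<delta> * t / k\<close>. Where \<open>Z \<le> B\<close> the value of \<open>v k\<close> is at least
  \<open>v k t\<close>, Markov's inequality bounds the probability of \<open>Z > B\<close>, and the shift by \<open>B\<close> costs only a factor \<open>exp \<delta>\<close>.\<close>

lemma v_upper_truncated_mean:
  assumes t: "0 < t" and k: "1 \<le> k" and d: "0 < \<delta>" "\<delta> \<le> 1"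
  shows "v k t * (1 - (real k)\<^sup>2 * F0.trunc_mean t / (\<delta> * t)) \<le> P k t * exp \<delta>"
proof -
  define B where "B = \<delta> * t / real k"
  have B: "0 < B" using t k d by (simp add: B_def)
  have "\<delta> * t \<le> 1 * (t * real k)" using t d k by (intro mult_mono) (auto simp: mult_le_cancel_left1)
  then have Bt: "B \<le> t" using k by (simp add: B_def field_simps)
  define c where "c = v k t / B"
  have c0: "0 \<le> c" using B v_nonneg by (simp add: c_def)
  have tm: "0 \<le> F0.trunc_mean B" using B by (intro F0.trunc_mean_nonneg) simp
  have pw: "v k t \<le> v k u + c * min B (max 0 (t + B - u))" for u
  proof (cases "t \<le> u")
    case True
    have "0 \<le> c * min B (max 0 (t + B - u))" using c0 B by (intro mult_nonneg_nonneg) auto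
    then show ?thesis using v_mono[OF True, of k] by linarith
  next
    case False
    then have "min B (max 0 (t + B - u)) = B" using B by simp
    then show ?thesis using B v_nonneg[of k u] by (simp add: c_def)
  qed
  have "(conv F0 ^^ k) (\<lambda>_. ennreal (v k t)) (t + B) \<le> ennreal (P k (t + B) + c * (real k * F0.trunc_mean B))"
  proof (rule F0.conv_pow_affine_bound[OF _ _ pw])
    show "(conv F0 ^^ k) (\<lambda>u. ennreal (v k u)) (t + B) \<le> ennreal (P k (t + B))"
      unfolding delay_identity_v by (rule G.conv_pow_le_mono) (auto intro!: ennreal_leI P_mono)
    show "(conv F0 ^^ k) (\<lambda>u. ennreal (min B (max 0 (t + B - u)))) (t + B) \<le> ennreal (real k * F0.trunc_mean B)"
      using F0.conv_pow_trunc[of B k "t + B" "t + B"] B by simp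
  qed (use B c0 tm P_nonneg v_nonneg in auto)
  then have "v k t \<le> P k (t + B) + c * (real k * F0.trunc_mean B)"
    unfolding F0.conv_pow_const using c0 tm P_nonneg[of k "t + B"] by (subst (asm) ennreal_le_iff) auto
  also have "P k (t + B) \<le> P k t * exp \<delta>"
  proof -
    have "real k * (t + B - t) / t = \<delta>" using t k by (simp add: B_def)
    then show ?thesis using P_exp_bound[OF t, of k "t + B"] by simp
  qed
  also have "c * (real k * F0.trunc_mean B) \<le> c * (real k * F0.trunc_mean t)"
    using c0 B Bt by (intro mult_left_mono F0.trunc_mean_mono) auto
  also have "c * (real k * F0.trunc_mean t) = v k t * ((real k)\<^sup>2 * F0.trunc_mean t / (\<delta> * t))"
    using k t d by (simp add: B_def c_def power2_eq_square)
  finally show ?thesis by (simp add: algebra_simps)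
qed

lemma v_asymp_truncated_mean:
  fixes k :: "real \<Rightarrow> nat"
  assumes X: "((\<lambda>t. (real (k t))\<^sup>2 * F0.trunc_mean t / t) \<longlongrightarrow> 0) at_top"
    and Y: "((\<lambda>t. (real (k t))\<^sup>2 * G.trunc_mean t / t) \<longlongrightarrow> 0) at_top"
  shows "((\<lambda>t. v (k t) t / P (k t) t) \<longlongrightarrow> 1) at_top"
proof (rule order_tendstoI)
  fix a :: real assume a: "a < 1"
  have "eventually (\<lambda>t. (real (k t))\<^sup>2 * G.trunc_mean t / t < 1 - a) at_top"
    by (rule order_tendstoD(2)[OF Y]) (use a in simp)
  then show "eventually (\<lambda>t. a < v (k t) t / P (k t) t) at_top"
    using eventually_gt_at_top[of 0]
  proof eventually_elim
    case (elim t)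
    have Pp: "0 < P (k t) t" by (rule P_pos) fact
    show ?case
    proof (cases "k t = 0")
      case True
      then show ?thesis using a elim by (simp add: v_0 P_0)
    next
      case False
      have "a * P (k t) t < P (k t) t * (1 - (real (k t))\<^sup>2 * G.trunc_mean t / t)"
        using elim Pp by (subst mult.commute) (intro mult_strict_left_mono, auto)
      also have "\<dots> \<le> v (k t) t" using elim False by (intro v_lower_truncated_mean) auto
      finally show ?thesis using Pp by (simp add: field_simps)
    qed
  qed
next
  fix a :: real assume a: "1 < a"
  obtain \<delta> :: real where d: "exp \<delta> < a" "\<delta> < 1" "0 < \<delta>"
    by (rule small_argument[of exp a 1]) (use a in auto)
  have pos: "0 < \<delta> * (1 - exp \<delta> / a)" using d a by simp
  have "eventually (\<lambda>t. (real (k t))\<^sup>2 * F0.trunc_mean t / t < \<delta> * (1 - exp \<delta> / a)) at_top"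
    by (rule order_tendstoD(2)[OF X pos])
  then show "eventually (\<lambda>t. v (k t) t / P (k t) t < a) at_top"
    using eventually_gt_at_top[of 0]
  proof eventually_elim
    case (elim t)
    have Pp: "0 < P (k t) t" by (rule P_pos) fact
    show ?case
    proof (cases "k t = 0")
      case True
      then show ?thesis using a elim by (simp add: v_0 P_0)
    next
      case False
      let ?q = "(real (k t))\<^sup>2 * F0.trunc_mean t / (\<delta> * t)"
      have "?q = (real (k t))\<^sup>2 * F0.trunc_mean t / t / \<delta>" by simp
      also have "\<dots> < 1 - exp \<delta> / a" using elim d by (simp add: field_simps)
      finally have q: "exp \<delta> < a * (1 - ?q)" using a by (simp add: field_simps)
      have "v (k t) t * (1 - ?q) \<le> P (k t) t * exp \<delta>" using elim False d by (intro v_upper_truncated_mean) auto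
      also have "\<dots> < P (k t) t * (a * (1 - ?q))" using q Pp by (intro mult_strict_left_mono)
      finally have "v (k t) t * (1 - ?q) < (P (k t) t * a) * (1 - ?q)" by (simp add: mult.assoc)
      moreover have "0 < 1 - ?q"
      proof -
        have "0 < a * (1 - ?q)" using q exp_gt_zero[of \<delta>] by linarith
        then show ?thesis using a by (simp add: zero_less_mult_iff)
      qed
      ultimately have "v (k t) t < P (k t) t * a" by (rule mult_right_less_imp_less[OF _ less_imp_le])
      then show ?thesis using Pp by (simp add: field_simps)
    qed
  qed
qed

end

section \<open>Asymptotics under second moments\<close>

lemma exp_minus_le_quadratic:
  fixes y :: real assumes "0 \<le> y"
  shows "exp (- y) \<le> 1 - y + y\<^sup>2 / 2"
proof -
  define f where "f z = (1 - z + z\<^sup>2 / 2) * exp z" for z :: real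
  have "f 0 \<le> f y"
  proof (rule DERIV_nonneg_imp_nondecreasing[OF assms])
    fix z :: real
    have "(f has_real_derivative (z\<^sup>2 / 2) * exp z) (at z)"
      unfolding f_def[abs_def] by (auto intro!: derivative_eq_intros simp: algebra_simps power2_eq_square)
    then show "\<exists>d. (f has_real_derivative d) (at z) \<and> 0 \<le> d"
      by (intro exI[of _ "(z\<^sup>2 / 2) * exp z"]) simp
  qed
  then have "1 \<le> (1 - y + y\<^sup>2 / 2) * exp y" by (simp add: f_def)
  then have "1 * exp (- y) \<le> ((1 - y + y\<^sup>2 / 2) * exp y) * exp (- y)" by (intro mult_right_mono) auto
  then show ?thesis by (simp add: mult.assoc exp_add[symmetric])
qed

locale square_integrable_law = pos_law +
  assumes int_sq: "integrable \<mu> (\<lambda>x. x\<^sup>2)"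
begin

lemma int_id: "integrable \<mu> (\<lambda>x. x)"
proof (rule Bochner_Integration.integrable_bound[of _ "\<lambda>x. 1 + x\<^sup>2"])
  show "AE x in \<mu>. norm x \<le> norm (1 + x\<^sup>2)"
  proof (rule AE_I2)
    fix x :: real
    have "0 \<le> (\<bar>x\<bar> - 1)\<^sup>2" by simp
    then have "2 * \<bar>x\<bar> \<le> 1 + x\<^sup>2" by (simp add: power2_diff)
    then show "norm x \<le> norm (1 + x\<^sup>2)" by simp
  qed
qed (use int_sq in auto)

definition mean :: real where "mean = (LINT x|\<mu>. x)"
definition sq_mean :: real where "sq_mean = (LINT x|\<mu>. x\<^sup>2)"

lemma mean_nonneg: "0 \<le> mean" unfolding mean_def using nonneg by (rule integral_nonneg_AE)
lemma sq_mean_nonneg: "0 \<le> sq_mean" unfolding sq_mean_def by (rule integral_nonneg_AE) simp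

lemma measure_UNIV [simp]: "measure \<mu> UNIV = 1"
  using prob_space sets_eq_imp_space_eq[OF sets_pos] by simp

text \<open>A sub-Gaussian bound for the lower tail of a nonnegative variable, from \<open>exp (- y) \<le> 1 - y + y\<^sup>2 / 2\<close> for \<open>y \<ge> 0\<close>.\<close>

lemma exp_mom_le:
  assumes "0 \<le> \<theta>"
  shows "exp_mom \<mu> \<theta> \<le> ennreal (exp (- \<theta> * mean + \<theta>\<^sup>2 * sq_mean / 2))"
proof -
  let ?q = "\<lambda>x. 1 - \<theta> * x + \<theta>\<^sup>2 * x\<^sup>2 / 2"
  have qi: "integrable \<mu> ?q" using int_id int_sq by auto
  have le: "exp (- \<theta> * x) \<le> ?q x" if "0 \<le> x" for x
    using exp_minus_le_quadratic[of "\<theta> * x"] assms that by (simp add: power_mult_distrib)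
  have q0: "AE x in \<mu>. 0 \<le> ?q x"
    using nonneg by eventually_elim (rule order_trans[OF _ le], auto)
  have "exp_mom \<mu> \<theta> \<le> (\<integral>\<^sup>+ x. ennreal (?q x) \<partial>\<mu>)"
    unfolding exp_mom_def using nonneg by (intro nn_integral_mono_AE) (auto elim!: eventually_mono intro!: ennreal_leI le[simplified])
  also have "\<dots> = ennreal (LINT x|\<mu>. ?q x)" by (rule nn_integral_eq_integral[OF qi q0])
  also have "(LINT x|\<mu>. ?q x) = 1 + (- \<theta> * mean + \<theta>\<^sup>2 * sq_mean / 2)"
    using int_id int_sq by (simp add: mean_def sq_mean_def prob_space)
  also have "\<dots> \<le> exp (- \<theta> * mean + \<theta>\<^sup>2 * sq_mean / 2)" by (rule exp_ge_add_one_self)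
  finally show ?thesis by (simp add: ennreal_leI)
qed

lemma exp_mom_pow_le:
  assumes "0 \<le> \<theta>"
  shows "exp_mom \<mu> \<theta> ^ k \<le> ennreal (exp (real k * (- \<theta> * mean + \<theta>\<^sup>2 * sq_mean / 2)))"
proof -
  have "exp_mom \<mu> \<theta> ^ k \<le> ennreal (exp (- \<theta> * mean + \<theta>\<^sup>2 * sq_mean / 2)) ^ k"
    by (rule power_mono[OF exp_mom_le[OF assms]]) simp
  then show ?thesis by (simp add: ennreal_power exp_of_nat_mult[symmetric])
qed

text \<open>The second moment of a sum of \<open>n\<close> independent variables about a point, with the variance of the terms
  bounded by their second moment.\<close>

lemma conv_pow_square_le:
  "(conv \<mu> ^^ n) (\<lambda>u. ennreal ((u - c)\<^sup>2)) t \<le> ennreal ((t - real n * mean - c)\<^sup>2 + real n * sq_mean)"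
proof (induction n arbitrary: t)
  case (Suc n)
  let ?d = "real n * mean + c"
  have "(conv \<mu> ^^ Suc n) (\<lambda>u. ennreal ((u - c)\<^sup>2)) t \<le> conv \<mu> (\<lambda>u. ennreal ((u - real n * mean - c)\<^sup>2 + real n * sq_mean)) t"
    using Suc by (auto intro!: conv_mono)
  also have "\<dots> = (\<integral>\<^sup>+ x. ennreal ((t - ?d)\<^sup>2 - 2 * (t - ?d) * x + x\<^sup>2 + real n * sq_mean) \<partial>\<mu>)"
    unfolding conv_def by (intro nn_integral_cong arg_cong[of _ _ ennreal]) (simp add: power2_eq_square algebra_simps)
  also have "\<dots> = ennreal (LINT x|\<mu>. (t - ?d)\<^sup>2 - 2 * (t - ?d) * x + x\<^sup>2 + real n * sq_mean)"
  proof (rule nn_integral_eq_integral)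
    show "integrable \<mu> (\<lambda>x. (t - ?d)\<^sup>2 - 2 * (t - ?d) * x + x\<^sup>2 + real n * sq_mean)"
      using int_id int_sq by auto
    show "AE x in \<mu>. 0 \<le> (t - ?d)\<^sup>2 - 2 * (t - ?d) * x + x\<^sup>2 + real n * sq_mean"
    proof (rule AE_I2)
      fix x
      have "(t - ?d)\<^sup>2 - 2 * (t - ?d) * x + x\<^sup>2 = (t - ?d - x)\<^sup>2" by (simp add: power2_eq_square algebra_simps)
      then show "0 \<le> (t - ?d)\<^sup>2 - 2 * (t - ?d) * x + x\<^sup>2 + real n * sq_mean" using sq_mean_nonneg by simp
    qed
  qed
  also have "(LINT x|\<mu>. (t - ?d)\<^sup>2 - 2 * (t - ?d) * x + x\<^sup>2 + real n * sq_mean)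
      = (t - ?d)\<^sup>2 - 2 * (t - ?d) * mean + sq_mean + real n * sq_mean"
    using int_id int_sq by (simp add: mean_def sq_mean_def prob_space)
  also have "\<dots> \<le> (t - real (Suc n) * mean - c)\<^sup>2 + real (Suc n) * sq_mean"
    by (simp add: power2_eq_square algebra_simps)
  finally show ?case by (simp add: ennreal_leI)
qed simp

end

locale prw_second_moment = prw_finite_mean +
  assumes F0_sq: "integrable F0 (\<lambda>x. x\<^sup>2)" and G_sq: "integrable G (\<lambda>x. x\<^sup>2)"
begin

sublocale F0: square_integrable_law F0 by unfold_locales (rule F0_sq)
sublocale G: square_integrable_law G by unfold_locales (rule G_sq)

text \<open>Jensen's inequality for the convex function \<open>P k\<close>, by its tangent at \<open>t\<close> minus the mean.\<close>

lemma P_jensen: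
  assumes k: "1 \<le> k"
  shows "ennreal (P k (t - G.mean)) \<le> conv G (\<lambda>u. ennreal (P k u)) t"
proof (cases "0 < t - G.mean")
  case False
  then have "P k (t - G.mean) = 0" using k by (auto simp: P_def not_less)
  then show ?thesis by simp
next
  case True
  let ?c = "t - G.mean"
  have i1: "integrable G (\<lambda>y. P k (t - y))"
    by (rule G.integrable_const_bound[of _ "P k t"])
       (use G.nonneg P_nonneg P_mono in \<open>auto elim!: eventually_mono\<close>)
  have i2: "integrable G (\<lambda>y. P k ?c * (1 + real k * ((t - y - ?c) / ?c)))"
    using G.int_id by (auto simp: diff_divide_distrib)
  have "P k ?c = (LINT y|G. P k ?c * (1 + real k * ((t - y - ?c) / ?c)))"
  proof -
    have "(LINT y|G. P k ?c * (1 + real k * ((t - y - ?c) / ?c))) = P k ?c * (1 + real k * ((t - G.mean - ?c) / ?c))"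
      using G.int_id G.measure_UNIV by (simp add: G.mean_def diff_divide_distrib)
    then show ?thesis by simp
  qed
  also have "\<dots> \<le> (LINT y|G. P k (t - y))"
    by (rule integral_mono[OF i2 i1]) (rule P_tangent[OF True k])
  finally have "ennreal (P k ?c) \<le> ennreal (LINT y|G. P k (t - y))" by (rule ennreal_leI)
  also have "\<dots> = conv G (\<lambda>u. ennreal (P k u)) t"
    unfolding conv_def by (intro nn_integral_eq_integral[symmetric] i1) (simp add: P_nonneg)
  finally show ?thesis .
qed

lemma P_jensen_pow:
  assumes k: "1 \<le> k"
  shows "ennreal (P k (t - real n * G.mean)) \<le> (conv G ^^ n) (\<lambda>u. ennreal (P k u)) t"
proof (induction n arbitrary: t)
  case (Suc n)
  have "ennreal (P k (t - real (Suc n) * G.mean)) \<le> conv G (\<lambda>u. ennreal (P k u)) (t - real n * G.mean)"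
    using P_jensen[OF k, of "t - real n * G.mean"] by (simp add: algebra_simps)
  also have "\<dots> = conv G (\<lambda>u. ennreal (P k (u - real n * G.mean))) t"
    unfolding conv_def by (simp add: algebra_simps)
  also have "\<dots> \<le> (conv G ^^ Suc n) (\<lambda>u. ennreal (P k u)) t"
    using Suc by (auto intro!: conv_mono)
  finally show ?case .
qed simp

text \<open>\<open>P k\<close> is dominated by the exponential function that touches it at \<open>s\<close>, and exponential functions are eigenfunctions.\<close>

lemma G_pow_P_upper:
  assumes s: "0 < s"
  shows "(conv G ^^ k) (\<lambda>u. ennreal (P k u)) s
    \<le> ennreal (P k s * exp (- (real k)\<^sup>2 * G.mean / s + (real k) ^ 3 * G.sq_mean / (2 * s\<^sup>2)))"
proof -
  define \<theta> where "\<theta> = real k / s"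
  have th: "0 \<le> \<theta>" using s by (simp add: \<theta>_def)
  have "(conv G ^^ k) (\<lambda>u. ennreal (P k u)) s
      \<le> (conv G ^^ k) (\<lambda>u. ennreal (P k s * exp (- real k)) * ennreal (exp (\<theta> * u))) s"
  proof (rule conv_pow_mono)
    fix u
    have "P k u \<le> P k s * exp (real k * (u - s) / s)" by (rule P_exp_bound[OF s])
    also have "real k * (u - s) / s = - real k + \<theta> * u" using s by (simp add: \<theta>_def field_simps)
    finally have "P k u \<le> P k s * exp (- real k) * exp (\<theta> * u)" by (simp only: exp_add mult.assoc)
    then show "ennreal (P k u) \<le> ennreal (P k s * exp (- real k)) * ennreal (exp (\<theta> * u))"
      using P_nonneg by (simp add: ennreal_mult'[symmetric] ennreal_leI)
  qed
  also have "\<dots> = ennreal (P k s * exp (- real k)) * (ennreal (exp (\<theta> * s)) * exp_mom G \<theta> ^ k)"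
    by (simp add: G.conv_pow_cmult G.conv_pow_exp)
  also have "\<dots> \<le> ennreal (P k s * exp (- real k)) * (ennreal (exp (\<theta> * s)) * ennreal (exp (real k * (- \<theta> * G.mean + \<theta>\<^sup>2 * G.sq_mean / 2))))"
    by (intro mult_left_mono G.exp_mom_pow_le th) auto
  also have "\<dots> = ennreal (P k s * (exp (- real k) * (exp (\<theta> * s) * exp (real k * (- \<theta> * G.mean + \<theta>\<^sup>2 * G.sq_mean / 2)))))"
    using P_nonneg by (simp add: ennreal_mult'[symmetric] mult.assoc)
  also have "exp (- real k) * (exp (\<theta> * s) * exp (real k * (- \<theta> * G.mean + \<theta>\<^sup>2 * G.sq_mean / 2)))
     = exp (- (real k)\<^sup>2 * G.mean / s + (real k) ^ 3 * G.sq_mean / (2 * s\<^sup>2))"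
  proof -
    have "\<theta> * s = real k" using s by (simp add: \<theta>_def)
    moreover have "real k * (- \<theta> * G.mean + \<theta>\<^sup>2 * G.sq_mean / 2) = - (real k)\<^sup>2 * G.mean / s + (real k) ^ 3 * G.sq_mean / (2 * s\<^sup>2)"
      by (simp add: \<theta>_def power2_eq_square power3_eq_cube algebra_simps)
    ultimately show ?thesis by (simp add: exp_add[symmetric])
  qed
  finally show ?thesis .
qed

text \<open>By the first moments of \<open>F0\<close> and \<open>G\<close> this is the constant \<open>\<gamma>\<^sub>0 * m\<close> of the theorem.\<close>

definition shift :: real where "shift = F0.mean - G.mean"

abbreviation "D \<equiv> profile shift"

text \<open>Evaluate the delay identity at \<open>s = t + k * E X + B\<close>, where \<open>X\<close> has law \<open>F0\<close> and \<open>B = \<epsilon> * t / k\<close>. By Chebyshev's inequality \<open>Z\<close> exceeds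
  its mean by more than \<open>B\<close> only with a probability of order \<open>k / B\<^sup>2\<close>, that is \<open>k ^ 3 / t\<^sup>2\<close>; otherwise \<open>v k\<close> is evaluated beyond \<open>t\<close>.
  What remains is to compare the resulting exponent at \<open>s\<close> with the one at \<open>t\<close>.\<close>

lemma v_upper_second_moment:
  assumes t: "0 < t" and k: "1 \<le> k" "real k \<le> t" and e: "0 < \<epsilon>"
  shows "v k t * (1 - (real k ^ 3 / t\<^sup>2) * F0.sq_mean / \<epsilon>\<^sup>2)
    \<le> D k t * exp (\<epsilon> * (1 + G.mean) + (real k ^ 3 / t\<^sup>2) * (G.mean * F0.mean + G.sq_mean / 2))"
proof -
  define B where "B = \<epsilon> * t / real k"
  define s where "s = t + real k * F0.mean + B"
  have B: "0 < B" using t k e by (simp add: B_def)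
  have m1: "0 \<le> F0.mean" "0 \<le> G.mean" "0 \<le> G.sq_mean" "0 \<le> F0.sq_mean"
    by (rule F0.mean_nonneg G.mean_nonneg G.sq_mean_nonneg F0.sq_mean_nonneg)+
  have st: "t \<le> s" "0 < s" using B t m1 k by (auto simp: s_def add_pos_nonneg add_nonneg_pos intro!: add_increasing2)
  define c where "c = v k t / B\<^sup>2"
  have c0: "0 \<le> c" using v_nonneg by (simp add: c_def)
  have pw: "v k t \<le> v k u + c * (u - (t + B))\<^sup>2" for u
  proof (cases "t \<le> u")
    case True
    have "0 \<le> c * (u - (t + B))\<^sup>2" using c0 by simp
    then show ?thesis using v_mono[OF True, of k] by linarith
  next
    case False
    then have "B\<^sup>2 \<le> (u - (t + B))\<^sup>2" using B by (subst power2_commute) (intro power_mono, auto)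
    then have "c * B\<^sup>2 \<le> c * (u - (t + B))\<^sup>2" using c0 by (rule mult_left_mono)
    moreover have "c * B\<^sup>2 = v k t" using B by (simp add: c_def)
    ultimately show ?thesis using v_nonneg[of k u] by linarith
  qed
  have "(conv F0 ^^ k) (\<lambda>_. ennreal (v k t)) s
    \<le> ennreal (P k s * exp (- (real k)\<^sup>2 * G.mean / s + (real k) ^ 3 * G.sq_mean / (2 * s\<^sup>2)) + c * (real k * F0.sq_mean))"
  proof (rule F0.conv_pow_affine_bound[OF _ _ pw])
    show "(conv F0 ^^ k) (\<lambda>u. ennreal (v k u)) s
      \<le> ennreal (P k s * exp (- (real k)\<^sup>2 * G.mean / s + (real k) ^ 3 * G.sq_mean / (2 * s\<^sup>2)))"
      unfolding delay_identity_v by (rule G_pow_P_upper[OF st(2)])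
    show "(conv F0 ^^ k) (\<lambda>u. ennreal ((u - (t + B))\<^sup>2)) s \<le> ennreal (real k * F0.sq_mean)"
      using F0.conv_pow_square_le[of k "t + B" s] by (simp add: s_def)
  qed (use c0 m1 P_nonneg v_nonneg in auto)
  then have "v k t \<le> P k s * exp (- (real k)\<^sup>2 * G.mean / s + (real k) ^ 3 * G.sq_mean / (2 * s\<^sup>2)) + c * (real k * F0.sq_mean)"
    unfolding F0.conv_pow_const using c0 m1 P_nonneg[of k s] by (subst (asm) ennreal_le_iff) auto
  moreover have "c * (real k * F0.sq_mean) = v k t * ((real k ^ 3 / t\<^sup>2) * F0.sq_mean / \<epsilon>\<^sup>2)"
    using k t e by (simp add: c_def B_def power_divide power_mult_distrib power2_eq_square power3_eq_cube mult_ac)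
  ultimately have 1: "v k t * (1 - (real k ^ 3 / t\<^sup>2) * F0.sq_mean / \<epsilon>\<^sup>2)
      \<le> P k s * exp (- (real k)\<^sup>2 * G.mean / s + (real k) ^ 3 * G.sq_mean / (2 * s\<^sup>2))"
    by (simp add: right_diff_distrib)
  also have "\<dots> \<le> P k t * exp (real k * (s - t) / t) * exp (- (real k)\<^sup>2 * G.mean / s + (real k) ^ 3 * G.sq_mean / (2 * s\<^sup>2))"
    by (intro mult_right_mono P_exp_bound t) simp
  also have "\<dots> = P k t * exp (real k * (s - t) / t + (- (real k)\<^sup>2 * G.mean / s + (real k) ^ 3 * G.sq_mean / (2 * s\<^sup>2)))"
    by (simp add: exp_add)
  also have "\<dots> \<le> P k t * exp (shift * (real k)\<^sup>2 / t + (\<epsilon> * (1 + G.mean) + (real k ^ 3 / t\<^sup>2) * (G.mean * F0.mean + G.sq_mean / 2)))"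
  proof (intro mult_left_mono P_nonneg, subst exp_le_cancel_iff)
    have e1: "real k * (s - t) / t = F0.mean * (real k)\<^sup>2 / t + \<epsilon>"
      using t k by (simp add: s_def B_def field_simps power2_eq_square)
    have "1 / t - 1 / s = (s - t) / (t * s)" using t st by (simp add: field_simps)
    also have "\<dots> \<le> (s - t) / (t * t)" using t st by (intro divide_left_mono mult_left_mono) auto
    finally have "(real k)\<^sup>2 * G.mean * (1 / t - 1 / s) \<le> (real k)\<^sup>2 * G.mean * ((s - t) / (t * t))"
      using m1 by (intro mult_left_mono) auto
    also have "\<dots> = (real k ^ 3 / t\<^sup>2) * (G.mean * F0.mean) + \<epsilon> * G.mean * (real k / t)"
      using t k by (simp add: s_def B_def field_simps power2_eq_square power3_eq_cube)
    also have "\<epsilon> * G.mean * (real k / t) \<le> \<epsilon> * G.mean * 1"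
      using t k m1 e by (intro mult_left_mono) auto
    finally have e2: "- (real k)\<^sup>2 * G.mean / s \<le> - (real k)\<^sup>2 * G.mean / t + (real k ^ 3 / t\<^sup>2) * (G.mean * F0.mean) + \<epsilon> * G.mean"
      by (simp add: right_diff_distrib)
    have "t\<^sup>2 \<le> s\<^sup>2" using st t by (intro power_mono) auto
    then have "(real k) ^ 3 * G.sq_mean / (2 * s\<^sup>2) \<le> (real k) ^ 3 * G.sq_mean / (2 * t\<^sup>2)"
      using t m1 st by (intro divide_left_mono) auto
    then have e3: "(real k) ^ 3 * G.sq_mean / (2 * s\<^sup>2) \<le> (real k ^ 3 / t\<^sup>2) * (G.sq_mean / 2)" by simp
    have e4: "shift * (real k)\<^sup>2 / t = F0.mean * (real k)\<^sup>2 / t + - (real k)\<^sup>2 * G.mean / t"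
      by (simp add: shift_def left_diff_distrib diff_divide_distrib mult.commute right_diff_distrib)
    show "real k * (s - t) / t + (- (real k)\<^sup>2 * G.mean / s + (real k) ^ 3 * G.sq_mean / (2 * s\<^sup>2))
      \<le> shift * (real k)\<^sup>2 / t + (\<epsilon> * (1 + G.mean) + (real k ^ 3 / t\<^sup>2) * (G.mean * F0.mean + G.sq_mean / 2))"
      using e1 e2 e3 e4 by (simp only: distrib_left mult_1_right)
  qed
  finally show ?thesis by (simp only: profile_def exp_add mult.assoc)
qed

lemma ratio_square_le:
  assumes t: "0 < t" and k: "1 \<le> k" and x: "real k ^ 3 / t\<^sup>2 \<le> \<delta>"
  shows "(real k / t)\<^sup>2 \<le> \<delta>"
proof -
  have "(real k)\<^sup>2 \<le> real k ^ 3" using k by (intro power_increasing) auto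
  then have "(real k)\<^sup>2 / t\<^sup>2 \<le> real k ^ 3 / t\<^sup>2" by (intro divide_right_mono) auto
  then show ?thesis using x by (simp add: power_divide)
qed

text \<open>A crude consequence of the upper bound. It holds for all \<open>t\<close>, not only asymptotically, as the proof of the lower bound
  evaluates \<open>v k\<close> at random arguments.\<close>

lemma v_le_const_profile:
  "\<exists>K \<delta>. 0 < K \<and> 0 < \<delta> \<and> \<delta> \<le> 1 \<and> (\<forall>k t. 1 \<le> k \<longrightarrow> 0 < t \<longrightarrow> real k ^ 3 / t\<^sup>2 \<le> \<delta> \<longrightarrow> v k t \<le> K * D k t)"
proof -
  define \<delta> where "\<delta> = min 1 (1 / (2 * (F0.sq_mean + 1)))"
  define L where "L = G.mean * F0.mean + G.sq_mean / 2"
  have m1: "0 \<le> F0.mean" "0 \<le> G.mean" "0 \<le> G.sq_mean" "0 \<le> F0.sq_mean"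
    by (rule F0.mean_nonneg G.mean_nonneg G.sq_mean_nonneg F0.sq_mean_nonneg)+
  have L: "0 \<le> L" using m1 by (simp add: L_def)
  have d: "0 < \<delta>" "\<delta> \<le> 1" using m1 by (auto simp: \<delta>_def)
  have "v k t \<le> (2 * exp (1 + G.mean + L)) * D k t" if k: "1 \<le> k" and t: "0 < t" and x: "real k ^ 3 / t\<^sup>2 \<le> \<delta>" for k t
  proof -
    let ?x = "real k ^ 3 / t\<^sup>2"
    have "(real k / t)\<^sup>2 \<le> 1" using ratio_square_le[OF t k x] d by simp
    then have kt: "real k \<le> t" using t by (simp add: power_le_one_iff abs_square_le_1 divide_le_eq)
    have x0: "0 \<le> ?x" by simp
    have "?x * F0.sq_mean \<le> 1 / (2 * (F0.sq_mean + 1)) * F0.sq_mean"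
      using x m1 by (intro mult_right_mono) (auto simp: \<delta>_def)
    also have "\<dots> \<le> 1 / 2" using m1 by (simp add: field_simps)
    finally have "v k t * (1 / 2) \<le> v k t * (1 - ?x * F0.sq_mean / 1\<^sup>2)"
      by (intro mult_left_mono v_nonneg) simp
    also have "\<dots> \<le> D k t * exp (1 * (1 + G.mean) + ?x * L)"
      unfolding L_def by (rule v_upper_second_moment[OF t k kt]) simp
    also have "\<dots> \<le> D k t * exp (1 + G.mean + L)"
    proof (intro mult_left_mono, subst exp_le_cancel_iff)
      have "?x * L \<le> 1 * L" using x d L by (intro mult_right_mono) auto
      then show "1 * (1 + G.mean) + ?x * L \<le> 1 + G.mean + L" by simp
      show "0 \<le> D k t" using profile_pos[OF t, of shift k] by simp
    qed
    finally show ?thesis by (simp add: mult_ac)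
  qed
  then show ?thesis using d by (intro exI[of _ "2 * exp (1 + G.mean + L)"] exI[of _ \<delta>]) auto
qed

text \<open>Evaluate the delay identity at \<open>s = t + k * E X - B\<close>, where \<open>X\<close> has law \<open>F0\<close> and \<open>B = \<epsilon> * t / k\<close>. Jensen's inequality bounds the side with
  \<open>P k\<close> from below by a value that is close to the profile. On the other side \<open>v k (s - Z)\<close> is at most \<open>v k t\<close> unless \<open>Z\<close> falls below
  its mean by more than \<open>B\<close>. On this rare event the upper bound for \<open>v k\<close> grows like an exponential function with rate of order \<open>k / t\<close>, and
  the lower tail of \<open>Z\<close> pays for it: the exponential moment of order \<open>A * k / t\<close> leaves a factor of about
  \<open>exp (- A * \<epsilon>)\<close>, which is small for large \<open>A\<close>.\<close>

lemma v_lower_second_moment: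
  assumes K: "0 < K" and d: "\<delta> \<le> 1"
    and up: "\<And>k t. 1 \<le> k \<Longrightarrow> 0 < t \<Longrightarrow> real k ^ 3 / t\<^sup>2 \<le> \<delta> \<Longrightarrow> v k t \<le> K * D k t"
    and t: "0 < t" and k: "1 \<le> k" and x: "real k ^ 3 / t\<^sup>2 \<le> \<delta>" and xa: "real k ^ 3 / t\<^sup>2 * shift\<^sup>2 \<le> 1 / 16"
    and e: "0 < \<epsilon>" "\<epsilon> \<le> 1 / 4" and A: "1 + \<bar>shift\<bar> \<le> A"
  shows "D k t * (exp (- \<epsilon> - 4 * \<epsilon>\<^sup>2 - 4 * shift\<^sup>2 * (real k ^ 3 / t\<^sup>2))
      - K * exp (- A * \<epsilon> + A\<^sup>2 * F0.sq_mean / 2 * (real k ^ 3 / t\<^sup>2))) \<le> v k t"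
proof -
  let ?x = "real k ^ 3 / t\<^sup>2"
  define B where "B = \<epsilon> * t / real k"
  define s where "s = t + real k * F0.mean - B"
  define \<theta> where "\<theta> = A * real k / t"
  have "(real k / t)\<^sup>2 \<le> 1" using ratio_square_le[OF t k x] d by simp
  then have kt: "real k / t \<le> 1" using t by (simp add: abs_square_le_1)
  have th: "0 \<le> \<theta>" using A t by (simp add: \<theta>_def)
  have D0: "0 < D k t" by (rule profile_pos[OF t])
  have pw: "v k u \<le> v k t + K * D k t * exp (\<theta> * (u - t))" for u
  proof (cases "u \<le> t")
    case True
    have "0 \<le> K * D k t * exp (\<theta> * (u - t))" using K D0 by simp
    then show ?thesis using v_mono[OF True, of k] by linarith
  next
    case False
    then have u: "t < u" "0 < u" using t by auto
    have "t\<^sup>2 \<le> u\<^sup>2" using u t by (intro power_mono) auto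
    then have "real k ^ 3 / u\<^sup>2 \<le> ?x" using t u by (intro divide_left_mono) auto
    then have "v k u \<le> K * D k u" using x by (intro up k u) simp
    also have "D k u \<le> D k t * exp (\<theta> * (u - t))"
    proof -
      have "1 / t - 1 / u = (u - t) / (t * u)" using t u by (simp add: field_simps)
      also have "\<dots> \<le> (u - t) / (t * t)" using t u by (intro divide_left_mono mult_left_mono) auto
      finally have i: "1 / t - 1 / u \<le> (u - t) / (t * t)" .
      have i0: "0 \<le> 1 / t - 1 / u" using t u by (simp add: field_simps)
      have "shift * (real k)\<^sup>2 / u - shift * (real k)\<^sup>2 / t = - shift * ((real k)\<^sup>2 * (1 / t - 1 / u))"
        by (simp add: algebra_simps)
      also have "\<dots> \<le> \<bar>shift\<bar> * ((real k)\<^sup>2 * (1 / t - 1 / u))" using i0 by (intro mult_right_mono) auto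
      also have "\<dots> \<le> \<bar>shift\<bar> * ((real k)\<^sup>2 * ((u - t) / (t * t)))" using i by (intro mult_left_mono) auto
      also have "\<dots> = (\<bar>shift\<bar> * (real k / t) * (u - t)) * (real k / t)" by (simp add: power2_eq_square)
      also have "\<dots> \<le> (\<bar>shift\<bar> * (real k / t) * (u - t)) * 1" using kt t u by (intro mult_left_mono) auto
      finally have j: "shift * (real k)\<^sup>2 / u \<le> shift * (real k)\<^sup>2 / t + \<bar>shift\<bar> * (real k / t) * (u - t)" by simp
      have "(1 + \<bar>shift\<bar>) * ((real k / t) * (u - t)) \<le> A * ((real k / t) * (u - t))"
        using A t u by (intro mult_right_mono) auto
      moreover have "(1 + \<bar>shift\<bar>) * ((real k / t) * (u - t)) = real k * (u - t) / t + \<bar>shift\<bar> * (real k / t) * (u - t)"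
        by (simp add: distrib_right add_divide_distrib mult.assoc)
      moreover have "A * ((real k / t) * (u - t)) = \<theta> * (u - t)" by (simp add: \<theta>_def)
      ultimately have l: "real k * (u - t) / t + \<bar>shift\<bar> * (real k / t) * (u - t) \<le> \<theta> * (u - t)"
        by (simp only:)
      have "D k u \<le> (P k t * exp (real k * (u - t) / t)) * exp (shift * (real k)\<^sup>2 / t + \<bar>shift\<bar> * (real k / t) * (u - t))"
        unfolding profile_def using j P_nonneg
        by (intro mult_mono P_exp_bound t) auto
      also have "\<dots> = D k t * exp (real k * (u - t) / t + \<bar>shift\<bar> * (real k / t) * (u - t))"
        by (simp add: profile_def exp_add)
      also have "\<dots> \<le> D k t * exp (\<theta> * (u - t))"
        using l D0 by (intro mult_left_mono) auto
      finally show ?thesis .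
    qed
    finally have "v k u \<le> K * D k t * exp (\<theta> * (u - t))" using K by (simp add: mult.assoc)
    then show ?thesis using v_nonneg[of k t] by linarith
  qed
  define c where "c = K * D k t * exp (- \<theta> * t)"
  have c0: "0 \<le> c" using K D0 by (simp add: c_def)
  have "ennreal (P k (s - real k * G.mean)) \<le> (conv G ^^ k) (\<lambda>u. ennreal (P k u)) s"
    by (rule P_jensen_pow[OF k])
  also have "\<dots> = (conv F0 ^^ k) (\<lambda>u. ennreal (v k u)) s" by (simp only: delay_identity_v)
  also have "\<dots> \<le> ennreal (v k t + c * (exp (\<theta> * s) * exp (real k * (- \<theta> * F0.mean + \<theta>\<^sup>2 * F0.sq_mean / 2))))"
  proof (rule F0.conv_pow_affine_bound)
    fix u
    have "K * D k t * exp (\<theta> * (u - t)) = c * exp (\<theta> * u)"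
      by (simp add: c_def exp_add[symmetric] algebra_simps)
    then show "v k u \<le> v k t + c * exp (\<theta> * u)" using pw[of u] by simp
  next
    show "(conv F0 ^^ k) (\<lambda>u. ennreal (exp (\<theta> * u))) s
      \<le> ennreal (exp (\<theta> * s) * exp (real k * (- \<theta> * F0.mean + \<theta>\<^sup>2 * F0.sq_mean / 2)))"
      using mult_left_mono[OF F0.exp_mom_pow_le[OF th, of k], of "ennreal (exp (\<theta> * s))"]
      by (simp add: F0.conv_pow_exp ennreal_mult')
  qed (use c0 v_nonneg in auto)
  finally have "P k (s - real k * G.mean) \<le> v k t + c * (exp (\<theta> * s) * exp (real k * (- \<theta> * F0.mean + \<theta>\<^sup>2 * F0.sq_mean / 2)))"
    using c0 v_nonneg[of k t] by (subst (asm) ennreal_le_iff) auto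
  moreover have "c * (exp (\<theta> * s) * exp (real k * (- \<theta> * F0.mean + \<theta>\<^sup>2 * F0.sq_mean / 2)))
      = K * D k t * exp (- A * \<epsilon> + A\<^sup>2 * F0.sq_mean / 2 * ?x)"
  proof -
    have "- \<theta> * t + (\<theta> * s + real k * (- \<theta> * F0.mean + \<theta>\<^sup>2 * F0.sq_mean / 2)) = - \<theta> * B + real k * \<theta>\<^sup>2 * F0.sq_mean / 2"
      by (simp add: s_def algebra_simps)
    also have "\<dots> = - A * \<epsilon> + A\<^sup>2 * F0.sq_mean / 2 * ?x"
      using k t by (simp add: \<theta>_def B_def power_divide power_mult_distrib power2_eq_square power3_eq_cube mult_ac)
    finally show ?thesis unfolding c_def by (simp only: mult.assoc exp_add[symmetric])
  qed
  ultimately have main: "P k (s - real k * G.mean) \<le> v k t + K * D k t * exp (- A * \<epsilon> + A\<^sup>2 * F0.sq_mean / 2 * ?x)" by simp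
  define y where "y = shift * (real k / t) - \<epsilon> / real k"
  have z: "s - real k * G.mean = t * (1 + y)"
    using t k by (simp add: s_def B_def y_def shift_def field_simps)
  have y1: "\<bar>y\<bar> \<le> 1 / 2"
  proof -
    have "(real k / t)\<^sup>2 \<le> ?x" using ratio_square_le[OF t k order_refl] .
    then have "(shift * (real k / t))\<^sup>2 \<le> (1 / 4)\<^sup>2"
      using xa mult_right_mono[of "(real k / t)\<^sup>2" ?x "shift\<^sup>2"] by (simp add: power_mult_distrib power_divide mult.commute)
    then have "\<bar>shift * (real k / t)\<bar> \<le> 1 / 4" using abs_le_square_iff[of "shift * (real k / t)" "1 / 4"] by simp
    moreover have "\<bar>\<epsilon> / real k\<bar> \<le> 1 / 4"
    proof -
      have "\<epsilon> / real k \<le> \<epsilon> / 1" using e k by (intro divide_left_mono) auto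
      then show ?thesis using e k by simp
    qed
    ultimately show ?thesis unfolding y_def by linarith
  qed
  have ky: "real k * y\<^sup>2 \<le> 2 * shift\<^sup>2 * ?x + 2 * \<epsilon>\<^sup>2"
  proof -
    have "y\<^sup>2 \<le> 2 * (shift * (real k / t))\<^sup>2 + 2 * (\<epsilon> / real k)\<^sup>2"
    proof -
      have "0 \<le> (shift * (real k / t) + \<epsilon> / real k)\<^sup>2" by simp
      then show ?thesis unfolding y_def power2_sum power2_diff by linarith
    qed
    then have "real k * y\<^sup>2 \<le> real k * (2 * (shift * (real k / t))\<^sup>2 + 2 * (\<epsilon> / real k)\<^sup>2)" by (intro mult_left_mono) auto
    also have "\<dots> = 2 * shift\<^sup>2 * ?x + 2 * \<epsilon>\<^sup>2 / real k"
      using k by (simp add: power_mult_distrib power_divide power2_eq_square power3_eq_cube distrib_left)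
    also have "2 * \<epsilon>\<^sup>2 / real k \<le> 2 * \<epsilon>\<^sup>2 / 1" using k by (intro divide_left_mono) auto
    finally show ?thesis by simp
  qed
  have "D k t * exp (- \<epsilon> - 4 * \<epsilon>\<^sup>2 - 4 * shift\<^sup>2 * ?x) \<le> P k (s - real k * G.mean)"
  proof -
    have "\<bar>ln (1 + y) - y\<bar> \<le> 2 * y\<^sup>2" by (rule abs_ln_one_plus_x_minus_x_bound[OF y1])
    then have "y - 2 * y\<^sup>2 \<le> ln (1 + y)" by linarith
    then have "exp (y - 2 * y\<^sup>2) \<le> 1 + y" using y1 by (subst ln_ge_iff[symmetric]) auto
    then have "exp (y - 2 * y\<^sup>2) ^ k \<le> (1 + y) ^ k" by (intro power_mono) auto
    then have p: "exp (real k * (y - 2 * y\<^sup>2)) \<le> (1 + y) ^ k" by (simp add: exp_of_nat_mult)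
    have "real k * y = shift * (real k)\<^sup>2 / t - \<epsilon>" using k by (simp add: y_def right_diff_distrib power2_eq_square)
    then have "shift * (real k)\<^sup>2 / t + (- \<epsilon> - 4 * \<epsilon>\<^sup>2 - 4 * shift\<^sup>2 * ?x) \<le> real k * (y - 2 * y\<^sup>2)"
      using ky by (simp add: right_diff_distrib)
    then have "exp (shift * (real k)\<^sup>2 / t + (- \<epsilon> - 4 * \<epsilon>\<^sup>2 - 4 * shift\<^sup>2 * ?x)) \<le> exp (real k * (y - 2 * y\<^sup>2))"
      by (subst exp_le_cancel_iff)
    from order_trans[OF this p]
    have "P k t * exp (shift * (real k)\<^sup>2 / t + (- \<epsilon> - 4 * \<epsilon>\<^sup>2 - 4 * shift\<^sup>2 * ?x)) \<le> P k t * (1 + y) ^ k"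
      by (intro mult_left_mono P_nonneg)
    also have "\<dots> = P k (t * (1 + y))"
    proof -
      have "0 \<le> t * (1 + y)" using t y1 by (intro mult_nonneg_nonneg) auto
      then show ?thesis using t by (simp add: P_def power_mult_distrib not_less)
    qed
    finally show ?thesis by (simp only: z profile_def exp_add mult.assoc)
  qed
  with main show ?thesis by (simp add: right_diff_distrib mult.assoc mult.left_commute)
qed

text \<open>In the lower bound first \<open>\<epsilon>\<close> is chosen small, then \<open>A\<close> large, and then \<open>k ^ 3 / t\<^sup>2\<close> tends to 0.\<close>

lemma v_asymp_second_moment:
  fixes k :: "real \<Rightarrow> nat"
  assumes lim: "((\<lambda>t. real (k t) ^ 3 / t\<^sup>2) \<longlongrightarrow> 0) at_top"
  shows "((\<lambda>t. v (k t) t / D (k t) t) \<longlongrightarrow> 1) at_top"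
proof -
  define x where "x t = real (k t) ^ 3 / t\<^sup>2" for t
  have X: "(x \<longlongrightarrow> 0) at_top" using lim by (simp add: x_def[abs_def])
  show ?thesis
  proof (rule order_tendstoI)
  fix b :: real assume b: "b < 1"
  obtain K \<delta> where K: "0 < K" "0 < \<delta>" "\<delta> \<le> 1"
    "\<And>k t. 1 \<le> k \<Longrightarrow> 0 < t \<Longrightarrow> real k ^ 3 / t\<^sup>2 \<le> \<delta> \<Longrightarrow> v k t \<le> K * D k t"
    using v_le_const_profile by metis
  obtain \<epsilon> :: real where e: "b < exp (- \<epsilon> - 4 * \<epsilon>\<^sup>2)" "0 < \<epsilon>" "\<epsilon> \<le> 1 / 4"
    by (rule small_argument[of "\<lambda>\<epsilon>. - exp (- \<epsilon> - 4 * \<epsilon>\<^sup>2)" "- b" "1 / 4"]) (use b in auto)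
  have "((\<lambda>A. K * exp (- A * \<epsilon>)) \<longlongrightarrow> K * 0) at_top"
  proof (intro tendsto_mult tendsto_const filterlim_compose[OF exp_at_bot])
    show "filterlim (\<lambda>A. - A * \<epsilon>) at_bot at_top"
      using e(2) by (simp add: filterlim_uminus_at_bot filterlim_at_top_mult_tendsto_pos[OF tendsto_const _ filterlim_ident])
  qed
  then have "eventually (\<lambda>A. K * exp (- A * \<epsilon>) < exp (- \<epsilon> - 4 * \<epsilon>\<^sup>2) - b) at_top"
    by (rule order_tendstoD) (use e in simp)
  then have "eventually (\<lambda>A. K * exp (- A * \<epsilon>) < exp (- \<epsilon> - 4 * \<epsilon>\<^sup>2) - b \<and> 1 + \<bar>shift\<bar> \<le> A) at_top"
    using eventually_ge_at_top[of "1 + \<bar>shift\<bar>"] by eventually_elim simp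
  then obtain A where A: "K * exp (- A * \<epsilon>) < exp (- \<epsilon> - 4 * \<epsilon>\<^sup>2) - b" "1 + \<bar>shift\<bar> \<le> A"
    by (auto dest: eventually_happens)
  have "((\<lambda>t. exp (- \<epsilon> - 4 * \<epsilon>\<^sup>2 - 4 * shift\<^sup>2 * x t)
      - K * exp (- A * \<epsilon> + A\<^sup>2 * F0.sq_mean / 2 * x t)) \<longlongrightarrow>
      exp (- \<epsilon> - 4 * \<epsilon>\<^sup>2 - 4 * shift\<^sup>2 * 0) - K * exp (- A * \<epsilon> + A\<^sup>2 * F0.sq_mean / 2 * 0)) at_top"
    by (intro tendsto_intros X)
  then have E1: "eventually (\<lambda>t. b < exp (- \<epsilon> - 4 * \<epsilon>\<^sup>2 - 4 * shift\<^sup>2 * x t)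
      - K * exp (- A * \<epsilon> + A\<^sup>2 * F0.sq_mean / 2 * x t)) at_top"
    by (rule order_tendstoD) (use A in simp)
  have E2: "eventually (\<lambda>t. x t < \<delta>) at_top" by (rule order_tendstoD(2)[OF X K(2)])
  have E3: "eventually (\<lambda>t. x t * shift\<^sup>2 < 1 / 16) at_top"
    by (rule order_tendstoD(2)[OF tendsto_mult_left_zero[OF X]]) simp
  show "eventually (\<lambda>t. b < v (k t) t / D (k t) t) at_top"
    using E1 E2 E3 eventually_gt_at_top[of 0]
  proof eventually_elim
    case (elim t)
    have Dp: "0 < D (k t) t" by (rule profile_pos) fact
    show ?case
    proof (cases "k t = 0")
      case True
      then show ?thesis using b elim by (simp add: v_0 P_0 profile_def)
    next
      case False
      have "D (k t) t * (exp (- \<epsilon> - 4 * \<epsilon>\<^sup>2 - 4 * shift\<^sup>2 * x t)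
        - K * exp (- A * \<epsilon> + A\<^sup>2 * F0.sq_mean / 2 * x t)) \<le> v (k t) t"
        using elim e A False unfolding x_def by (intro v_lower_second_moment[OF K(1,3,4)]) auto
      moreover have "D (k t) t * b < D (k t) t * (exp (- \<epsilon> - 4 * \<epsilon>\<^sup>2 - 4 * shift\<^sup>2 * x t)
        - K * exp (- A * \<epsilon> + A\<^sup>2 * F0.sq_mean / 2 * x t))"
        using elim Dp by (intro mult_strict_left_mono)
      ultimately have "D (k t) t * b < v (k t) t" by linarith
      then show ?thesis using Dp by (simp add: field_simps)
    qed
  qed
next
  fix b :: real assume b: "1 < b"
  obtain \<epsilon> :: real where e: "exp (\<epsilon> * (1 + G.mean)) < b" "0 < \<epsilon>"
    by (rule small_argument[of "\<lambda>\<epsilon>. exp (\<epsilon> * (1 + G.mean))" b 1]) (use b in auto)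
  have "((\<lambda>t. b * (1 - x t * F0.sq_mean / \<epsilon>\<^sup>2)
      - exp (\<epsilon> * (1 + G.mean) + x t * (G.mean * F0.mean + G.sq_mean / 2))) \<longlongrightarrow>
      b * (1 - 0 * F0.sq_mean / \<epsilon>\<^sup>2) - exp (\<epsilon> * (1 + G.mean) + 0 * (G.mean * F0.mean + G.sq_mean / 2))) at_top"
    using e(2) by (intro tendsto_intros X) auto
  then have E1: "eventually (\<lambda>t. 0 < b * (1 - x t * F0.sq_mean / \<epsilon>\<^sup>2)
      - exp (\<epsilon> * (1 + G.mean) + x t * (G.mean * F0.mean + G.sq_mean / 2))) at_top"
    by (rule order_tendstoD) (use e in simp)
  have E2: "eventually (\<lambda>t. x t < 1) at_top" by (rule order_tendstoD(2)[OF X]) simp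
  show "eventually (\<lambda>t. v (k t) t / D (k t) t < b) at_top"
    using E1 E2 eventually_gt_at_top[of 0]
  proof eventually_elim
    case (elim t)
    have Dp: "0 < D (k t) t" by (rule profile_pos) fact
    show ?case
    proof (cases "k t = 0")
      case True
      then show ?thesis using b elim by (simp add: v_0 P_0 profile_def)
    next
      case False
      let ?q = "1 - x t * F0.sq_mean / \<epsilon>\<^sup>2"
      let ?E = "exp (\<epsilon> * (1 + G.mean) + x t * (G.mean * F0.mean + G.sq_mean / 2))"
      have k1: "1 \<le> k t" using False by simp
      have "(real (k t) / t)\<^sup>2 \<le> 1" using ratio_square_le[OF elim(3) k1, of 1] elim by (simp add: x_def)
      then have kt: "real (k t) \<le> t" using elim by (simp add: abs_square_le_1 divide_le_eq)
      have "v (k t) t * ?q \<le> D (k t) t * ?E"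
        unfolding x_def by (rule v_upper_second_moment[OF elim(3) k1 kt e(2)])
      also have "\<dots> < D (k t) t * (b * ?q)" using elim Dp by (intro mult_strict_left_mono) auto
      finally have "v (k t) t * ?q < (D (k t) t * b) * ?q" by (simp add: mult.assoc)
      moreover have "0 < ?q"
      proof -
        have "0 < b * ?q" using elim exp_gt_zero[of "\<epsilon> * (1 + G.mean) + x t * (G.mean * F0.mean + G.sq_mean / 2)"] by linarith
        then show ?thesis using b by (simp add: zero_less_mult_iff)
      qed
      ultimately have "v (k t) t < D (k t) t * b" by (rule mult_right_less_imp_less[OF _ less_imp_le])
      then show ?thesis using Dp by (simp add: field_simps)
    qed
  qed
qed
qed

end

section \<open>Moments of the delay distribution\<close>

lemma nn_integral_indicator_has_integral:
  fixes g :: "real \<Rightarrow> real"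
  assumes [measurable]: "g \<in> borel_measurable borel" "S \<in> sets borel"
    and nn: "\<And>x. 0 \<le> g x" and I: "(g has_integral I) S"
  shows "(\<integral>\<^sup>+ x. ennreal (g x) * indicator S x \<partial>lborel) = ennreal I"
proof -
  have "(\<integral>\<^sup>+ x. ennreal (g x) * indicator S x \<partial>lborel) = (\<integral>\<^sup>+ x. ennreal (if x \<in> S then g x else 0) \<partial>lborel)"
    by (intro nn_integral_cong) (auto simp: indicator_def)
  also have "\<dots> = ennreal I"
    by (rule nn_integral_has_integral_lborel) (use nn I in \<open>auto simp: has_integral_restrict_UNIV\<close>)
  finally show ?thesis .
qed

context prw_setup
begin

definition tail :: "real \<Rightarrow> real" where
  "tail x = measure M {\<omega> \<in> space M. \<xi> \<omega> > x}"

lemma tail_le_1: "tail x \<le> 1" by (simp add: tail_def)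

lemma tail_eq: "emeasure F {x<..} = ennreal (tail x)"
  by (simp add: emeasure_distr tail_def emeasure_eq_measure vimage_def Int_def conj_commute)

text \<open>Tonelli's theorem for the region between 0 and \<open>\<xi>\<close>.\<close>

lemma nn_integral_below:
  assumes [measurable]: "h \<in> borel_measurable borel"
  shows "(\<integral>\<^sup>+ z. \<integral>\<^sup>+ x. h x * (if 0 \<le> x \<and> x < z then 1 else 0) \<partial>lborel \<partial>F)
    = (\<integral>\<^sup>+ x. h x * indicator {0..} x * emeasure F {x<..} \<partial>lborel)"
proof -
  interpret Q: pair_sigma_finite F "lborel :: real measure" ..
  have "(\<integral>\<^sup>+ z. \<integral>\<^sup>+ x. h x * (if 0 \<le> x \<and> x < z then 1 else 0) \<partial>lborel \<partial>F)
      = (\<integral>\<^sup>+ x. \<integral>\<^sup>+ z. h x * (if 0 \<le> x \<and> x < z then 1 else 0) \<partial>F \<partial>lborel)"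
    by (rule Q.Fubini'[symmetric]) measurable
  also have "\<dots> = (\<integral>\<^sup>+ x. h x * indicator {0..} x * emeasure F {x<..} \<partial>lborel)"
  proof (rule nn_integral_cong)
    fix x
    have "(\<integral>\<^sup>+ z. h x * (if 0 \<le> x \<and> x < z then 1 else 0) \<partial>F) = (\<integral>\<^sup>+ z. h x * indicator {0..} x * indicator {x<..} z \<partial>F)"
      by (intro nn_integral_cong) (auto simp: indicator_def)
    also have "\<dots> = h x * indicator {0..} x * emeasure F {x<..}" by (subst nn_integral_cmult_indicator) auto
    finally show "(\<integral>\<^sup>+ z. h x * (if 0 \<le> x \<and> x < z then 1 else 0) \<partial>F) = h x * indicator {0..} x * emeasure F {x<..}" .
  qed
  finally show ?thesis .
qed

text \<open>The asymptotic relation gives the bound for large \<open>x\<close>; for small \<open>x\<close> the tail is at most 1, and the power is bounded from below.\<close>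

lemma regular_tail_bound:
  assumes b: "0 < b" and s: "sim_const (\<lambda>t. measure M {\<omega> \<in> space M. \<xi> \<omega> > t}) b (\<lambda>t. t powr (- r))" and r: "1 < r"
  obtains A where "0 < A" "\<And>x. 0 < x \<Longrightarrow> tail x \<le> A * x powr (- r)"
proof -
  have "((\<lambda>t. tail t / t powr (- r)) \<longlongrightarrow> b) at_top" using s by (simp add: sim_const_def tail_def)
  then have "eventually (\<lambda>t. tail t / t powr (- r) < b + 1) at_top" by (rule order_tendstoD) simp
  then obtain T0 where T0: "\<And>t. T0 \<le> t \<Longrightarrow> tail t / t powr (- r) < b + 1" by (auto simp: eventually_at_top_linorder)
  define T where "T = max 1 T0"
  define A where "A = max (b + 1) (T powr r)"
  have "tail x \<le> A * x powr (- r)" if x: "0 < x" for x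
  proof (cases "T \<le> x")
    case True
    then have "tail x < (b + 1) * x powr (- r)" using T0[of x] x by (simp add: T_def field_simps)
    also have "\<dots> \<le> A * x powr (- r)" by (intro mult_right_mono) (auto simp: A_def)
    finally show ?thesis by simp
  next
    case False
    have "1 \<le> (T / x) powr r" using False x r by (intro ge_one_powr_ge_zero) auto
    also have "\<dots> = T powr r * x powr (- r)"
    proof -
      have "(T / x) powr r = T powr r / x powr r" by (rule powr_divide)
      then show ?thesis by (simp add: powr_minus_divide)
    qed
    also have "\<dots> \<le> A * x powr (- r)" by (intro mult_right_mono) (auto simp: A_def)
    finally show ?thesis using tail_le_1[of x] by simp
  qed
  moreover have "0 < A" using b by (simp add: A_def)
  ultimately show thesis using that by blast
qed

text \<open>Under the tail condition the mean is the integral of the tail, and \<open>x powr (- r)\<close> is integrable at infinity as \<open>r > 1\<close>.\<close>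

lemma integrable_of_nonlattice_assms:
  assumes "nonlattice_assms M \<xi> \<eta> j"
  shows "integrable M \<xi>"
proof -
  obtain r where "(1 < r \<and> r \<le> 2 \<and> integrable M (\<lambda>\<omega>. \<xi> \<omega> powr r)) \<or>
         (1 < r \<and> r < 2 \<and>
            (\<exists>b>0. sim_const (\<lambda>t. measure M {\<omega>\<in>space M. \<xi> \<omega> > t}) b (\<lambda>t. t powr (- r))))"
    using assms unfolding nonlattice_assms_def by blast
  then show ?thesis
  proof (elim disjE conjE exE)
    assume r: "1 < r" "r \<le> 2" and i: "integrable M (\<lambda>\<omega>. \<xi> \<omega> powr r)"
    show ?thesis
    proof (rule Bochner_Integration.integrable_bound[of _ "\<lambda>\<omega>. 1 + \<xi> \<omega> powr r"])
      show "AE \<omega> in M. norm (\<xi> \<omega>) \<le> norm (1 + \<xi> \<omega> powr r)"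
        using xi_pos
      proof eventually_elim
        case (elim \<omega>)
        have "\<xi> \<omega> \<le> 1 + \<xi> \<omega> powr r"
        proof (cases "\<xi> \<omega> \<le> 1")
          case True then show ?thesis using powr_ge_zero[of "\<xi> \<omega>" r] by linarith
        next
          case False
          then have "\<xi> \<omega> powr 1 \<le> \<xi> \<omega> powr r" using r by (intro powr_mono) auto
          then show ?thesis using elim by simp
        qed
        then show ?case using elim by simp
      qed
    qed (use i in auto)
  next
    fix b assume r: "1 < r" "r < 2" and b: "0 < b"
      and s: "sim_const (\<lambda>t. measure M {\<omega>\<in>space M. \<xi> \<omega> > t}) b (\<lambda>t. t powr (- r))"
    obtain A where A: "0 < A" "\<And>x. 0 < x \<Longrightarrow> tail x \<le> A * x powr (- r)"
      using regular_tail_bound[OF b s r(1)] by blast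
    have I: "((\<lambda>x. x powr (- r)) has_integral - (1 powr (- r + 1)) / (- r + 1)) {1..}"
      by (rule has_integral_powr_to_inf) (use r in auto)
    have "(\<integral>\<^sup>+ \<omega>. ennreal (norm (\<xi> \<omega>)) \<partial>M) = (\<integral>\<^sup>+ \<omega>. ennreal (\<xi> \<omega>) \<partial>M)"
      using xi_pos by (intro nn_integral_cong_AE) (auto elim!: eventually_mono)
    also have "\<dots> = (\<integral>\<^sup>+ z. ennreal z \<partial>F)" by (simp add: nn_integral_distr)
    also have "\<dots> = (\<integral>\<^sup>+ z. \<integral>\<^sup>+ x. 1 * (if 0 \<le> x \<and> x < z then 1 else 0) \<partial>lborel \<partial>F)"
    proof (rule nn_integral_cong)
      fix z :: real
      have "(\<integral>\<^sup>+ x. 1 * (if 0 \<le> x \<and> x < z then 1 else 0) \<partial>lborel) = (\<integral>\<^sup>+ x. indicator {0..<z} x \<partial>lborel)"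
        by (intro nn_integral_cong) (auto simp: indicator_def)
      also have "\<dots> = ennreal z" by (cases "0 \<le> z") (auto simp: ennreal_neg)
      finally show "ennreal z = (\<integral>\<^sup>+ x. 1 * (if 0 \<le> x \<and> x < z then 1 else 0) \<partial>lborel)" by simp
    qed
    also have "\<dots> = (\<integral>\<^sup>+ x. 1 * indicator {0..} x * emeasure F {x<..} \<partial>lborel)" by (rule nn_integral_below) simp
    also have "\<dots> \<le> (\<integral>\<^sup>+ x. indicator {0..1} x + ennreal A * (ennreal (x powr (- r)) * indicator {1..} x) \<partial>lborel)"
    proof (rule nn_integral_mono)
      fix x :: real
      show "1 * indicator {0..} x * emeasure F {x<..} \<le> indicator {0..1} x + ennreal A * (ennreal (x powr (- r)) * indicator {1..} x)"
      proof (cases "x \<le> 1")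
        case True
        have "emeasure F {x<..} \<le> 1" by (simp add: tail_eq tail_le_1 ennreal_le_1)
        then have "1 * indicator {0..} x * emeasure F {x<..} \<le> indicator {0..1} x" using True by (auto simp: indicator_def)
        then show ?thesis by (rule order_trans) simp
      next
        case False
        then have "emeasure F {x<..} \<le> ennreal (A * x powr (- r))" unfolding tail_eq by (intro ennreal_leI A) simp
        then show ?thesis using False A(1) by (simp add: indicator_def ennreal_mult)
      qed
    qed
    also have "\<dots> = (\<integral>\<^sup>+ x. indicator {0..1} x \<partial>(lborel :: real measure)) + ennreal A * (\<integral>\<^sup>+ x. ennreal (x powr (- r)) * indicator {1..} x \<partial>lborel)"
      by (subst nn_integral_add, measurable, subst nn_integral_cmult, measurable)
    also have "\<dots> < \<infinity>"
      by (subst nn_integral_indicator_has_integral[OF _ _ _ I]) (simp_all add: ennreal_mult_less_top)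
    finally show ?thesis by (intro integrableI_bounded) auto
  qed
qed

end

context prw_finite_mean
begin

lemma trunc_mean_G: "G.trunc_mean t = (LINT \<omega>|M. min (\<eta> \<omega>) t)"
  unfolding G.trunc_mean_def by (subst integral_distr) auto

lemma nn_trunc_F0:
  "0 \<le> t \<Longrightarrow> ennreal (F0.trunc_mean t) = ennreal (1 / m) * (\<integral>\<^sup>+ z. \<integral>\<^sup>+ x. ennreal (min x t) * (if 0 \<le> x \<and> x < z then 1 else 0) \<partial>lborel \<partial>F)"
  by (subst F0.nn_trunc_mean[symmetric]) (simp_all add: nn_integral_F0)

text \<open>Interpolation: \<open>min x t \<le> x powr (r - 1) * t powr (2 - r)\<close>, as the two exponents are nonnegative and add up to 1.\<close>

lemma trunc_mean_F0_moment:
  assumes r: "1 < r" "r \<le> 2" and i: "integrable M (\<lambda>\<omega>. \<xi> \<omega> powr r)"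
  shows "\<exists>C\<ge>0. \<forall>t>0. F0.trunc_mean t \<le> C * t powr (2 - r)"
proof (intro exI conjI allI impI)
  let ?E = "LINT \<omega>|M. \<xi> \<omega> powr r"
  have E0: "0 \<le> ?E" by (rule integral_nonneg_AE) simp
  show "0 \<le> ?E / m" using E0 m_pos by simp
  fix t :: real assume t: "0 < t"
  have "(\<integral>\<^sup>+ z. \<integral>\<^sup>+ x. ennreal (min x t) * (if 0 \<le> x \<and> x < z then 1 else 0) \<partial>lborel \<partial>F) \<le> (\<integral>\<^sup>+ z. ennreal (t powr (2 - r)) * ennreal (z powr r) \<partial>F)"
  proof (rule nn_integral_mono)
    fix z
    show "(\<integral>\<^sup>+ x. ennreal (min x t) * (if 0 \<le> x \<and> x < z then 1 else 0) \<partial>lborel) \<le> ennreal (t powr (2 - r)) * ennreal (z powr r)"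
    proof (cases "z \<le> 0")
      case True
      then have "(\<integral>\<^sup>+ x. ennreal (min x t) * (if 0 \<le> x \<and> x < z then 1 else 0) \<partial>lborel) = (\<integral>\<^sup>+ x. 0 \<partial>(lborel :: real measure))"
        by (intro nn_integral_cong) auto
      then show ?thesis by simp
    next
      case False
      have "(\<integral>\<^sup>+ x. ennreal (min x t) * (if 0 \<le> x \<and> x < z then 1 else 0) \<partial>lborel)
          \<le> (\<integral>\<^sup>+ x. ennreal (z powr (r - 1) * t powr (2 - r)) * indicator {0..<z} x \<partial>lborel)"
      proof (rule nn_integral_mono)
        fix x
        have "min x t \<le> z powr (r - 1) * t powr (2 - r)" if x: "0 \<le> x" "x < z"
        proof (cases "x = 0")
          case True then show ?thesis using t by (simp add: min_def)
        next
          case False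
          define y where "y = min x t"
          have y: "0 < y" "y \<le> x" "y \<le> t" using False x t by (auto simp: y_def)
          have "y = y powr (r - 1) * y powr (2 - r)" using y by (simp add: powr_add[symmetric])
          also have "\<dots> \<le> z powr (r - 1) * t powr (2 - r)" using y x r by (intro mult_mono powr_mono2) auto
          finally show ?thesis by (simp add: y_def)
        qed
        then show "ennreal (min x t) * (if 0 \<le> x \<and> x < z then 1 else 0) \<le> ennreal (z powr (r - 1) * t powr (2 - r)) * indicator {0..<z} x"
          by (auto simp: indicator_def intro!: ennreal_leI)
      qed
      also have "\<dots> = ennreal (z powr (r - 1) * t powr (2 - r)) * ennreal z"
        using False by (subst nn_integral_cmult_indicator) auto
      also have "\<dots> = ennreal (t powr (2 - r)) * ennreal (z powr r)"
        using False by (simp add: ennreal_mult'[symmetric] powr_diff)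
      finally show ?thesis .
    qed
  qed
  also have "\<dots> = ennreal (t powr (2 - r)) * ennreal ?E"
  proof -
    have "(\<integral>\<^sup>+ z. ennreal (z powr r) \<partial>F) = (\<integral>\<^sup>+ \<omega>. ennreal (\<xi> \<omega> powr r) \<partial>M)" by (simp add: nn_integral_distr)
    also have "\<dots> = ennreal ?E" by (rule nn_integral_eq_integral[OF i]) simp
    finally show ?thesis by (subst nn_integral_cmult) auto
  qed
  finally have "ennreal (F0.trunc_mean t) \<le> ennreal (1 / m) * (ennreal (t powr (2 - r)) * ennreal ?E)"
    using nn_trunc_F0[of t] t by (simp add: mult_left_mono)
  also have "\<dots> = ennreal (?E / m * t powr (2 - r))"
    using m_pos E0 by (simp add: ennreal_mult'[symmetric] mult.commute)
  finally show "F0.trunc_mean t \<le> ?E / m * t powr (2 - r)"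
    using E0 m_pos by (subst (asm) ennreal_le_iff) auto
qed

text \<open>The truncated mean is the integral of \<open>min x t\<close> times the tail. It is split at \<open>t\<close>: below \<open>t\<close> one uses
  \<open>r < 2\<close>, above \<open>t\<close> one uses \<open>r > 1\<close>.\<close>

lemma trunc_mean_F0_tail:
  assumes r: "1 < r" "r < 2" and A: "0 < A" "\<And>x. 0 < x \<Longrightarrow> tail x \<le> A * x powr (- r)"
  shows "\<exists>C\<ge>0. \<forall>t>0. F0.trunc_mean t \<le> C * t powr (2 - r)"
proof (intro exI conjI allI impI)
  let ?C = "A / m * (1 / (2 - r) + 1 / (r - 1))"
  show C0: "0 \<le> ?C" using A m_pos r by simp
  fix t :: real assume t: "0 < t"
  have I1: "((\<lambda>x. x powr (1 - r)) has_integral (t powr (1 - r + 1) / (1 - r + 1))) {0..t}"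
    by (rule has_integral_powr_from_0) (use r t in auto)
  have I2: "((\<lambda>x. x powr (- r)) has_integral - (t powr (- r + 1)) / (- r + 1)) {t..}"
    by (rule has_integral_powr_to_inf) (use r t in auto)
  have "(\<integral>\<^sup>+ z. \<integral>\<^sup>+ x. ennreal (min x t) * (if 0 \<le> x \<and> x < z then 1 else 0) \<partial>lborel \<partial>F)
      = (\<integral>\<^sup>+ x. ennreal (min x t) * indicator {0..} x * emeasure F {x<..} \<partial>lborel)"
    by (rule nn_integral_below) simp
  also have "\<dots> \<le> (\<integral>\<^sup>+ x. ennreal A * (ennreal (x powr (1 - r)) * indicator {0..t} x) + ennreal (A * t) * (ennreal (x powr (- r)) * indicator {t..} x) \<partial>lborel)"
  proof (rule nn_integral_mono)
    fix x :: real
    let ?l = "ennreal (min x t) * indicator {0..} x * emeasure F {x<..}"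
    let ?a = "ennreal A * (ennreal (x powr (1 - r)) * indicator {0..t} x)" and ?b = "ennreal (A * t) * (ennreal (x powr (- r)) * indicator {t..} x)"
    show "?l \<le> ?a + ?b"
    proof (cases "x \<le> 0")
      case True
      then show ?thesis using t by (auto simp: indicator_def ennreal_neg)
    next
      case x: False
      then have e: "emeasure F {x<..} \<le> ennreal (A * x powr (- r))" unfolding tail_eq by (intro ennreal_leI A) simp
      show ?thesis
      proof (cases "x \<le> t")
        case True
        have "?l \<le> ennreal x * ennreal (A * x powr (- r))" using e x True by (simp add: indicator_def mult_left_mono min_def)
        also have "\<dots> = ?a" using x True A by (simp add: indicator_def ennreal_mult'[symmetric] powr_diff powr_minus field_simps)
        finally show ?thesis by (rule order_trans) simp
      next
        case False
        have "?l \<le> ennreal t * ennreal (A * x powr (- r))" using e x False by (simp add: indicator_def mult_left_mono min_def)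
        also have "\<dots> = ?b" using x False A t by (simp add: indicator_def ennreal_mult'[symmetric] mult_ac)
        finally show ?thesis by (rule order_trans) simp
      qed
    qed
  qed
  also have "\<dots> = ennreal A * (\<integral>\<^sup>+ x. ennreal (x powr (1 - r)) * indicator {0..t} x \<partial>lborel)
      + ennreal (A * t) * (\<integral>\<^sup>+ x. ennreal (x powr (- r)) * indicator {t..} x \<partial>lborel)"
    by (subst nn_integral_add, measurable, subst nn_integral_cmult, measurable, subst nn_integral_cmult, measurable)
  also have "\<dots> = ennreal A * ennreal (t powr (1 - r + 1) / (1 - r + 1)) + ennreal (A * t) * ennreal (- (t powr (- r + 1)) / (- r + 1))"
    using nn_integral_indicator_has_integral[OF _ _ _ I1] nn_integral_indicator_has_integral[OF _ _ _ I2] by simp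
  also have "\<dots> = ennreal (A * (t powr (1 - r + 1) / (1 - r + 1)) + (A * t) * (- (t powr (- r + 1)) / (- r + 1)))"
  proof -
    have *: "ennreal p * ennreal a + ennreal q * ennreal b = ennreal (p * a + q * b)"
      if "0 \<le> p" "0 \<le> q" "0 \<le> a" "0 \<le> b" for p q a b
      using that by (simp add: ennreal_mult)
    have "0 \<le> - (t powr (- r + 1)) / (- r + 1)" using r by (simp add: divide_nonneg_neg divide_nonpos_neg)
    then show ?thesis using A t r by (intro *) auto
  qed
  also have "A * (t powr (1 - r + 1) / (1 - r + 1)) + (A * t) * (- (t powr (- r + 1)) / (- r + 1)) = m * (?C * t powr (2 - r))"
  proof -
    have "t * t powr (- r + 1) = t powr (2 - r)" using t powr_add[of t 1 "- r + 1"] by simp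
    moreover have "1 - r + 1 = 2 - r" by simp
    moreover have "- (t powr (- r + 1)) / (- r + 1) = t powr (- r + 1) / (r - 1)"
      by (metis (no_types, opaque_lifting) minus_diff_eq minus_divide_divide uminus_add_conv_diff)
    ultimately have "A * (t powr (1 - r + 1) / (1 - r + 1)) + (A * t) * (- (t powr (- r + 1)) / (- r + 1))
        = A * (t powr (2 - r) / (2 - r)) + A * (t powr (2 - r) / (r - 1))" by (simp add: mult.assoc)
    also have "\<dots> = A * (1 / (2 - r) + 1 / (r - 1)) * t powr (2 - r)" by (simp add: distrib_left distrib_right)
    also have "\<dots> = m * (?C * t powr (2 - r))"
    proof -
      have "m * (A / m * s * x) = A * s * x" for s x using m_pos by simp
      then show ?thesis by (simp only:)
    qed
    finally show ?thesis .
  qed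
  finally have "ennreal (F0.trunc_mean t) \<le> ennreal (1 / m) * ennreal (m * (?C * t powr (2 - r)))"
    using nn_trunc_F0[of t] t by (simp add: mult_left_mono)
  also have "\<dots> = ennreal (?C * t powr (2 - r))"
    using m_pos by (simp add: ennreal_mult'[symmetric])
  finally show "F0.trunc_mean t \<le> ?C * t powr (2 - r)"
    by (subst (asm) ennreal_le_iff) (rule mult_nonneg_nonneg[OF C0 powr_ge_zero])
qed

lemma square_trunc_mean_tendsto_0:
  assumes C: "\<And>t. T \<le> t \<Longrightarrow> 0 \<le> q t" "eventually (\<lambda>t. q t \<le> C * t powr (2 - r)) at_top"
    and k: "((\<lambda>t. real (k t) / t powr ((r - 1) / 2)) \<longlongrightarrow> 0) at_top"
  shows "((\<lambda>t. (real (k t))\<^sup>2 * q t / t) \<longlongrightarrow> 0) at_top"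
proof -
  have lim: "((\<lambda>t. C * (real (k t) / t powr ((r - 1) / 2))\<^sup>2) \<longlongrightarrow> C * 0\<^sup>2) at_top"
    by (intro tendsto_intros k)
  show ?thesis
  proof (rule tendsto_sandwich[OF _ _ tendsto_const])
    show "eventually (\<lambda>t. 0 \<le> (real (k t))\<^sup>2 * q t / t) at_top"
      using eventually_ge_at_top[of T] eventually_gt_at_top[of 0] by eventually_elim (simp add: C)
    show "eventually (\<lambda>t. (real (k t))\<^sup>2 * q t / t \<le> C * (real (k t) / t powr ((r - 1) / 2))\<^sup>2) at_top"
      using C(2) eventually_gt_at_top[of 0]
    proof eventually_elim
      case (elim t)
      have "(real (k t))\<^sup>2 * q t / t \<le> (real (k t))\<^sup>2 * (C * t powr (2 - r)) / t"
        using elim by (intro divide_right_mono mult_left_mono) auto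
      also have "\<dots> = C * (real (k t))\<^sup>2 * (t powr (2 - r) / t)" by simp
      also have "t powr (2 - r) / t = t powr (1 - r)"
        using elim powr_diff[of t "2 - r" 1] by simp
      also have "t powr (1 - r) = 1 / (t powr ((r - 1) / 2))\<^sup>2"
        using elim by (simp add: power2_eq_square powr_add[symmetric] powr_minus_divide[symmetric])
      finally show ?case by (simp add: power_divide)
    qed
    show "((\<lambda>t. C * (real (k t) / t powr ((r - 1) / 2))\<^sup>2) \<longlongrightarrow> 0) at_top" using lim by simp
  qed
qed

section \<open>From the convolution powers to the theorem\<close>

text \<open>The exponents differ by at most \<open>2 * \<bar>\<alpha>\<bar> * j / t\<close>, so the theorem may be stated with \<open>j\<close> in place of \<open>j - 1\<close>.\<close>

lemma exp_square_ratio: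
  fixes j :: "real \<Rightarrow> nat"
  assumes "((\<lambda>t. real (j t) / t) \<longlongrightarrow> 0) at_top"
  shows "((\<lambda>t. exp (\<alpha> * (real (j t - 1))\<^sup>2 / t) / exp (\<alpha> * (real (j t))\<^sup>2 / t)) \<longlongrightarrow> 1) at_top"
proof -
  have "((\<lambda>t. \<bar>\<alpha>\<bar> * (2 * (real (j t) / t))) \<longlongrightarrow> \<bar>\<alpha>\<bar> * (2 * 0)) at_top"
    by (intro tendsto_intros assms)
  then have z: "((\<lambda>t. \<bar>\<alpha>\<bar> * (2 * (real (j t) / t))) \<longlongrightarrow> 0) at_top" by simp
  have "((\<lambda>t. \<alpha> * ((real (j t - 1))\<^sup>2 - (real (j t))\<^sup>2) / t) \<longlongrightarrow> 0) at_top"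
  proof (rule Lim_null_comparison[OF _ z])
    show "eventually (\<lambda>t. norm (\<alpha> * ((real (j t - 1))\<^sup>2 - (real (j t))\<^sup>2) / t) \<le> \<bar>\<alpha>\<bar> * (2 * (real (j t) / t))) at_top"
      using eventually_gt_at_top[of 0]
    proof eventually_elim
      case (elim t)
      have "\<bar>(real (j t - 1))\<^sup>2 - (real (j t))\<^sup>2\<bar> \<le> 2 * real (j t)"
        by (cases "j t") (auto simp: power2_eq_square algebra_simps)
      then have "\<bar>\<alpha>\<bar> * \<bar>(real (j t - 1))\<^sup>2 - (real (j t))\<^sup>2\<bar> / t \<le> \<bar>\<alpha>\<bar> * (2 * real (j t)) / t"
        using elim by (intro divide_right_mono mult_left_mono) auto
      then show ?case using elim by (simp add: abs_mult)
    qed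
  qed
  from tendsto_exp[OF this] show ?thesis
    by (simp add: exp_diff[symmetric] right_diff_distrib diff_divide_distrib)
qed

text \<open>\<open>P (k - 1) t / P k t = m * k / t\<close>, and the exponential factors of the two profiles are asymptotically equal.
  The convention for \<open>k = 0\<close> stands for the fact that there is no mass close to \<open>t\<close> in this case.\<close>

lemma v_ratio_tendsto_0:
  fixes k :: "real \<Rightarrow> nat"
  assumes a: "((\<lambda>t. v (k t) t / profile \<alpha> (k t) t) \<longlongrightarrow> 1) at_top"
    and b: "((\<lambda>t. v (k t - 1) t / profile \<alpha> (k t - 1) t) \<longlongrightarrow> 1) at_top"
    and k: "((\<lambda>t. real (k t) / t) \<longlongrightarrow> 0) at_top"
  shows "((\<lambda>t. (if k t = 0 then 0 else v (k t - 1) t) / v (k t) t) \<longlongrightarrow> 0) at_top"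
proof -
  define R where "R t = (v (k t - 1) t / profile \<alpha> (k t - 1) t) * inverse (v (k t) t / profile \<alpha> (k t) t) * (m * (real (k t) / t))
      * (exp (\<alpha> * (real (k t - 1))\<^sup>2 / t) / exp (\<alpha> * (real (k t))\<^sup>2 / t))" for t
  have "(R \<longlongrightarrow> 1 * inverse 1 * (m * 0) * 1) at_top"
    unfolding R_def by (intro tendsto_intros a b k exp_square_ratio) simp
  then have "(R \<longlongrightarrow> 0) at_top" by simp
  then show ?thesis
  proof (rule Lim_transform_eventually)
    show "eventually (\<lambda>t. R t = (if k t = 0 then 0 else v (k t - 1) t) / v (k t) t) at_top"
      using eventually_gt_at_top[of 0]
    proof eventually_elim
      case (elim t)
      show ?case
      proof (cases "k t")
        case 0 then show ?thesis by (simp add: R_def)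
      next
        case (Suc n)
        have "P (Suc n) t = P n t * (t / (m * real (Suc n)))"
          using elim by (simp add: P_def mult_ac del: of_nat_Suc)
        then have "P (Suc n) t * (m * real (Suc n)) = P n t * t"
          using m_pos by (simp del: of_nat_Suc)
        then have one: "P (Suc n) t / P n t * (m * (real (Suc n) / t)) = 1"
          using elim P_pos[OF elim, of n] by (simp add: field_simps)
        have eq: "(v n t / profile \<alpha> n t) * inverse (v (Suc n) t / profile \<alpha> (Suc n) t)
          * (m * (real (Suc n) / t)) * (exp (\<alpha> * (real n)\<^sup>2 / t) / exp (\<alpha> * (real (Suc n))\<^sup>2 / t))
          = v n t / v (Suc n) t * (P (Suc n) t / P n t * (m * (real (Suc n) / t)))"
          using P_pos[OF elim, of n] P_pos[OF elim, of "Suc n"] m_pos by (simp add: profile_def field_simps del: of_nat_Suc)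
        show ?thesis using eq unfolding R_def one Suc by (simp only: diff_Suc_1 mult_1_right nat.distinct if_False)
      qed
    qed
  qed
qed

end

context prw_nonlattice
begin

text \<open>The mass of \<open>V\<^sub>k\<close> in the window of length \<open>A\<close> before \<open>t\<close> is the average over \<open>V\<^sub>k\<^sub>-\<^sub>1\<close> of masses of windows of \<open>V\<close>, which are
  uniformly bounded. For \<open>k = 0\<close> all mass is at 0, which is outside the window as soon as \<open>A \<le> t\<close>.\<close>

lemma conv_\<nu>_pow_window_le:
  fixes w :: "nat \<Rightarrow> real \<Rightarrow> real"
  defines "w \<equiv> \<lambda>k t. if k = 0 then 0 else v (k - 1) t"
  shows "\<exists>C\<ge>0. \<forall>k t. A \<le> t \<longrightarrow> (conv \<nu> ^^ k) (indicator {0..<A}) t \<le> ennreal (C * w k t)"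
proof -
  obtain C where C: "0 \<le> C" "\<And>t. emeasure \<nu> {t - A<..t} \<le> ennreal C" using window_bound[of A] by blast
  have le: "conv \<nu> (indicator {0..<A}) u \<le> ennreal C * H u" for u
  proof (cases "u < 0")
    case True
    have "emeasure \<nu> {u - A<..u} \<le> emeasure \<nu> {..0}" using True by (intro emeasure_mono) auto
    then show ?thesis using \<nu>_nonpos_null True by (simp add: conv_window)
  next
    case False
    then show ?thesis using C by (simp add: conv_window indicator_def)
  qed
  have "(conv \<nu> ^^ k) (indicator {0..<A}) t \<le> ennreal (C * w k t)" if t: "A \<le> t" for k t
  proof (cases k)
    case 0
    then show ?thesis using t by (simp add: w_def)
  next
    case (Suc n)
    have "(conv \<nu> ^^ k) (indicator {0..<A}) t = (conv \<nu> ^^ n) (conv \<nu> (indicator {0..<A})) t"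
      unfolding Suc funpow_Suc_right by simp
    also have "\<dots> \<le> (conv \<nu> ^^ n) (\<lambda>u. ennreal C * H u) t" by (rule conv_pow_mono) (rule le)
    also have "\<dots> = ennreal C * (conv \<nu> ^^ n) H t" by (rule \<nu>.conv_pow_cmult) simp
    also have "\<dots> = ennreal (C * w k t)"
      using C(1) by (simp add: v_eq[symmetric] w_def Suc ennreal_mult v_nonneg)
    finally show ?thesis .
  qed
  then show ?thesis using C(1) by blast
qed

lemma conv_\<nu>_pow_scaled: "0 \<le> a \<Longrightarrow> (conv \<nu> ^^ k) (\<lambda>u. ennreal (a * indicator {0..} u)) t = ennreal (a * v k t)"
  using \<nu>.conv_pow_cmult[OF H_meas, of k "ennreal a" t]
  by (simp add: v_eq[symmetric] ennreal_mult' ennreal_indicator)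

text \<open>\<open>g * V\<close> lies within \<open>e\<close> of its limit \<open>c\<close> beyond some \<open>A\<close>, and within a constant of it everywhere on the half-line. Averaging over \<open>V\<^sub>k\<close>, the
  second part contributes at most a constant times the mass of a window, which is negligible against \<open>v k t\<close> by \<open>rat\<close>.\<close>

lemma renewal_power_limit:
  fixes k :: "real \<Rightarrow> nat" and g :: "real \<Rightarrow> ennreal"
  assumes [measurable]: "g \<in> borel_measurable borel" and g0: "\<And>u. u < 0 \<Longrightarrow> g u = 0"
    and bd: "\<And>u. conv \<nu> g u \<le> ennreal C" and C0: "0 \<le> C"
    and lim: "((\<lambda>u. enn2real (conv \<nu> g u)) \<longlongrightarrow> c) at_top"
    and rat: "((\<lambda>t. (if k t = 0 then 0 else v (k t - 1) t) / v (k t) t) \<longlongrightarrow> 0) at_top"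
    and vpos: "eventually (\<lambda>t. 0 < v (k t) t) at_top"
  shows "((\<lambda>t. enn2real ((conv \<nu> ^^ Suc (k t)) g t) / v (k t) t) \<longlongrightarrow> c) at_top"
proof -
  define y where "y u = enn2real (conv \<nu> g u)" for u
  have y: "conv \<nu> g u = ennreal (y u)" for u
    using le_less_trans[OF bd[of u] ennreal_less_top] by (simp add: y_def)
  have y0: "0 \<le> y u" "y u \<le> C" for u using bd[of u] C0 unfolding y by (simp_all add: y_def)
  have yneg: "y u = 0" if "u < 0" for u
  proof -
    have "conv \<nu> g u = (\<integral>\<^sup>+ z. 0 \<partial>\<nu>)"
      unfolding conv_def using AE_\<nu> that g0 by (intro nn_integral_cong_AE) (auto elim!: eventually_mono)
    then show ?thesis by (simp add: y_def)
  qed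
  have [measurable]: "y \<in> borel_measurable borel" unfolding y_def[abs_def] by measurable
  have c0: "0 \<le> c" by (rule tendsto_lowerbound[OF lim]) auto
  define N where "N t = enn2real ((conv \<nu> ^^ Suc (k t)) g t)" for t
  have Neq0: "(conv \<nu> ^^ Suc (k t)) g = (conv \<nu> ^^ k t) (\<lambda>u. ennreal (y u))" for t
    unfolding funpow_Suc_right comp_def y ..
  have N: "(conv \<nu> ^^ k t) (\<lambda>u. ennreal (y u)) t = ennreal (N t)" for t
  proof -
    have "(conv \<nu> ^^ k t) (\<lambda>u. ennreal (y u)) t \<le> (conv \<nu> ^^ k t) (\<lambda>u. ennreal (C * indicator {0..} u)) t"
      using yneg y0 by (intro conv_pow_mono ennreal_leI) (auto simp: indicator_def not_le)
    also have "\<dots> < top" using C0 by (simp add: conv_\<nu>_pow_scaled)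
    finally show ?thesis by (simp add: N_def Neq0 del: funpow.simps)
  qed
  have N0: "0 \<le> N t" for t by (simp add: N_def)
  define \<rho> where "\<rho> t = (if k t = 0 then 0 else v (k t - 1) t) / v (k t) t" for t
  have bounds: "\<exists>L. eventually (\<lambda>t. N t / v (k t) t \<le> c + e + L * \<rho> t \<and> c \<le> N t / v (k t) t + e + L * \<rho> t) at_top" if e: "0 < e" for e
  proof -
    have "eventually (\<lambda>u. dist (y u) c < e) at_top" using lim e unfolding y_def[symmetric] by (rule tendstoD)
    then obtain A where A: "\<And>u. A \<le> u \<Longrightarrow> \<bar>y u - c\<bar> < e" by (auto simp: eventually_at_top_linorder dist_real_def)
    obtain C' where C': "0 \<le> C'" "\<And>k t. A \<le> t \<Longrightarrow> (conv \<nu> ^^ k) (indicator {0..<A}) t \<le> ennreal (C' * (if k = 0 then 0 else v (k - 1) t))"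
      using conv_\<nu>_pow_window_le[of A] by blast
    define L where "L = max C c * C'"
    have L0: "0 \<le> max C c" using C0 by simp
    have "eventually (\<lambda>t. N t / v (k t) t \<le> c + e + L * \<rho> t \<and> c \<le> N t / v (k t) t + e + L * \<rho> t) at_top"
      using vpos eventually_ge_at_top[of A]
    proof eventually_elim
      case (elim t)
      let ?w = "if k t = 0 then 0 else v (k t - 1) t"
      let ?err = "\<lambda>u. e * indicator {0..} u + max C c * indicator {0..<A} u :: real"
      have nn: "0 \<le> v (k t) t" "0 \<le> ?w" "0 \<le> C' * ?w" "0 \<le> L * ?w" "0 \<le> e * v (k t) t"
        using v_nonneg L0 C'(1) e by (auto simp: L_def)
      have err: "(conv \<nu> ^^ k t) (\<lambda>u. ennreal (?err u)) t \<le> ennreal (e * v (k t) t + max C c * (C' * ?w))"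
        by (rule \<nu>.conv_pow_affine_bound[where r = "indicator {0..<A}" and q = "\<lambda>u. e * indicator {0..} u"])
           (use e L0 nn C'(2)[OF elim(2), of "k t"] in \<open>auto simp: conv_\<nu>_pow_scaled ennreal_indicator\<close>)
      have "(conv \<nu> ^^ k t) (\<lambda>u. ennreal (y u)) t \<le> ennreal (c * v (k t) t + 1 * (e * v (k t) t + max C c * (C' * ?w)))"
      proof (rule \<nu>.conv_pow_affine_bound[OF _ _ _ _ _ _ _ _ _ err, where q = "\<lambda>u. c * indicator {0..} u"])
        show "y u \<le> c * indicator {0..} u + 1 * ?err u" for u
          using A[of u] y0[of u] yneg[of u] C0 c0 e by (auto simp: indicator_def not_le)
      qed (use c0 e L0 nn in \<open>auto simp: conv_\<nu>_pow_scaled\<close>)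
      then have 1: "N t \<le> (c + e) * v (k t) t + L * ?w"
        unfolding N using c0 nn by (subst (asm) ennreal_le_iff) (auto simp: L_def algebra_simps)
      have "(conv \<nu> ^^ k t) (\<lambda>u. ennreal (c * indicator {0..} u)) t \<le> ennreal (N t + 1 * (e * v (k t) t + max C c * (C' * ?w)))"
      proof (rule \<nu>.conv_pow_affine_bound[OF _ _ _ _ _ _ _ _ _ err, where q = y])
        show "c * indicator {0..} u \<le> y u + 1 * ?err u" for u
          using A[of u] y0[of u] yneg[of u] C0 c0 e by (auto simp: indicator_def not_le)
      qed (use c0 e L0 nn y0 N0 in \<open>auto simp: N\<close>)
      then have 2: "c * v (k t) t \<le> N t + e * v (k t) t + L * ?w"
        using c0 nn N0[of t] by (subst (asm) conv_\<nu>_pow_scaled, simp) (subst (asm) ennreal_le_iff, auto simp: L_def algebra_simps)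
      have "N t / v (k t) t \<le> ((c + e) * v (k t) t + L * ?w) / v (k t) t"
        using 1 elim by (intro divide_right_mono) auto
      moreover have "c * v (k t) t / v (k t) t \<le> (N t + e * v (k t) t + L * ?w) / v (k t) t"
        using 2 elim by (intro divide_right_mono) auto
      ultimately show ?case unfolding \<rho>_def using elim by (simp add: add_divide_distrib)
    qed
    then show ?thesis by blast
  qed
  have \<rho>0: "(\<rho> \<longlongrightarrow> 0) at_top" using rat unfolding \<rho>_def[abs_def] .
  have "((\<lambda>t. N t / v (k t) t) \<longlongrightarrow> c) at_top"
  proof (rule tendstoI)
    fix e :: real assume e: "0 < e"
    obtain L where L: "eventually (\<lambda>t. N t / v (k t) t \<le> c + e / 2 + L * \<rho> t \<and> c \<le> N t / v (k t) t + e / 2 + L * \<rho> t) at_top"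
      using bounds[of "e / 2"] e by auto
    have "((\<lambda>t. L * \<rho> t) \<longlongrightarrow> L * 0) at_top" by (intro tendsto_intros \<rho>0)
    then have "eventually (\<lambda>t. L * \<rho> t < e / 2) at_top" by (rule order_tendstoD) (use e in simp)
    with L show "eventually (\<lambda>t. dist (N t / v (k t) t) c < e) at_top"
      by eventually_elim (simp add: dist_real_def abs_less_iff)
  qed
  then show ?thesis by (simp add: N_def del: funpow.simps)
qed

text \<open>The common end of both cases. The asymptotic assumption on \<open>j - 2\<close> serves to show that the ratio of two consecutive powers tends to 0.\<close>

lemma renewal_power_asymptotics:
  fixes f :: "real \<Rightarrow> real" and j :: "real \<Rightarrow> nat"
  assumes f: "set_borel_measurable borel {0..} f" and f0: "\<And>y. y \<ge> 0 \<Longrightarrow> f y \<ge> 0"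
    and dri: "directly_riemann_integrable f"
    and j1: "\<And>t. t \<ge> 0 \<Longrightarrow> j t \<ge> 1"
    and a: "((\<lambda>t. v (j t - 1) t / profile \<alpha> (j t - 1) t) \<longlongrightarrow> 1) at_top"
    and b: "((\<lambda>t. v (j t - 1 - 1) t / profile \<alpha> (j t - 1 - 1) t) \<longlongrightarrow> 1) at_top"
    and jt: "((\<lambda>t. real (j t) / t) \<longlongrightarrow> 0) at_top"
  defines "c \<equiv> 1 / m * (LINT y:{0..}|lborel. f y)"
  shows "sim_const (\<lambda>t. stieltjes_conv f (Vj (j t)) t) c (\<lambda>t. Vj (j t - 1) t)"
    and "sim_const (\<lambda>t. stieltjes_conv f (Vj (j t)) t) c (\<lambda>t. P (j t - 1) t * exp (\<alpha> * (real (j t))\<^sup>2 / t))"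
proof -
  define k where "k t = j t - 1" for t
  let ?f = "\<lambda>x. ennreal (indicator {0..} x * f x)"
  have fm: "(\<lambda>x. indicator {0..} x * f x) \<in> borel_measurable borel"
    using f by (simp add: set_borel_measurable_def)
  have fm' [measurable]: "?f \<in> borel_measurable borel" using fm by measurable
  obtain C where C: "0 \<le> C" "\<And>t. conv \<nu> ?f t \<le> ennreal C" using key_renewal(1)[OF f f0 dri] by blast
  have lim: "((\<lambda>t. enn2real (conv \<nu> ?f t)) \<longlongrightarrow> c) at_top"
    unfolding c_def by (rule key_renewal(2)[OF f f0 dri])
  have kt: "((\<lambda>t. real (k t) / t) \<longlongrightarrow> 0) at_top"
  proof (rule Lim_null_comparison[OF _ jt])
    show "eventually (\<lambda>t. norm (real (k t) / t) \<le> real (j t) / t) at_top"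
      using eventually_gt_at_top[of 0] by eventually_elim (simp add: k_def divide_right_mono)
  qed
  have a': "((\<lambda>t. v (k t) t / profile \<alpha> (k t) t) \<longlongrightarrow> 1) at_top" using a by (simp add: k_def)
  have b': "((\<lambda>t. v (k t - 1) t / profile \<alpha> (k t - 1) t) \<longlongrightarrow> 1) at_top" using b by (simp add: k_def)
  have rat: "((\<lambda>t. (if k t = 0 then 0 else v (k t - 1) t) / v (k t) t) \<longlongrightarrow> 0) at_top"
    by (rule v_ratio_tendsto_0[OF a' b' kt])
  have vpos: "eventually (\<lambda>t. 0 < v (k t) t) at_top"
  proof -
    have "eventually (\<lambda>t. 0 < v (k t) t / profile \<alpha> (k t) t) at_top" by (rule order_tendstoD(1)[OF a']) simp
    then show ?thesis using eventually_gt_at_top[of 0]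
      by eventually_elim (use profile_pos in \<open>simp add: zero_less_divide_iff less_not_sym\<close>)
  qed
  have L: "((\<lambda>t. enn2real ((conv \<nu> ^^ Suc (k t)) ?f t) / v (k t) t) \<longlongrightarrow> c) at_top"
    by (rule renewal_power_limit[OF fm' _ C(2) C(1) lim rat vpos]) (simp add: indicator_def)
  have num: "stieltjes_conv f (Vj (j t)) t = enn2real ((conv \<nu> ^^ Suc (k t)) ?f t)" if "0 \<le> t" for t
  proof -
    have "j t = Suc (k t)" using j1[OF that] by (simp add: k_def)
    then show ?thesis using stieltjes_conv_Vj[OF f f0, of "k t" t] by simp
  qed
  show "sim_const (\<lambda>t. stieltjes_conv f (Vj (j t)) t) c (\<lambda>t. Vj (j t - 1) t)"
    unfolding sim_const_def
  proof
    show "eventually (\<lambda>t. Vj (j t - 1) t \<noteq> 0) at_top"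
      using vpos eventually_ge_at_top[of 0] by eventually_elim (simp add: v_eq_Vj k_def)
    show "((\<lambda>t. stieltjes_conv f (Vj (j t)) t / Vj (j t - 1) t) \<longlongrightarrow> c) at_top"
      by (rule Lim_transform_eventually[OF L])
         (use eventually_ge_at_top[of 0] in eventually_elim, simp add: num v_eq_Vj k_def del: funpow.simps)
  qed
  show "sim_const (\<lambda>t. stieltjes_conv f (Vj (j t)) t) c (\<lambda>t. P (j t - 1) t * exp (\<alpha> * (real (j t))\<^sup>2 / t))"
    unfolding sim_const_def
  proof
    show "eventually (\<lambda>t. P (j t - 1) t * exp (\<alpha> * (real (j t))\<^sup>2 / t) \<noteq> 0) at_top"
      using eventually_gt_at_top[of 0] by eventually_elim (use P_pos in \<open>simp add: less_imp_neq[symmetric]\<close>)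
    have "((\<lambda>t. enn2real ((conv \<nu> ^^ Suc (k t)) ?f t) / v (k t) t * (v (k t) t / profile \<alpha> (k t) t)
        * (exp (\<alpha> * (real (j t - 1))\<^sup>2 / t) / exp (\<alpha> * (real (j t))\<^sup>2 / t))) \<longlongrightarrow> c * 1 * 1) at_top"
      by (intro tendsto_mult L a' exp_square_ratio jt)
    then have "((\<lambda>t. enn2real ((conv \<nu> ^^ Suc (k t)) ?f t) / v (k t) t * (v (k t) t / profile \<alpha> (k t) t)
        * (exp (\<alpha> * (real (j t - 1))\<^sup>2 / t) / exp (\<alpha> * (real (j t))\<^sup>2 / t))) \<longlongrightarrow> c) at_top"
      by simp
    then show "((\<lambda>t. stieltjes_conv f (Vj (j t)) t / (P (j t - 1) t * exp (\<alpha> * (real (j t))\<^sup>2 / t))) \<longlongrightarrow> c) at_top"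
    proof (rule Lim_transform_eventually)
      show "eventually (\<lambda>t. enn2real ((conv \<nu> ^^ Suc (k t)) ?f t) / v (k t) t * (v (k t) t / profile \<alpha> (k t) t)
        * (exp (\<alpha> * (real (j t - 1))\<^sup>2 / t) / exp (\<alpha> * (real (j t))\<^sup>2 / t))
        = stieltjes_conv f (Vj (j t)) t / (P (j t - 1) t * exp (\<alpha> * (real (j t))\<^sup>2 / t))) at_top"
        using eventually_gt_at_top[of 0] vpos
      proof eventually_elim
        case (elim t)
        then show ?case by (simp add: num profile_def k_def del: funpow.simps)
      qed
    qed
  qed
qed

end

text \<open>All convolution powers of a law on a lattice live on the lattice, which is countable and hence a Lebesgue null set;
  so none of them has an absolutely continuous component.\<close>

lemma (in pos_law) spread_out_imp_nonlattice:
  assumes "spread_out \<mu>"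
  shows "nonlattice \<mu>"
  unfolding nonlattice_def
proof (intro allI impI notI)
  fix d :: real assume "0 < d" and lat: "AE x in \<mu>. x \<in> {d * real n | n. True}"
  define \<Lambda> where "\<Lambda> = {d * real n | n. True}"
  have \<Lambda>r: "\<Lambda> = range (\<lambda>n. d * real n)" by (auto simp: \<Lambda>_def)
  have cnt: "countable \<Lambda>" by (simp add: \<Lambda>r)
  have \<Lambda>b [measurable]: "\<Lambda> \<in> sets borel" by (rule sets.countable[OF _ cnt]) simp
  have cp: "finite_measure (convolution_power \<mu> n) \<and> sets (convolution_power \<mu> n) = sets borel
      \<and> (AE x in convolution_power \<mu> n. x \<in> \<Lambda>)" for n
  proof (induction n)
    case 0
    have "0 \<in> \<Lambda>" by (auto simp: \<Lambda>_def intro: exI[of _ 0])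
    then have "AE x in return borel 0. x \<in> \<Lambda>"
      by (subst AE_return) (use \<Lambda>b in \<open>auto simp: pred_def\<close>)
    moreover have "finite_measure (return borel (0 :: real))"
      by (rule prob_space.finite_measure) (rule prob_space_return, simp)
    ultimately show ?case unfolding convolution_power.simps by (intro conjI) (assumption | rule sets_return)+
  next
    case (Suc n)
    let ?N = "convolution_power \<mu> n"
    have N: "finite_measure ?N" "sets ?N = sets borel" "AE x in ?N. x \<in> \<Lambda>" using Suc by auto
    have fin: "finite_measure (\<mu> \<star> ?N)" by (rule convolution_finite) (use N finite_measure_axioms in auto)
    have "emeasure (\<mu> \<star> ?N) (UNIV - \<Lambda>) = (\<integral>\<^sup>+ x. indicator (UNIV - \<Lambda>) x \<partial>(\<mu> \<star> ?N))"
      by (rule nn_integral_indicator[symmetric]) simp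
    also have "\<dots> = (\<integral>\<^sup>+ x. \<integral>\<^sup>+ y. indicator (UNIV - \<Lambda>) (x + y) \<partial>?N \<partial>\<mu>)"
      by (rule nn_integral_convolution) (use N finite_measure_axioms in auto)
    also have "\<dots> = (\<integral>\<^sup>+ x. 0 \<partial>\<mu>)"
    proof (rule nn_integral_cong_AE)
      show "AE x in \<mu>. (\<integral>\<^sup>+ y. indicator (UNIV - \<Lambda>) (x + y) \<partial>?N) = 0"
        using lat[folded \<Lambda>_def]
      proof eventually_elim
        case (elim x)
        have "AE y in ?N. indicator (UNIV - \<Lambda>) (x + y) = (0 :: ennreal)"
          using N(3)
        proof eventually_elim
          case (elim y)
          then obtain p q where "x = d * real p" "y = d * real q" using \<open>x \<in> \<Lambda>\<close> by (auto simp: \<Lambda>_def)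
          then have "x + y = d * real (p + q)" by (simp add: distrib_left)
          then have "x + y \<in> \<Lambda>" unfolding \<Lambda>_def by blast
          then show ?case by simp
        qed
        then have "(\<integral>\<^sup>+ y. indicator (UNIV - \<Lambda>) (x + y) \<partial>?N) = (\<integral>\<^sup>+ y. 0 \<partial>?N)" by (rule nn_integral_cong_AE)
        then show ?case by simp
      qed
    qed
    finally have z: "emeasure (\<mu> \<star> ?N) (UNIV - \<Lambda>) = 0" by simp
    have "AE x in \<mu> \<star> ?N. x \<in> \<Lambda>"
      by (rule AE_I[OF _ z]) auto
    then show ?case using fin unfolding convolution_power.simps by (intro conjI) simp_all
  qed
  obtain n where "has_ac_component (convolution_power \<mu> n)" using assms by (auto simp: spread_out_def)
  then obtain \<alpha> \<sigma> where \<alpha>: "sets \<alpha> = sets borel"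
      "\<forall>A\<in>sets borel. emeasure (convolution_power \<mu> n) A = emeasure \<alpha> A + emeasure \<sigma> A"
      "absolutely_continuous lborel \<alpha>" "emeasure \<alpha> UNIV > 0"
    unfolding has_ac_component_def by blast
  have "\<Lambda> \<in> null_sets lborel" using countable_imp_null_set_lborel[OF cnt] .
  then have n1: "emeasure \<alpha> \<Lambda> = 0" using \<alpha>(3) by (auto simp: absolutely_continuous_def)
  have "emeasure (convolution_power \<mu> n) (UNIV - \<Lambda>) = 0"
  proof -
    have "AE x in convolution_power \<mu> n. x \<notin> UNIV - \<Lambda>" using cp[of n] by simp
    moreover have "UNIV - \<Lambda> \<in> sets (convolution_power \<mu> n)" using cp[of n] \<Lambda>b by (metis Diff_UNIV sets.Diff sets.top space_borel)
    ultimately show ?thesis by (subst (asm) AE_iff_null_sets[symmetric]) auto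
  qed
  then have n2: "emeasure \<alpha> (UNIV - \<Lambda>) = 0" using \<alpha>(2) by simp
  have "emeasure \<alpha> UNIV \<le> emeasure \<alpha> \<Lambda> + emeasure \<alpha> (UNIV - \<Lambda>)"
    using emeasure_subadditive[of \<Lambda> \<alpha> "UNIV - \<Lambda>"] \<alpha>(1) by simp
  then show False using n1 n2 \<alpha>(4) by simp
qed

context prw_finite_mean
begin

lemma nn_integral_id_below: "0 \<le> z \<Longrightarrow> (\<integral>\<^sup>+ x. ennreal x * (if 0 \<le> x \<and> x < z then 1 else 0) \<partial>lborel) = ennreal (z\<^sup>2 / 2)"
proof -
  assume z: "0 \<le> z"
  have "AE x in lborel. x \<noteq> z" by (rule AE_lborel_singleton)
  then have "(\<integral>\<^sup>+ x. ennreal x * (if 0 \<le> x \<and> x < z then 1 else 0) \<partial>lborel) = (\<integral>\<^sup>+ x. ennreal x * indicator {0..z} x \<partial>lborel)"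
    by (intro nn_integral_cong_AE) (auto simp: indicator_def elim!: eventually_mono)
  also have "\<dots> = ennreal (z\<^sup>2 / 2 - 0\<^sup>2 / 2)"
    by (rule nn_integral_FTC_Icc) (use z in \<open>auto intro!: derivative_eq_intros\<close>)
  finally show ?thesis by simp
qed

text \<open>The mean of \<open>x\<close> under \<open>F0\<close> is \<open>1 / m\<close> times the mean of the integral of \<open>x\<close> from 0 to \<open>\<xi>\<close>.\<close>

lemma F0_first_moment:
  assumes i: "integrable M (\<lambda>\<omega>. \<xi> \<omega> ^ 2)"
  shows "(LINT x|F0. x) = (LINT \<omega>|M. \<xi> \<omega> ^ 2) / (2 * m)"
proof -
  let ?E = "LINT \<omega>|M. \<xi> \<omega> ^ 2"
  have E0: "0 \<le> ?E" by (rule integral_nonneg_AE) simp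
  have "(LINT x|F0. x) = enn2real (\<integral>\<^sup>+ x. ennreal x \<partial>F0)"
    by (rule integral_eq_nn_integral) (use F0.nonneg in auto)
  also have "(\<integral>\<^sup>+ x. ennreal x \<partial>F0) = ennreal (1 / m) * (\<integral>\<^sup>+ z. \<integral>\<^sup>+ x. ennreal x * (if 0 \<le> x \<and> x < z then 1 else 0) \<partial>lborel \<partial>F)"
    by (rule nn_integral_F0) simp
  also have "(\<integral>\<^sup>+ z. \<integral>\<^sup>+ x. ennreal x * (if 0 \<le> x \<and> x < z then 1 else 0) \<partial>lborel \<partial>F) = (\<integral>\<^sup>+ z. ennreal (z\<^sup>2 / 2) \<partial>F)"
    using F.nonneg by (intro nn_integral_cong_AE) (auto simp: nn_integral_id_below elim!: eventually_mono)
  also have "\<dots> = (\<integral>\<^sup>+ \<omega>. ennreal (\<xi> \<omega> ^ 2 / 2) \<partial>M)" by (simp add: nn_integral_distr)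
  also have "\<dots> = ennreal (LINT \<omega>|M. \<xi> \<omega> ^ 2 / 2)" using i by (intro nn_integral_eq_integral) auto
  also have "ennreal (1 / m) * \<dots> = ennreal (?E / (2 * m))"
    using m_pos by (simp add: ennreal_mult'[symmetric] mult.commute)
  finally show ?thesis using E0 m_pos by simp
qed

lemma F0_second_moment:
  assumes i: "integrable M (\<lambda>\<omega>. \<xi> \<omega> ^ 3)"
  shows "integrable F0 (\<lambda>x. x\<^sup>2)"
proof (rule integrableI_bounded)
  have "(\<integral>\<^sup>+ x. ennreal (norm (x\<^sup>2)) \<partial>F0) = ennreal (1 / m) * (\<integral>\<^sup>+ z. \<integral>\<^sup>+ x. ennreal (x\<^sup>2) * (if 0 \<le> x \<and> x < z then 1 else 0) \<partial>lborel \<partial>F)"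
    by (subst nn_integral_F0) simp_all
  also have "(\<integral>\<^sup>+ z. \<integral>\<^sup>+ x. ennreal (x\<^sup>2) * (if 0 \<le> x \<and> x < z then 1 else 0) \<partial>lborel \<partial>F) \<le> (\<integral>\<^sup>+ z. ennreal (z ^ 3) \<partial>F)"
  proof (rule nn_integral_mono_AE)
    show "AE z in F. (\<integral>\<^sup>+ x. ennreal (x\<^sup>2) * (if 0 \<le> x \<and> x < z then 1 else 0) \<partial>lborel) \<le> ennreal (z ^ 3)"
      using F.nonneg
    proof eventually_elim
      case (elim z)
      have "(\<integral>\<^sup>+ x. ennreal (x\<^sup>2) * (if 0 \<le> x \<and> x < z then 1 else 0) \<partial>lborel) \<le> (\<integral>\<^sup>+ x. ennreal (z\<^sup>2) * indicator {0..<z} x \<partial>lborel)"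
        by (intro nn_integral_mono) (auto simp: indicator_def intro!: ennreal_leI power_mono)
      also have "\<dots> = ennreal (z\<^sup>2) * ennreal z" using elim by (subst nn_integral_cmult_indicator) auto
      also have "\<dots> = ennreal (z ^ 3)" by (simp add: ennreal_mult'[symmetric] power2_eq_square power3_eq_cube)
      finally show ?case .
    qed
  qed
  also have "(\<integral>\<^sup>+ z. ennreal (z ^ 3) \<partial>F) = (\<integral>\<^sup>+ \<omega>. ennreal (\<xi> \<omega> ^ 3) \<partial>M)" by (simp add: nn_integral_distr)
  also have "\<dots> = ennreal (LINT \<omega>|M. \<xi> \<omega> ^ 3)"
    using xi_pos by (intro nn_integral_eq_integral i) (auto elim!: eventually_mono)
  finally have "(\<integral>\<^sup>+ x. ennreal (norm (x\<^sup>2)) \<partial>F0) \<le> ennreal (1 / m) * ennreal (LINT \<omega>|M. \<xi> \<omega> ^ 3)"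
    by (simp add: mult_left_mono)
  then show "(\<integral>\<^sup>+ x. ennreal (norm (x\<^sup>2)) \<partial>F0) < \<infinity>"
    by (rule le_less_trans) (simp add: ennreal_mult_less_top)
qed simp

end

lemma sim_const_cong:
  assumes "eventually (\<lambda>t. w t = w' t) at_top" "sim_const u c w"
  shows "sim_const u c w'"
proof -
  have "eventually (\<lambda>t. w' t \<noteq> 0) at_top"
    using assms unfolding sim_const_def by (auto elim: eventually_elim2)
  moreover have "((\<lambda>t. u t / w' t) \<longlongrightarrow> c) at_top"
  proof (rule Lim_transform_eventually)
    show "((\<lambda>t. u t / w t) \<longlongrightarrow> c) at_top" using assms(2) by (simp add: sim_const_def)
    show "eventually (\<lambda>t. u t / w t = u t / w' t) at_top" using assms(1) by eventually_elim simp
  qed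
  ultimately show ?thesis by (simp add: sim_const_def)
qed

context prw_setup
begin

lemma nonlattice_asymptotics:
  fixes f :: "real \<Rightarrow> real" and j :: "real \<Rightarrow> nat"
  assumes f: "set_borel_measurable borel {0..} f" and f0: "\<And>y. y \<ge> 0 \<Longrightarrow> f y \<ge> 0"
    and dri: "directly_riemann_integrable f"
    and j1: "\<And>t. t \<ge> 0 \<Longrightarrow> j t \<ge> 1"
    and na: "nonlattice_assms M \<xi> \<eta> j"
  defines "\<mu> \<equiv> LINT \<omega>|M. \<xi> \<omega>"
  shows "sim_const (\<lambda>t. stieltjes_conv f (Vj (j t)) t) (1 / \<mu> * (LINT y:{0..}|lborel. f y)) (\<lambda>t. Vj (j t - 1) t)"
    and "sim_const (\<lambda>t. stieltjes_conv f (Vj (j t)) t) (1 / \<mu> * (LINT y:{0..}|lborel. f y))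
      (\<lambda>t. t ^ (j t - 1) / (\<mu> ^ (j t - 1) * fact (j t - 1)))"
proof -
  have nl: "nonlattice F" using na by (simp add: nonlattice_assms_def)
  interpret prw_nonlattice M \<xi> \<eta> xi eta
    using integrable_of_nonlattice_assms[OF na] nl by unfold_locales
  have \<mu>: "\<mu> = m" by (simp add: \<mu>_def m_def)
  obtain r where disj: "(1 < r \<and> r \<le> 2 \<and> integrable M (\<lambda>\<omega>. \<xi> \<omega> powr r)) \<or>
         (1 < r \<and> r < 2 \<and> (\<exists>b>0. sim_const (\<lambda>t. measure M {\<omega>\<in>space M. \<xi> \<omega> > t}) b (\<lambda>t. t powr (- r))))"
      and eta: "(\<lambda>t. LINT \<omega>|M. min (\<eta> \<omega>) t) \<in> O[at_top](\<lambda>t. t powr (2 - r))"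
      and jo: "(\<lambda>t. real (j t)) \<in> o[at_top](\<lambda>t. t powr ((r - 1) / 2))"
    using na unfolding nonlattice_assms_def by blast
  have r: "1 < r" "r \<le> 2" using disj by linarith+
  have d: "integrable M (\<lambda>\<omega>. \<xi> \<omega> powr r) \<or>
      (r < 2 \<and> (\<exists>b>0. sim_const (\<lambda>t. measure M {\<omega>\<in>space M. \<xi> \<omega> > t}) b (\<lambda>t. t powr (- r))))"
    using disj by blast
  have "\<exists>C\<ge>0. \<forall>t>0. F0.trunc_mean t \<le> C * t powr (2 - r)"
    using d
  proof (elim disjE conjE exE)
    assume "integrable M (\<lambda>\<omega>. \<xi> \<omega> powr r)"
    then show ?thesis by (rule trunc_mean_F0_moment[OF r])
  next
    fix b assume "r < 2" and b: "0 < b" "sim_const (\<lambda>t. measure M {\<omega>\<in>space M. \<xi> \<omega> > t}) b (\<lambda>t. t powr (- r))"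
    obtain A where "0 < A" "\<And>x. 0 < x \<Longrightarrow> tail x \<le> A * x powr (- r)"
      using regular_tail_bound[OF b r(1)] by blast
    then show ?thesis by (rule trunc_mean_F0_tail[OF r(1) \<open>r < 2\<close>])
  qed
  then obtain CX where CX: "\<And>t. 0 < t \<Longrightarrow> F0.trunc_mean t \<le> CX * t powr (2 - r)" by blast
  have CX': "eventually (\<lambda>t. F0.trunc_mean t \<le> CX * t powr (2 - r)) at_top"
    using eventually_gt_at_top[of 0] by eventually_elim (rule CX)
  obtain CE where "eventually (\<lambda>t. norm (LINT \<omega>|M. min (\<eta> \<omega>) t) \<le> CE * norm (t powr (2 - r))) at_top"
    using landau_o.bigE[OF eta] by blast
  then have CE: "eventually (\<lambda>t. G.trunc_mean t \<le> CE * t powr (2 - r)) at_top"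
    by eventually_elim (simp add: trunc_mean_G)
  have jlim: "((\<lambda>t. real (j t) / t powr ((r - 1) / 2)) \<longlongrightarrow> 0) at_top" by (rule smalloD_tendsto[OF jo])
  have klim: "((\<lambda>t. real (k t) / t powr ((r - 1) / 2)) \<longlongrightarrow> 0) at_top" if "\<And>t. k t \<le> j t" for k :: "real \<Rightarrow> nat"
    by (rule Lim_null_comparison[OF _ jlim]) (use that in \<open>auto intro!: always_eventually divide_right_mono\<close>)
  have vP: "((\<lambda>t. v (k t) t / profile 0 (k t) t) \<longlongrightarrow> 1) at_top" if "\<And>t. k t \<le> j t" for k
  proof -
    have "((\<lambda>t. v (k t) t / P (k t) t) \<longlongrightarrow> 1) at_top"
      by (intro v_asymp_truncated_mean square_trunc_mean_tendsto_0[where T = 0, OF F0.trunc_mean_nonneg CX' klim]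
          square_trunc_mean_tendsto_0[where T = 0, OF G.trunc_mean_nonneg CE klim] that)
    then show ?thesis by (simp add: profile_def)
  qed
  have jt: "((\<lambda>t. real (j t) / t) \<longlongrightarrow> 0) at_top"
  proof (rule Lim_null_comparison[OF _ jlim])
    show "eventually (\<lambda>t. norm (real (j t) / t) \<le> real (j t) / t powr ((r - 1) / 2)) at_top"
      using eventually_ge_at_top[of 1]
    proof eventually_elim
      case (elim t)
      have "t powr ((r - 1) / 2) \<le> t powr 1" using elim r by (intro powr_mono) auto
      then show ?case using elim by (auto intro!: divide_left_mono)
    qed
  qed
  note main = renewal_power_asymptotics[OF f f0 dri j1 vP vP jt]
  show "sim_const (\<lambda>t. stieltjes_conv f (Vj (j t)) t) (1 / \<mu> * (LINT y:{0..}|lborel. f y)) (\<lambda>t. Vj (j t - 1) t)"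
    unfolding \<mu> by (rule main(1)) auto
  have s2: "sim_const (\<lambda>t. stieltjes_conv f (Vj (j t)) t) (1 / m * (LINT y:{0..}|lborel. f y)) (\<lambda>t. P (j t - 1) t * exp (0 * (real (j t))\<^sup>2 / t))"
    by (rule main(2)) auto
  have eq: "eventually (\<lambda>t. P (j t - 1) t * exp (0 * (real (j t))\<^sup>2 / t) = t ^ (j t - 1) / (m ^ (j t - 1) * fact (j t - 1))) at_top"
    using eventually_ge_at_top[of 0] by eventually_elim (simp add: P_def)
  show "sim_const (\<lambda>t. stieltjes_conv f (Vj (j t)) t) (1 / \<mu> * (LINT y:{0..}|lborel. f y))
      (\<lambda>t. t ^ (j t - 1) / (\<mu> ^ (j t - 1) * fact (j t - 1)))"
    unfolding \<mu> using s2 by (rule sim_const_cong[OF eq])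
qed

lemma integrable_of_cube:
  assumes "integrable M (\<lambda>\<omega>. \<xi> \<omega> ^ 3)" and "k \<le> 3"
  shows "integrable M (\<lambda>\<omega>. \<xi> \<omega> ^ k)"
proof (rule Bochner_Integration.integrable_bound[of _ "\<lambda>\<omega>. 1 + \<xi> \<omega> ^ 3"])
  show "AE \<omega> in M. norm (\<xi> \<omega> ^ k) \<le> norm (1 + \<xi> \<omega> ^ 3)"
    using xi_pos
  proof eventually_elim
    case (elim \<omega>)
    have "\<xi> \<omega> ^ k \<le> 1 + \<xi> \<omega> ^ 3"
    proof (cases "\<xi> \<omega> \<le> 1")
      case True
      then have "\<xi> \<omega> ^ k \<le> 1" using elim by (intro power_le_one) auto
      moreover have "0 \<le> \<xi> \<omega> ^ 3" using elim by simp
      ultimately show ?thesis by linarith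
    next
      case False
      then have "\<xi> \<omega> ^ k \<le> \<xi> \<omega> ^ 3" using assms(2) by (intro power_increasing) auto
      then show ?thesis by simp
    qed
    then show ?case using elim by simp
  qed
qed (use assms in auto)

lemma spread_out_asymptotics:
  fixes f :: "real \<Rightarrow> real" and j :: "real \<Rightarrow> nat"
  assumes f: "set_borel_measurable borel {0..} f" and f0: "\<And>y. y \<ge> 0 \<Longrightarrow> f y \<ge> 0"
    and dri: "directly_riemann_integrable f"
    and j1: "\<And>t. t \<ge> 0 \<Longrightarrow> j t \<ge> 1"
    and so: "spread_out_assms M \<xi> \<eta> j"
  defines "\<mu> \<equiv> LINT \<omega>|M. \<xi> \<omega>"
  shows "integrable M \<xi>"
    and "sim_const (\<lambda>t. stieltjes_conv f (Vj (j t)) t) (1 / \<mu> * (LINT y:{0..}|lborel. f y)) (\<lambda>t. Vj (j t - 1) t)"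
    and "sim_const (\<lambda>t. stieltjes_conv f (Vj (j t)) t) (1 / \<mu> * (LINT y:{0..}|lborel. f y))
      (\<lambda>t. t ^ (j t - 1) / (\<mu> ^ (j t - 1) * fact (j t - 1)) *
         exp (((LINT \<omega>|M. \<xi> \<omega> ^ 2) / (2 * \<mu> ^ 2) - (LINT \<omega>|M. \<eta> \<omega>) / \<mu>) * \<mu> * (real (j t))\<^sup>2 / t))"
proof -
  have c: "integrable M (\<lambda>\<omega>. \<xi> \<omega> ^ 3)" and e: "integrable M (\<lambda>\<omega>. \<eta> \<omega> ^ 2)"
    and jo: "(\<lambda>t. real (j t)) \<in> o[at_top](\<lambda>t. t powr (2 / 3))"
    using so by (auto simp: spread_out_assms_def)
  have nl: "nonlattice F" using so by (intro F.spread_out_imp_nonlattice) (simp add: spread_out_assms_def)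
  show i: "integrable M \<xi>" using integrable_of_cube[OF c, of 1] by simp
  interpret prw_nonlattice M \<xi> \<eta> xi eta using i nl by unfold_locales
  interpret prw_second_moment M \<xi> \<eta> xi eta
  proof
    show "integrable F0 (\<lambda>x. x\<^sup>2)" by (rule F0_second_moment[OF c])
    show "integrable G (\<lambda>x. x\<^sup>2)" using e by (subst integrable_distr_eq) auto
  qed
  have \<mu>: "\<mu> = m" by (simp add: \<mu>_def m_def)
  have "F0.mean = (LINT \<omega>|M. \<xi> \<omega> ^ 2) / (2 * m)"
    unfolding F0.mean_def by (rule F0_first_moment) (rule integrable_of_cube[OF c], simp)
  moreover have "G.mean = (LINT \<omega>|M. \<eta> \<omega>)" unfolding G.mean_def by (subst integral_distr) auto
  ultimately have shift: "shift = ((LINT \<omega>|M. \<xi> \<omega> ^ 2) / (2 * m ^ 2) - (LINT \<omega>|M. \<eta> \<omega>) / m) * m"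
    using m_pos by (simp add: shift_def field_simps power2_eq_square)
  have jlim: "((\<lambda>t. real (j t) / t powr (2 / 3)) \<longlongrightarrow> 0) at_top" by (rule smalloD_tendsto[OF jo])
  have "((\<lambda>t. (real (j t) / t powr (2 / 3)) ^ 3) \<longlongrightarrow> 0 ^ 3) at_top" by (intro tendsto_power jlim)
  then have j3: "((\<lambda>t. (real (j t) / t powr (2 / 3)) ^ 3) \<longlongrightarrow> 0) at_top" by simp
  have k3: "((\<lambda>t. real (k t) ^ 3 / t\<^sup>2) \<longlongrightarrow> 0) at_top" if k: "\<And>t. k t \<le> j t" for k :: "real \<Rightarrow> nat"
  proof (rule Lim_null_comparison[OF _ j3])
    show "eventually (\<lambda>t. norm (real (k t) ^ 3 / t\<^sup>2) \<le> (real (j t) / t powr (2 / 3)) ^ 3) at_top"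
      using eventually_gt_at_top[of 0]
    proof eventually_elim
      case (elim t)
      have "(t powr (2 / 3)) ^ 3 = (t powr (2 / 3)) powr real 3" using elim by (intro powr_realpow[symmetric]) simp
      also have "\<dots> = t powr real 2" by (simp add: powr_powr)
      also have "\<dots> = t\<^sup>2" using elim by (intro powr_realpow)
      finally have "(real (j t) / t powr (2 / 3)) ^ 3 = real (j t) ^ 3 / t\<^sup>2" by (simp add: power_divide)
      moreover have "real (k t) ^ 3 / t\<^sup>2 \<le> real (j t) ^ 3 / t\<^sup>2"
        using k[of t] by (intro divide_right_mono power_mono) auto
      ultimately show ?case by simp
    qed
  qed
  have vD: "((\<lambda>t. v (k t) t / profile shift (k t) t) \<longlongrightarrow> 1) at_top" if "\<And>t. k t \<le> j t" for k
    using v_asymp_second_moment[OF k3[OF that]] by simp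
  have jt: "((\<lambda>t. real (j t) / t) \<longlongrightarrow> 0) at_top"
  proof (rule Lim_null_comparison[OF _ jlim])
    show "eventually (\<lambda>t. norm (real (j t) / t) \<le> real (j t) / t powr (2 / 3)) at_top"
      using eventually_ge_at_top[of 1]
    proof eventually_elim
      case (elim t)
      have "t powr (2 / 3) \<le> t powr 1" using elim by (intro powr_mono) auto
      then show ?case using elim by (auto intro!: divide_left_mono)
    qed
  qed
  note main = renewal_power_asymptotics[OF f f0 dri j1 vD vD jt]
  show "sim_const (\<lambda>t. stieltjes_conv f (Vj (j t)) t) (1 / \<mu> * (LINT y:{0..}|lborel. f y)) (\<lambda>t. Vj (j t - 1) t)"
    unfolding \<mu> by (rule main(1)) auto
  have s2: "sim_const (\<lambda>t. stieltjes_conv f (Vj (j t)) t) (1 / m * (LINT y:{0..}|lborel. f y)) (\<lambda>t. P (j t - 1) t * exp (shift * (real (j t))\<^sup>2 / t))"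
    by (rule main(2)) auto
  have eq: "eventually (\<lambda>t. P (j t - 1) t * exp (shift * (real (j t))\<^sup>2 / t)
      = t ^ (j t - 1) / (m ^ (j t - 1) * fact (j t - 1)) *
         exp (((LINT \<omega>|M. \<xi> \<omega> ^ 2) / (2 * m ^ 2) - (LINT \<omega>|M. \<eta> \<omega>) / m) * m * (real (j t))\<^sup>2 / t)) at_top"
    using eventually_ge_at_top[of 0] by eventually_elim (simp add: P_def shift)
  show "sim_const (\<lambda>t. stieltjes_conv f (Vj (j t)) t) (1 / \<mu> * (LINT y:{0..}|lborel. f y))
      (\<lambda>t. t ^ (j t - 1) / (\<mu> ^ (j t - 1) * fact (j t - 1)) *
         exp (((LINT \<omega>|M. \<xi> \<omega> ^ 2) / (2 * \<mu> ^ 2) - (LINT \<omega>|M. \<eta> \<omega>) / \<mu>) * \<mu> * (real (j t))\<^sup>2 / t))"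
    unfolding \<mu> using s2 by (rule sim_const_cong[OF eq])
qed

end

text \<open>The two cases share the first asymptotic relation, so it is obtained from whichever set of assumptions holds.\<close>

theorem theorem2p7:
  fixes M :: "'a measure"
    and \<xi> \<eta> :: "'a \<Rightarrow> real"
    and xi eta :: "nat \<Rightarrow> 'a \<Rightarrow> real"
    and f :: "real \<Rightarrow> real"
    and j :: "real \<Rightarrow> nat"
  assumes "prob_space M"
    and "\<xi> \<in> borel_measurable M" and "\<eta> \<in> borel_measurable M"
    and "AE \<omega> in M. \<xi> \<omega> > 0" and "AE \<omega> in M. \<eta> \<omega> > 0"
    and "prob_space.indep_vars M (\<lambda>_. borel) (\<lambda>i \<omega>. (xi i \<omega>, eta i \<omega>)) {1..}"
    and "\<And>i. i \<ge> 1 \<Longrightarrow>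
           distr M borel (\<lambda>\<omega>. (xi i \<omega>, eta i \<omega>)) = distr M borel (\<lambda>\<omega>. (\<xi> \<omega>, \<eta> \<omega>))"
    and "set_borel_measurable borel {0..} f" and "\<And>y. y \<ge> 0 \<Longrightarrow> f y \<ge> 0"
    and "directly_riemann_integrable f"
    and "\<And>t. t \<ge> 0 \<Longrightarrow> j t \<ge> 1"
    and "nonlattice_assms M \<xi> \<eta> j \<or> spread_out_assms M \<xi> \<eta> j"
  shows "let m = (LINT \<omega>|M. \<xi> \<omega>);
             \<gamma>\<^sub>0 = (LINT \<omega>|M. \<xi> \<omega> ^ 2) / (2 * m ^ 2) - (LINT \<omega>|M. \<eta> \<omega>) / m;
             Vj = stieltjes_conv_power (prw_mean M xi eta);
             c = 1 / m * (LINT y:{0..}|lborel. f y)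
         in integrable M \<xi> \<and>
            sim_const (\<lambda>t. stieltjes_conv f (Vj (j t)) t) c (\<lambda>t. Vj (j t - 1) t) \<and>
            (nonlattice_assms M \<xi> \<eta> j \<longrightarrow>
              sim_const (\<lambda>t. stieltjes_conv f (Vj (j t)) t) c
                (\<lambda>t. t ^ (j t - 1) / (m ^ (j t - 1) * fact (j t - 1)))) \<and>
            (spread_out_assms M \<xi> \<eta> j \<longrightarrow>
              sim_const (\<lambda>t. stieltjes_conv f (Vj (j t)) t) c
                (\<lambda>t. t ^ (j t - 1) / (m ^ (j t - 1) * fact (j t - 1)) *
                     exp (\<gamma>\<^sub>0 * m * (real (j t))\<^sup>2 / t)))"
proof -
  interpret prw_setup M \<xi> \<eta> xi eta
    by (intro prw_setup.intro prw_setup_axioms.intro assms(1-7))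
  have int: "integrable M \<xi>"
    using assms(12)
  proof
    assume "nonlattice_assms M \<xi> \<eta> j"
    then show ?thesis by (rule integrable_of_nonlattice_assms)
  next
    assume "spread_out_assms M \<xi> \<eta> j"
    show ?thesis by (rule spread_out_asymptotics(1)) fact+
  qed
  have sim: "sim_const (\<lambda>t. stieltjes_conv f (Vj (j t)) t)
      (1 / (LINT \<omega>|M. \<xi> \<omega>) * (LINT y:{0..}|lborel. f y)) (\<lambda>t. Vj (j t - 1) t)"
    using assms(12)
  proof
    assume "nonlattice_assms M \<xi> \<eta> j"
    show ?thesis by (rule nonlattice_asymptotics(1)) fact+
  next
    assume "spread_out_assms M \<xi> \<eta> j"
    show ?thesis by (rule spread_out_asymptotics(2)) fact+
  qed
  show ?thesis
    unfolding Let_def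
  proof (intro conjI impI int sim)
    assume "nonlattice_assms M \<xi> \<eta> j"
    show "sim_const (\<lambda>t. stieltjes_conv f (Vj (j t)) t) (1 / (LINT \<omega>|M. \<xi> \<omega>) * (LINT y:{0..}|lborel. f y))
        (\<lambda>t. t ^ (j t - 1) / ((LINT \<omega>|M. \<xi> \<omega>) ^ (j t - 1) * fact (j t - 1)))"
      by (rule nonlattice_asymptotics(2)) fact+
  next
    assume "spread_out_assms M \<xi> \<eta> j"
    show "sim_const (\<lambda>t. stieltjes_conv f (Vj (j t)) t) (1 / (LINT \<omega>|M. \<xi> \<omega>) * (LINT y:{0..}|lborel. f y))
        (\<lambda>t. t ^ (j t - 1) / ((LINT \<omega>|M. \<xi> \<omega>) ^ (j t - 1) * fact (j t - 1)) *
          exp (((LINT \<omega>|M. \<xi> \<omega> ^ 2) / (2 * (LINT \<omega>|M. \<xi> \<omega>) ^ 2) - (LINT \<omega>|M. \<eta> \<omega>) / (LINT \<omega>|M. \<xi> \<omega>))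
            * (LINT \<omega>|M. \<xi> \<omega>) * (real (j t))\<^sup>2 / t))"
      by (rule spread_out_asymptotics(3)) fact+
  qed
qed

end
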